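(* Let $n\ge 3$ be an integer, $q>2^*$, $K_1<0$ and $K_2>0$, and consider the equation $$u''+\frac{n-1}{r}u'+k(r)\,u|u|^{q-2}=0,\qquad k(r)=\begin{cases}K_1 & r\le 1,\\ K_2 & r>1.\end{cases}$$ Then there is an increasing sequence of positive numbers $(D_k)_{k\ge 0}$ converging to some $D_\infty<\infty$ such that: (i) $u(r,D_0)$ is a ground state with fast decay, and for any $k\in\mathbb N$, $u(r,D_k)$ is a regular fast decay solution with exactly $k$ nondegenerate zeroes; (ii) $u(r,d)$ is a ground state with slow decay for any $0<d<D_0$; (iii) for any $k\ge 1$, $u(r,d)$ is a regular slow decay solution with exactly $k$ nondegenerate zeroes whenever $D_{k-1}<d<D_k$.
   Context: $2^*=\frac{2n}{n-2}$. Solutions are understood as $C^1$ functions satisfying the equation for $r\neq 1$. For $d\in\mathbb R$, $u(r,d)$ denotes the regular solution, i.e. the solution with $u(0,d)=d$, $u'(0,d)=0$. A solution defined for large $r$ is a fast decay solution if $\lim_{r\to\infty}u(r)r^{n-2}=L$ for some $L\in\mathbb R$, and a slow decay solution if $\lim_{r\to\infty}u(r)r^{n-2}=+\infty$ (or $-\infty$, for solutions that are negative for large $r$). A ground state is a regular solution that is defined and positive for all $r>0$ and satisfies $\lim_{r\to\infty}u(r)=0$. A zero $r_0>0$ of $u$ is nondegenerate if $u'(r_0)\neq0$; "exactly $k$ nondegenerate zeroes" means that $u$ has exactly $k$ zeroes in $(0,\infty)$ and they are all nondegenerate. $\mathbb N$ contains $0$. *)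

theory Defs
  imports "HOL-Analysis.Analysis"
begin

definition k_coeff :: "real \<Rightarrow> real \<Rightarrow> real \<Rightarrow> real" where
  "k_coeff K1 K2 r = (if r \<le> 1 then K1 else K2)"

text \<open>
  \<open>radial_solution n q K1 K2 I u\<close>: the restriction of \<open>u\<close> to the interval \<open>I \<subseteq> [0,\<infinity>)\<close> is a solution
  of class \<open>C\<^sup>1\<close>, where \<open>v\<close> plays the role of \<open>u'\<close>. The derivative \<open>u'\<close> is taken within \<open>I\<close>, hence
  it is one-sided at \<open>0\<close> if \<open>0 \<in> I\<close>. The equation is required for \<open>r \<noteq> 1\<close> and, being
  singular there, not at \<open>r = 0\<close>; the intervals used below are such that all their points
  except possibly \<open>0\<close> are interior. The value of \<open>powr\<close> at \<open>0\<close> is \<open>0\<close>, which is the right convention as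
  \<open>q > 2\<close>.
\<close>

definition radial_solution ::
  "nat \<Rightarrow> real \<Rightarrow> real \<Rightarrow> real \<Rightarrow> real set \<Rightarrow> (real \<Rightarrow> real) \<Rightarrow> bool" where
  "radial_solution n q K1 K2 I u \<longleftrightarrow>
     I \<subseteq> {0..} \<and>
     (\<exists>v. (\<forall>r\<in>I. (u has_real_derivative v r) (at r within I)) \<and>
          continuous_on I v \<and>
          (\<forall>r\<in>I - {0, 1}. \<exists>w. (v has_real_derivative w) (at r) \<and>
             w + (real n - 1) / r * v r + k_coeff K1 K2 r * (u r * \<bar>u r\<bar> powr (q - 2)) = 0))"

definition regular_solution ::
  "nat \<Rightarrow> real \<Rightarrow> real \<Rightarrow> real \<Rightarrow> real set \<Rightarrow> real \<Rightarrow> (real \<Rightarrow> real) \<Rightarrow> bool" where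
  "regular_solution n q K1 K2 I d u \<longleftrightarrow>
     radial_solution n q K1 K2 I u \<and> 0 \<in> I \<and> u 0 = d \<and>
     (u has_real_derivative 0) (at 0 within I)"

text \<open>
  The maximally continued regular solution \<open>u(r,d)\<close>: its value at \<open>r \<ge> 0\<close> is the common value at \<open>r\<close> of
  all regular solutions on intervals \<open>[0,R)\<close> containing \<open>r\<close>. Values at \<open>r < 0\<close>, or beyond the maximal
  interval of existence (solutions may blow up), are meaningless, so that global existence has to be
  asserted separately, by \<open>regular_solution \<dots> {0..} d (reg_sol \<dots> d)\<close>.
\<close>

definition reg_sol :: "nat \<Rightarrow> real \<Rightarrow> real \<Rightarrow> real \<Rightarrow> real \<Rightarrow> real \<Rightarrow> real" where
  "reg_sol n q K1 K2 d r =
     (THE y. \<exists>R u. r < R \<and> regular_solution n q K1 K2 {0..<R} d u \<and> u r = y)"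

definition fast_decay_solution ::
  "nat \<Rightarrow> real \<Rightarrow> real \<Rightarrow> real \<Rightarrow> (real \<Rightarrow> real) \<Rightarrow> bool" where
  "fast_decay_solution n q K1 K2 u \<longleftrightarrow>
     (\<exists>R. radial_solution n q K1 K2 {R<..} u) \<and>
     (\<exists>L. ((\<lambda>r. u r * r ^ (n - 2)) \<longlongrightarrow> L) at_top)"

definition slow_decay_solution ::
  "nat \<Rightarrow> real \<Rightarrow> real \<Rightarrow> real \<Rightarrow> (real \<Rightarrow> real) \<Rightarrow> bool" where
  "slow_decay_solution n q K1 K2 u \<longleftrightarrow>
     (\<exists>R. radial_solution n q K1 K2 {R<..} u) \<and>
     (filterlim (\<lambda>r. u r * r ^ (n - 2)) at_top at_top \<or>
      filterlim (\<lambda>r. u r * r ^ (n - 2)) at_bot at_top)"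

definition ground_state ::
  "nat \<Rightarrow> real \<Rightarrow> real \<Rightarrow> real \<Rightarrow> (real \<Rightarrow> real) \<Rightarrow> bool" where
  "ground_state n q K1 K2 u \<longleftrightarrow>
     (\<exists>d. regular_solution n q K1 K2 {0..} d u) \<and> (\<forall>r>0. u r > 0) \<and> (u \<longlongrightarrow> 0) at_top"

definition exactly_nondegenerate_zeroes :: "nat \<Rightarrow> (real \<Rightarrow> real) \<Rightarrow> bool" where
  "exactly_nondegenerate_zeroes k u \<longleftrightarrow>
     finite {r. r > 0 \<and> u r = 0} \<and> card {r. r > 0 \<and> u r = 0} = k \<and>
     (\<forall>r>0. u r = 0 \<longrightarrow> deriv u r \<noteq> 0)"

end

theory Submission
  imports Defs
begin

text \<open>
  The theorem is proved by counting zeroes. Put \<open>\<alpha> = 2/(q-2)\<close> and \<open>\<lambda> = n-2-\<alpha>\<close>. The substitution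
  \<open>x(t) = e\<^sup>\<alpha>\<^sup>t u(e\<^sup>t)\<close>, due to Fowler, turns the equation for \<open>r > 1\<close> into the autonomous system
  \<open>x' = y\<close>, \<open>y' = \<alpha>\<lambda>x - K\<^sub>2 x|x|\<^bsup>q-2\<^esup> - (\<lambda>-\<alpha>)y\<close>, which has a saddle at the origin and two further
  equilibria. The hypothesis \<open>q > 2\<^sup>*\<close> says precisely that \<open>\<alpha> < \<lambda>\<close>, so that the system is damped and its
  energy decreases. If the energy ever becomes negative, the orbit can no longer reach \<open>x = 0\<close>
  and \<open>|x|\<close> stays away from \<open>0\<close>: this is slow decay (\<open>slow_growth\<close>). If the energy never becomes
  negative, the orbit must converge to the saddle, like \<open>e\<^bsup>-\<lambda>t\<^esup>\<close>: this is fast decay (\<open>fast_decay\<close>).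
  So slow and fast decay are the only possibilities, and both leave only finitely many zeroes.

  Let \<open>N(d)\<close> be the number of zeroes of \<open>u(r,d)\<close>. The core of the proof is that \<open>N\<close> is nondecreasing and
  that \<open>N(d) < N(d')\<close> for all \<open>d' > d\<close> if \<open>d\<close> belongs to a fast decay solution (\<open>zero_count_outside\<close>).
  By scaling, all regular solutions trace one and the same curve for \<open>r \<le> 1\<close>, an orbit of the system with
  \<open>K\<^sub>1\<close> in place of \<open>K\<^sub>2\<close>. As \<open>K\<^sub>1 < 0 < K\<^sub>2\<close>, that curve crosses the orbits of the \<open>K\<^sub>2\<close>-system
  upwards wherever it meets them (\<open>outside_by_forcing\<close>), so a larger \<open>d\<close> starts on the outer side of the
  orbit of a smaller one. Different orbits of an autonomous planar system do not cross. Hence the outer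
  orbit remains outside after each half turn (\<open>outer_half_turn\<close>), and it makes at least as many half
  turns. If the inner orbit converges to the saddle, the outer one cannot do so from the same side, because
  the saddle attracts only one orbit from each side (\<open>fast_orbit_unique\<close>); it has to cross \<open>x = 0\<close> again.

  Conversely \<open>N\<close> cannot jump by more than one, nor jump at slow decay data (\<open>zero_count_semicontinuous\<close>):
  zeroes are nondegenerate, so they persist under perturbation, and an orbit which leaves a small
  neighbourhood of the saddle has too little energy for two more zeroes
  (\<open>energy_loss_between_zeros\<close>). Therefore \<open>N\<close> is a step function which increases by one exactly at the
  fast decay data, where it still has the smaller value. Finally \<open>N\<close> vanishes for small \<open>d\<close>, where
  the energy is negative from \<open>r = 1\<close> on, and \<open>N\<close> is unbounded, because \<open>u(1,d)\<close> is unbounded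
  (\<open>large_data\<close>) and orbits of large energy rotate at a definite speed (\<open>many_zeros_if_energy_large\<close>).
  The steps \<open>D\<^sub>k\<close> are bounded because the solution with \<open>d\<close> large blows up before \<open>r = 1\<close>
  (\<open>good_bounded\<close>).
\<close>

section \<open>Monotonicity and Gronwall estimates\<close>

text \<open>
  Derivatives are taken in the open interval throughout this section: the intervals used later end at \<open>r = 0\<close>, where
  the equation is singular, or at \<open>r = 1\<close>, where \<open>u\<close> has no second derivative.
\<close>

lemma increasing_if_deriv_nonneg:
  fixes f :: "real \<Rightarrow> real"
  assumes "a \<le> b" "continuous_on {a..b} f"
    and "\<And>x. a < x \<Longrightarrow> x < b \<Longrightarrow> (f has_real_derivative f' x) (at x)"
    and "\<And>x. a < x \<Longrightarrow> x < b \<Longrightarrow> 0 \<le> f' x"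
  shows "f a \<le> f b"
  by (rule DERIV_nonneg_imp_increasing_open[OF assms(1) _ assms(2)]) (use assms in blast)

lemma decreasing_if_deriv_nonpos:
  fixes f :: "real \<Rightarrow> real"
  assumes "a \<le> b" "continuous_on {a..b} f"
    and "\<And>x. a < x \<Longrightarrow> x < b \<Longrightarrow> (f has_real_derivative f' x) (at x)"
    and "\<And>x. a < x \<Longrightarrow> x < b \<Longrightarrow> f' x \<le> 0"
  shows "f b \<le> f a"
  by (rule DERIV_nonpos_imp_decreasing_open[OF assms(1) _ assms(2)]) (use assms in blast)

lemma strict_increasing_if_deriv_pos:
  fixes f :: "real \<Rightarrow> real"
  assumes "a < b" "continuous_on {a..b} f"
    and "\<And>x. a < x \<Longrightarrow> x < b \<Longrightarrow> (f has_real_derivative f' x) (at x)"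
    and "\<And>x. a < x \<Longrightarrow> x < b \<Longrightarrow> 0 < f' x"
  shows "f a < f b"
  by (rule DERIV_pos_imp_increasing_open[OF assms(1) _ assms(2)]) (use assms in blast)

lemma strict_decreasing_if_deriv_neg:
  fixes f :: "real \<Rightarrow> real"
  assumes "a < b" "continuous_on {a..b} f"
    and "\<And>x. a < x \<Longrightarrow> x < b \<Longrightarrow> (f has_real_derivative f' x) (at x)"
    and "\<And>x. a < x \<Longrightarrow> x < b \<Longrightarrow> f' x < 0"
  shows "f b < f a"
  by (rule DERIV_neg_imp_decreasing_open[OF assms(1) _ assms(2)]) (use assms in blast)

lemma diff_le_if_deriv_le:
  fixes f :: "real \<Rightarrow> real"
  assumes "a \<le> b" "continuous_on {a..b} f"
    and "\<And>x. a < x \<Longrightarrow> x < b \<Longrightarrow> (f has_real_derivative f' x) (at x)"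
    and "\<And>x. a < x \<Longrightarrow> x < b \<Longrightarrow> f' x \<le> c"
  shows "f b \<le> f a + c * (b - a)"
proof -
  have "f b - c * b \<le> f a - c * a"
    by (rule decreasing_if_deriv_nonpos[OF assms(1), where f' = "\<lambda>x. f' x - c"])
       (auto intro!: continuous_intros derivative_eq_intros assms)
  then show ?thesis by (simp add: algebra_simps)
qed

lemma gronwall_forward:
  fixes f :: "real \<Rightarrow> real"
  assumes "a \<le> b" "continuous_on {a..b} f"
    and "\<And>x. a < x \<Longrightarrow> x < b \<Longrightarrow> (f has_real_derivative f' x) (at x)"
    and "\<And>x. a < x \<Longrightarrow> x < b \<Longrightarrow> f' x \<le> c * f x"
  shows "f b \<le> exp (c * (b - a)) * f a"
proof -
  have "exp (- c * b) * f b \<le> exp (- c * a) * f a"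
  proof (rule decreasing_if_deriv_nonpos[OF assms(1), where f' = "\<lambda>x. exp (- c * x) * (f' x - c * f x)"])
    show "continuous_on {a..b} (\<lambda>x. exp (- c * x) * f x)"
      by (intro continuous_intros assms)
    fix x assume "a < x" "x < b"
    have "((\<lambda>x. exp (- c * x)) has_real_derivative exp (- c * x) * (- c)) (at x)"
      by (auto intro!: derivative_eq_intros)
    from DERIV_mult[OF this assms(3)[OF \<open>a < x\<close> \<open>x < b\<close>]]
    show "((\<lambda>x. exp (- c * x) * f x) has_real_derivative exp (- c * x) * (f' x - c * f x)) (at x)"
      by (simp add: algebra_simps)
    show "exp (- c * x) * (f' x - c * f x) \<le> 0"
      using assms(4)[OF \<open>a < x\<close> \<open>x < b\<close>] by (intro mult_nonneg_nonpos) auto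
  qed
  then have "exp (c * b) * (exp (- c * b) * f b) \<le> exp (c * b) * (exp (- c * a) * f a)"
    by (intro mult_left_mono) auto
  moreover have "exp (c * b) * exp (- c * b) = 1" "exp (c * b) * exp (- c * a) = exp (c * (b - a))"
    by (simp_all only: exp_add[symmetric]) (simp_all add: algebra_simps)
  ultimately show ?thesis
    by (metis mult.assoc mult_1)
qed

lemma gronwall_backward:
  fixes f :: "real \<Rightarrow> real"
  assumes "a \<le> b" "continuous_on {a..b} f"
    and "\<And>x. a < x \<Longrightarrow> x < b \<Longrightarrow> (f has_real_derivative f' x) (at x)"
    and "\<And>x. a < x \<Longrightarrow> x < b \<Longrightarrow> - c * f x \<le> f' x"
  shows "f a \<le> exp (c * (b - a)) * f b"
proof -
  have "exp (c * a) * f a \<le> exp (c * b) * f b"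
  proof (rule increasing_if_deriv_nonneg[OF assms(1), where f' = "\<lambda>x. exp (c * x) * (f' x + c * f x)"])
    show "continuous_on {a..b} (\<lambda>x. exp (c * x) * f x)"
      by (intro continuous_intros assms)
    fix x assume "a < x" "x < b"
    have "((\<lambda>x. exp (c * x)) has_real_derivative exp (c * x) * c) (at x)"
      by (auto intro!: derivative_eq_intros)
    from DERIV_mult[OF this assms(3)[OF \<open>a < x\<close> \<open>x < b\<close>]]
    show "((\<lambda>x. exp (c * x) * f x) has_real_derivative exp (c * x) * (f' x + c * f x)) (at x)"
      by (simp add: algebra_simps)
    show "0 \<le> exp (c * x) * (f' x + c * f x)"
      using assms(4)[OF \<open>a < x\<close> \<open>x < b\<close>] by (intro mult_nonneg_nonneg) auto
  qed
  then have "exp (- c * a) * (exp (c * a) * f a) \<le> exp (- c * a) * (exp (c * b) * f b)"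
    by (intro mult_left_mono) auto
  moreover have "exp (- c * a) * exp (c * a) = 1" "exp (- c * a) * exp (c * b) = exp (c * (b - a))"
    by (simp_all only: exp_add[symmetric]) (simp_all add: algebra_simps)
  ultimately show ?thesis
    by (metis mult.assoc mult_1)
qed

section \<open>The power nonlinearity\<close>

definition odd_power :: "real \<Rightarrow> real \<Rightarrow> real" where
  "odd_power q x = x * \<bar>x\<bar> powr (q - 2)"

lemma odd_power_0 [simp]: "odd_power q 0 = 0"
  by (simp add: odd_power_def)

lemma odd_power_minus [simp]: "odd_power q (- x) = - odd_power q x"
  by (simp add: odd_power_def)

lemma odd_power_pos: "0 < x \<Longrightarrow> 0 < odd_power q x"
  by (simp add: odd_power_def)

lemma odd_power_mult: "0 < c \<Longrightarrow> odd_power q (c * x) = c powr (q - 1) * odd_power q x"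
proof -
  assume "0 < c"
  then have "c * c powr (q - 2) = c powr (q - 1)"
    using powr_add[of c 1 "q - 2"] by simp
  then show ?thesis using \<open>0 < c\<close>
    by (simp add: odd_power_def abs_mult powr_mult)
qed

text \<open>
  At \<open>0\<close>, where the chain rule for powers does not apply, the difference quotient is \<open>|h|\<^bsup>q-2\<^esup>\<close> and tends
  to \<open>0\<close> as \<open>q > 2\<close>.
\<close>

lemma has_real_derivative_odd_power:
  assumes "2 < q"
  shows "(odd_power q has_real_derivative (q - 1) * \<bar>x\<bar> powr (q - 2)) (at x)"
proof -
  consider "x > 0" | "x < 0" | "x = 0" by linarith
  then show ?thesis
  proof cases
    case 1
    have "((\<lambda>z. z powr (q - 1)) has_real_derivative (q - 1) * \<bar>x\<bar> powr (q - 2)) (at x)"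
      using 1 by (auto intro!: derivative_eq_intros simp: algebra_simps)
    moreover have "eventually (\<lambda>z. z > 0) (nhds x)"
      using 1 eventually_nhds_in_open[of "{0<..}" x] by simp
    then have "eventually (\<lambda>z. z powr (q - 1) = odd_power q z) (nhds x)"
    proof eventually_elim
      case (elim z)
      then show ?case using powr_add[of z 1 "q - 2"] by (simp add: odd_power_def)
    qed
    ultimately show ?thesis by (subst (asm) DERIV_cong_ev[OF refl _ refl])
  next
    case 2
    have "((\<lambda>z. - ((- z) powr (q - 1))) has_real_derivative (q - 1) * \<bar>x\<bar> powr (q - 2)) (at x)"
      using 2 by (auto intro!: derivative_eq_intros simp: algebra_simps)
    moreover have "eventually (\<lambda>z. z < 0) (nhds x)"
      using 2 eventually_nhds_in_open[of "{..<0}" x] by simp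
    then have "eventually (\<lambda>z. - ((- z) powr (q - 1)) = odd_power q z) (nhds x)"
    proof eventually_elim
      case (elim z)
      then show ?case using powr_add[of "-z" 1 "q - 2"] by (simp add: odd_power_def)
    qed
    ultimately show ?thesis by (subst (asm) DERIV_cong_ev[OF refl _ refl])
  next
    case 3
    have "((\<lambda>h. \<bar>h\<bar> powr (q - 2)) \<longlongrightarrow> 0) (at 0)"
      using assms by (auto intro!: tendsto_eq_intros)
    then have "((\<lambda>h. (odd_power q (0 + h) - odd_power q 0) / h) \<longlongrightarrow> 0) (at 0)"
      by (rule Lim_transform_eventually)
         (auto simp: eventually_at_filter odd_power_def)
    then show ?thesis using 3 assms
      by (simp add: DERIV_def)
  qed
qed

lemma odd_power_lipschitz:
  assumes "2 < q" "\<bar>x\<bar> \<le> M" "\<bar>y\<bar> \<le> M"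
  shows "\<bar>odd_power q x - odd_power q y\<bar> \<le> (q - 1) * M powr (q - 2) * \<bar>x - y\<bar>"
proof -
  have "norm (odd_power q x - odd_power q y) \<le> (q - 1) * M powr (q - 2) * norm (x - y)"
  proof (rule field_differentiable_bound[of "{-M..M}"])
    fix z assume "z \<in> {-M..M}"
    then have "\<bar>z\<bar> \<le> M" by auto
    show "(odd_power q has_field_derivative (q - 1) * \<bar>z\<bar> powr (q - 2)) (at z within {-M..M})"
      by (rule has_field_derivative_at_within[OF has_real_derivative_odd_power[OF assms(1)]])
    show "norm ((q - 1) * \<bar>z\<bar> powr (q - 2)) \<le> (q - 1) * M powr (q - 2)"
      using \<open>\<bar>z\<bar> \<le> M\<close> assms by (simp add: abs_mult mult_left_mono powr_mono2)
  qed (use assms in auto)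
  then show ?thesis by simp
qed

lemma continuous_odd_power [continuous_intros]:
  "2 < q \<Longrightarrow> continuous_on S h \<Longrightarrow> continuous_on S (\<lambda>x. odd_power q (h x))"
proof -
  assume "2 < q" "continuous_on S h"
  have "continuous_on UNIV (odd_power q)"
    by (meson DERIV_isCont continuous_at_imp_continuous_on has_real_derivative_odd_power \<open>2 < q\<close>)
  from continuous_on_compose2[OF this \<open>continuous_on S h\<close>] show ?thesis by simp
qed

lemma has_real_derivative_abs_powr:
  assumes "2 < q"
  shows "((\<lambda>x. \<bar>x\<bar> powr q) has_real_derivative q * odd_power q x) (at x)"
proof -
  have eq: "\<bar>x\<bar> powr q = x * odd_power q x" for x :: real
  proof (cases "x = 0")
    case False
    then show ?thesis using powr_add[of "\<bar>x\<bar>" 2 "q - 2"]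
      by (simp add: odd_power_def power2_eq_square)
  qed simp
  have "((\<lambda>x. x * odd_power q x) has_real_derivative x * ((q - 1) * \<bar>x\<bar> powr (q - 2)) + odd_power q x) (at x)"
    by (auto intro!: derivative_eq_intros has_real_derivative_odd_power assms)
  then show ?thesis by (simp add: eq odd_power_def algebra_simps)
qed

lemma has_real_derivative_odd_power_chain [derivative_intros]:
  assumes "2 < q" "(h has_real_derivative h') (at x within S)"
  shows "((\<lambda>x. odd_power q (h x)) has_real_derivative (q - 1) * \<bar>h x\<bar> powr (q - 2) * h') (at x within S)"
  by (rule DERIV_chain2[OF has_real_derivative_odd_power assms(2)]) (rule assms(1))

section \<open>The damped autonomous system\<close>

text \<open>
  The linearisation at the origin has the eigenvalues \<open>alpha\<close> and \<open>-lam\<close>. The condition \<open>alpha < lam\<close> is the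
  supercriticality of the exponent in disguise.
\<close>

locale emden_fowler =
  fixes alpha lam K q :: real
  assumes alpha_pos: "0 < alpha" and alpha_less_lam: "alpha < lam"
    and K_pos: "0 < K" and q_gt_2: "2 < q"
begin

abbreviation f where "f \<equiv> odd_power q"
definition damping where "damping = lam - alpha"
definition restoring where "restoring x = alpha * lam * x - K * f x"
definition potential where "potential x = K * \<bar>x\<bar> powr q / q - alpha * lam * x\<^sup>2 / 2"
definition energy where "energy x y = y\<^sup>2 / 2 + potential x"

lemma lam_pos: "0 < lam" using alpha_pos alpha_less_lam by simp
lemma damping_pos: "0 < damping" using alpha_less_lam by (simp add: damping_def)
lemma B_pos: "0 < alpha * lam" using alpha_pos lam_pos by simp

text \<open>
  The system is imposed for positive times only, as \<open>t = 0\<close> corresponds to \<open>r = 1\<close>, where the coefficient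
  of the radial equation jumps. The class is invariant under forward time shifts and under the
  symmetry \<open>(x, y) \<mapsto> (-x, -y)\<close>.
\<close>

definition traj :: "(real \<Rightarrow> real) \<Rightarrow> (real \<Rightarrow> real) \<Rightarrow> bool" where
  "traj x y \<longleftrightarrow> continuous_on {0..} x \<and> continuous_on {0..} y \<and>
     (\<forall>t>0. (x has_real_derivative y t) (at t) \<and>
            (y has_real_derivative restoring (x t) - damping * y t) (at t))"

lemma trajD:
  assumes "traj x y"
  shows "continuous_on {0..} x" "continuous_on {0..} y"
    "0 < t \<Longrightarrow> (x has_real_derivative y t) (at t)"
    "0 < t \<Longrightarrow> (y has_real_derivative restoring (x t) - damping * y t) (at t)"
  using assms by (auto simp: traj_def)

lemma traj_cont:
  assumes "traj x y" "S \<subseteq> {0..}"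
  shows "continuous_on S x" "continuous_on S y"
  using assms continuous_on_subset by (auto simp: traj_def)

lemma restoring_minus: "restoring (- x) = - restoring x"
  by (simp add: restoring_def)

lemma restoring_0 [simp]: "restoring 0 = 0"
  by (simp add: restoring_def)

lemma potential_minus [simp]: "potential (- x) = potential x"
  by (simp add: potential_def)

lemma energy_minus [simp]: "energy (- x) (- y) = energy x y"
  by (simp add: energy_def)

lemma potential_0 [simp]: "potential 0 = 0"
  by (simp add: potential_def)

lemma traj_minus:
  assumes "traj x y"
  shows "traj (\<lambda>t. - x t) (\<lambda>t. - y t)"
proof -
  have "((\<lambda>t. - y t) has_real_derivative restoring (- x t) - damping * (- y t)) (at t)" if "t > 0" for t
    using DERIV_minus[OF trajD(4)[OF assms that]] by (simp add: restoring_minus)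
  then show ?thesis
    unfolding traj_def
    using trajD(1,2)[OF assms] DERIV_minus[OF trajD(3)[OF assms]] by (auto intro: continuous_on_minus)
qed

lemma traj_shift:
  assumes "traj x y" "0 \<le> s"
  shows "traj (\<lambda>t. x (s + t)) (\<lambda>t. y (s + t))"
proof -
  have sub: "(\<lambda>t. s + t) ` {0..} \<subseteq> {0..}" using assms(2) by auto
  have c: "continuous_on {0..} (\<lambda>t. s + t)" by (intro continuous_intros)
  have "((\<lambda>t. x (s + t)) has_real_derivative y (s + t)) (at t)"
    "((\<lambda>t. y (s + t)) has_real_derivative restoring (x (s + t)) - damping * y (s + t)) (at t)"
    if "t > 0" for t
  proof -
    have "s + t > 0" using that assms(2) by simp
    note d = trajD(3,4)[OF assms(1) this]
    have "((\<lambda>t. s + t) has_real_derivative 1) (at t)" by (auto intro!: derivative_eq_intros)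
    note ch = DERIV_chain2[OF _ this]
    show "((\<lambda>t. x (s + t)) has_real_derivative y (s + t)) (at t)"
      using ch[of x, OF d(1)] by simp
    show "((\<lambda>t. y (s + t)) has_real_derivative restoring (x (s + t)) - damping * y (s + t)) (at t)"
      using ch[of y, OF d(2)] by simp
  qed
  then show ?thesis
    using continuous_on_compose2[OF trajD(1)[OF assms(1)] c sub]
      continuous_on_compose2[OF trajD(2)[OF assms(1)] c sub]
    unfolding traj_def by blast
qed

lemma continuous_restoring [continuous_intros]:
  "continuous_on S h \<Longrightarrow> continuous_on S (\<lambda>x. restoring (h x))"
  unfolding restoring_def by (intro continuous_intros q_gt_2)

lemma deriv_potential: "(potential has_real_derivative - restoring x) (at x)"
proof -
  have "((\<lambda>x. K * \<bar>x\<bar> powr q / q - alpha * lam * x\<^sup>2 / 2) has_real_derivative - restoring x) (at x)"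
    by (rule DERIV_cong[OF DERIV_diff[OF DERIV_cdivide[OF DERIV_cmult[OF has_real_derivative_abs_powr[OF q_gt_2]]]
            DERIV_cdivide[OF DERIV_cmult[OF DERIV_power[OF DERIV_ident]]]]])
       (use q_gt_2 in \<open>simp add: restoring_def\<close>)
  moreover have "potential = (\<lambda>x. K * \<bar>x\<bar> powr q / q - alpha * lam * x\<^sup>2 / 2)"
    by (auto simp: potential_def)
  ultimately show ?thesis by simp
qed

lemma continuous_potential [continuous_intros]:
  "continuous_on S h \<Longrightarrow> continuous_on S (\<lambda>x. potential (h x))"
  by (rule continuous_on_compose2[of UNIV potential S h])
     (auto intro!: continuous_at_imp_continuous_on DERIV_isCont[OF deriv_potential])

lemma restoring_eq: "0 \<le> x \<Longrightarrow> restoring x = x * (alpha * lam - K * x powr (q - 2))"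
  by (simp add: restoring_def odd_power_def algebra_simps)

lemma potential_eq: "0 < x \<Longrightarrow> potential x = x\<^sup>2 * (K * x powr (q - 2) / q - alpha * lam / 2)"
proof -
  assume "0 < x"
  then show ?thesis using powr_add[of x 2 "q - 2"]
    by (simp add: potential_def algebra_simps)
qed

text \<open>
  An orbit of nonnegative energy that meets the axis \<open>y = 0\<close> does so where the potential is nonnegative.
  By this lemma and its symmetric counterpart it can cross that axis only towards \<open>x = 0\<close>.
\<close>

lemma restoring_neg_if_potential_nonneg:
  assumes "0 < x" "0 \<le> potential x"
  shows "restoring x < 0"
proof -
  have "0 \<le> K * x powr (q - 2) / q - alpha * lam / 2"
    using assms potential_eq[of x] by (simp add: zero_le_mult_iff)
  then have "alpha * lam * (q / 2) \<le> K * x powr (q - 2)"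
    using q_gt_2 by (simp add: field_simps)
  moreover have "alpha * lam * 1 < alpha * lam * (q / 2)"
    by (rule mult_strict_left_mono) (use q_gt_2 B_pos in auto)
  ultimately show ?thesis using assms(1) by (simp add: restoring_eq mult_pos_neg)
qed

lemma restoring_antimono_neg:
  assumes "0 < x" "x \<le> z" "restoring x < 0"
  shows "restoring z \<le> restoring x"
proof -
  have a: "alpha * lam - K * x powr (q - 2) < 0"
    using assms by (simp add: restoring_eq mult_less_0_iff)
  have "K * x powr (q - 2) \<le> K * z powr (q - 2)"
    using assms K_pos q_gt_2 by (simp add: powr_mono2)
  then have "z * (alpha * lam - K * z powr (q - 2)) \<le> z * (alpha * lam - K * x powr (q - 2))"
    using assms by simp
  also have "\<dots> \<le> x * (alpha * lam - K * x powr (q - 2))"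
    using a assms by (simp add: mult_right_mono_neg)
  finally show ?thesis using assms by (simp add: restoring_eq)
qed

lemma restoring_pos_below:
  assumes "0 < x" "x < z" "0 \<le> restoring z"
  shows "0 < restoring x"
proof -
  have "K * x powr (q - 2) < K * z powr (q - 2)"
    using assms K_pos q_gt_2 by (simp add: powr_less_mono2)
  moreover have "0 \<le> alpha * lam - K * z powr (q - 2)"
    using assms by (simp add: restoring_eq zero_le_mult_iff)
  ultimately show ?thesis using assms by (simp add: restoring_eq)
qed

lemma deriv_energy:
  assumes "traj x y" "0 < t"
  shows "((\<lambda>t. energy (x t) (y t)) has_real_derivative - damping * (y t)\<^sup>2) (at t)"
proof -
  note d = trajD(3,4)[OF assms]
  note dp = DERIV_chain2[OF deriv_potential d(1)]
  have "((\<lambda>t. (y t)\<^sup>2 / 2) has_real_derivative y t * (restoring (x t) - damping * y t)) (at t)"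
    by (auto intro!: derivative_eq_intros d)
  from DERIV_add[OF this dp] show ?thesis unfolding energy_def
    by (simp add: algebra_simps power2_eq_square)
qed

lemma cont_energy:
  assumes "traj x y" "S \<subseteq> {0..}"
  shows "continuous_on S (\<lambda>t. energy (x t) (y t))"
  unfolding energy_def by (intro continuous_intros traj_cont[OF assms]) simp

lemma energy_antimono:
  assumes "traj x y" "0 \<le> s" "s \<le> t"
  shows "energy (x t) (y t) \<le> energy (x s) (y s)"
  by (rule decreasing_if_deriv_nonpos[OF assms(3) cont_energy[OF assms(1)]
        deriv_energy[OF assms(1)]])
     (use assms damping_pos in \<open>auto simp: mult_nonneg_nonpos\<close>)

text \<open>
  Beyond \<open>m\<close> the term \<open>K|x|\<^sup>q/q\<close> dominates \<open>(alpha lam + 1)x\<^sup>2/2\<close>; on \<open>[-m, m]\<close> the constant makes up for it.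
\<close>

lemma potential_coercive: "\<exists>C\<ge>0. \<forall>x. x\<^sup>2 / 2 - C \<le> potential x"
proof -
  define m where "m = (q * (alpha * lam + 1) / (2 * K)) powr (1 / (q - 2))"
  have q: "q > 0" using q_gt_2 by simp
  have m: "m > 0" unfolding m_def using q B_pos K_pos
    by (simp add: add_nonneg_eq_0_iff less_imp_neq[symmetric])
  have mp: "m powr (q - 2) = q * (alpha * lam + 1) / (2 * K)"
    unfolding m_def using q_gt_2 q B_pos K_pos by (simp add: powr_powr)
  define C where "C = (alpha * lam + 1) * m\<^sup>2 / 2"
  have C: "0 \<le> C" using B_pos by (simp add: C_def)
  have pos: "x\<^sup>2 / 2 - C \<le> potential x" if "0 \<le> x" for x
  proof (cases "x \<le> m")
    case True
    have "(alpha * lam + 1) * x\<^sup>2 \<le> (alpha * lam + 1) * m\<^sup>2"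
      using that True B_pos by (intro mult_left_mono power_mono) auto
    moreover have "0 \<le> K * \<bar>x\<bar> powr q / q" using K_pos q by simp
    ultimately show ?thesis unfolding potential_def C_def by (simp add: algebra_simps add_divide_distrib)
  next
    case False
    then have x: "0 < x" using m by simp
    have "m powr (q - 2) \<le> x powr (q - 2)"
      using False m q_gt_2 by (intro powr_mono2) auto
    then have "K * m powr (q - 2) \<le> K * x powr (q - 2)" using K_pos by simp
    then have "K * (q * (alpha * lam + 1) / (2 * K)) \<le> K * x powr (q - 2)" unfolding mp .
    then have "q * (alpha * lam + 1) / 2 \<le> K * x powr (q - 2)" using K_pos by simp
    then have "1 / 2 \<le> K * x powr (q - 2) / q - alpha * lam / 2"
      using q by (simp add: field_simps)
    then have "x\<^sup>2 * (1 / 2) \<le> x\<^sup>2 * (K * x powr (q - 2) / q - alpha * lam / 2)"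
      by (intro mult_left_mono) auto
    then show ?thesis using potential_eq[OF x] C by linarith
  qed
  have "x\<^sup>2 / 2 - C \<le> potential x" for x
    using pos[of x] pos[of "- x"] by (cases "0 \<le> x") auto
  then show ?thesis using C by blast
qed

lemma traj_bounded:
  "\<exists>C\<ge>0. \<forall>x y t. traj x y \<longrightarrow> 0 \<le> t \<longrightarrow> (x t)\<^sup>2 + (y t)\<^sup>2 \<le> 2 * energy (x 0) (y 0) + C"
proof -
  obtain C where C: "C \<ge> 0" "\<And>x. x\<^sup>2 / 2 - C \<le> potential x" using potential_coercive by blast
  have "(x t)\<^sup>2 + (y t)\<^sup>2 \<le> 2 * energy (x 0) (y 0) + 2 * C" if "traj x y" "0 \<le> t" for x y t
    using energy_antimono[OF that(1) order_refl that(2)] C(2)[of "x t"]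
    by (simp add: energy_def)
  then show ?thesis using C(1) by (intro exI[of _ "2 * C"]) auto
qed

lemma traj_bound:
  assumes "traj x y"
  obtains M where "M > 0" "\<And>t. 0 \<le> t \<Longrightarrow> \<bar>x t\<bar> \<le> M" "\<And>t. 0 \<le> t \<Longrightarrow> \<bar>y t\<bar> \<le> M"
proof -
  obtain C where C: "\<And>t. 0 \<le> t \<Longrightarrow> (x t)\<^sup>2 + (y t)\<^sup>2 \<le> 2 * energy (x 0) (y 0) + C"
    using traj_bounded assms by metis
  define M where "M = 1 + \<bar>2 * energy (x 0) (y 0) + C\<bar>"
  have M: "(x t)\<^sup>2 + (y t)\<^sup>2 \<le> M\<^sup>2" "M > 0" if "0 \<le> t" for t
  proof -
    have "M * 1 \<le> M * M" by (rule mult_left_mono) (auto simp: M_def)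
    then show "(x t)\<^sup>2 + (y t)\<^sup>2 \<le> M\<^sup>2" using C[OF that] by (simp add: M_def power2_eq_square)
    show "M > 0" by (simp add: M_def)
  qed
  have "\<bar>x t\<bar> \<le> M" "\<bar>y t\<bar> \<le> M" if "0 \<le> t" for t
  proof -
    have *: "(x t)\<^sup>2 \<le> M\<^sup>2" "(y t)\<^sup>2 \<le> M\<^sup>2"
      using M(1)[OF that] zero_le_power2[of "x t"] zero_le_power2[of "y t"] by linarith+
    show "\<bar>x t\<bar> \<le> M" using abs_le_square_iff[of "x t" M] *(1) M(2)[OF that] by simp
    show "\<bar>y t\<bar> \<le> M" using abs_le_square_iff[of "y t" M] *(2) M(2)[OF that] by simp
  qed
  then show ?thesis using that M(2) by blast
qed

end

lemma first_zero:
  fixes f :: "real \<Rightarrow> real"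
  assumes "a \<le> b" "continuous_on {a..b} f" "f a < 0" "0 \<le> f b"
  obtains s where "a < s" "s \<le> b" "f s = 0" "\<And>t. a \<le> t \<Longrightarrow> t < s \<Longrightarrow> f t < 0"
proof -
  define S where "S = {a..b} \<inter> f -` {0..}"
  have "closed S" unfolding S_def
    by (rule continuous_closed_preimage[OF assms(2)]) auto
  then have "compact S" unfolding S_def by (auto intro!: compact_Int_closed simp: compact_eq_bounded_closed)
  moreover have "b \<in> S" using assms by (auto simp: S_def)
  ultimately obtain s where s: "s \<in> S" "\<And>t. t \<in> S \<Longrightarrow> s \<le> t"
    using compact_attains_inf[of S] by blast
  have neg: "f t < 0" if "a \<le> t" "t < s" for t
  proof (rule ccontr)
    assume "\<not> f t < 0"
    then have "t \<in> S" using s(1) that by (auto simp: S_def)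
    then show False using s(2) that by fastforce
  qed
  have "a < s" using s(1) assms(3) by (auto simp: S_def order.order_iff_strict)
  obtain z where z: "a \<le> z" "z \<le> s" "f z = 0"
    using IVT'[of f a 0 s] s(1) assms continuous_on_subset[OF assms(2), of "{a..s}"]
    by (auto simp: S_def)
  then have "f s = 0" using neg[of z] by (cases "z = s") auto
  then show ?thesis using that[OF \<open>a < s\<close> _ _ neg] s(1) by (auto simp: S_def)
qed

lemma last_zero:
  fixes f :: "real \<Rightarrow> real"
  assumes "a \<le> b" "continuous_on {a..b} f" "f a \<le> 0" "0 < f b"
  obtains s where "a \<le> s" "s < b" "f s = 0" "\<And>t. s < t \<Longrightarrow> t \<le> b \<Longrightarrow> 0 < f t"
proof -
  define S where "S = {a..b} \<inter> f -` {..0}"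
  have "closed S" unfolding S_def
    by (rule continuous_closed_preimage[OF assms(2)]) auto
  then have "compact S" unfolding S_def by (auto intro!: compact_Int_closed simp: compact_eq_bounded_closed)
  moreover have "a \<in> S" using assms by (auto simp: S_def)
  ultimately obtain s where s: "s \<in> S" "\<And>t. t \<in> S \<Longrightarrow> t \<le> s"
    using compact_attains_sup[of S] by blast
  have pos: "0 < f t" if "s < t" "t \<le> b" for t
  proof (rule ccontr)
    assume "\<not> 0 < f t"
    then have "t \<in> S" using s(1) that by (auto simp: S_def)
    then show False using s(2) that by fastforce
  qed
  have "s < b" using s(1) assms(4) by (auto simp: S_def order.order_iff_strict)
  obtain z where z: "s \<le> z" "z \<le> b" "f z = 0"
    using IVT'[of f s 0 b] s(1) assms continuous_on_subset[OF assms(2), of "{s..b}"]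
    by (auto simp: S_def)
  then have "f s = 0" using pos[of z] by (cases "z = s") auto
  then show ?thesis using that[OF _ \<open>s < b\<close> _ pos] s(1) by (auto simp: S_def)
qed

text \<open>
  To become nonnegative again, the function would have to reach \<open>0\<close> from below, with a derivative that
  is not negative.
\<close>

lemma negative_after_zero:
  fixes f :: "real \<Rightarrow> real"
  assumes "continuous_on {c..b} f" "f c = 0" "c < b"
    and down: "\<And>t. c \<le> t \<Longrightarrow> t \<le> b \<Longrightarrow> f t = 0 \<Longrightarrow> \<exists>D<0. (f has_real_derivative D) (at t)"
  shows "f b < 0"
proof (rule ccontr)
  assume "\<not> f b < 0"
  obtain d where d: "d > 0" "\<And>h. 0 < h \<Longrightarrow> h < d \<Longrightarrow> f (c + h) < 0"
    using down[of c] assms(2,3) DERIV_neg_dec_right[of f _ c] by auto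
  define a where "a = c + min (d / 2) ((b - c) / 2)"
  have a: "c < a" "a < b" "f a < 0"
    using d(1) assms(3) d(2)[of "min (d / 2) ((b - c) / 2)"] by (auto simp: a_def min_def field_simps)
  obtain s where s: "a < s" "s \<le> b" "f s = 0" "\<And>t. a \<le> t \<Longrightarrow> t < s \<Longrightarrow> f t < 0"
    using first_zero[of a b f, OF _ continuous_on_subset[OF assms(1)]] a \<open>\<not> f b < 0\<close> by auto
  obtain D where "D < 0" "(f has_real_derivative D) (at s)" using down[of s] s a by auto
  then obtain e where e: "e > 0" "\<And>h. 0 < h \<Longrightarrow> h < e \<Longrightarrow> f s < f (s - h)"
    using DERIV_neg_dec_left[of f D s] by blast
  have "f (s - min (e / 2) (s - a)) < 0" using s(1) e(1) by (intro s(4)) auto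
  moreover have "f s < f (s - min (e / 2) (s - a))" using s(1) e(1) by (intro e(2)) auto
  ultimately show False using s(3) by simp
qed

lemma no_zero_constant_sign:
  fixes f :: "real \<Rightarrow> real"
  assumes "continuous_on {a..} f" "\<And>t. a \<le> t \<Longrightarrow> f t \<noteq> 0"
  shows "(\<forall>t\<ge>a. f t > 0) \<or> (\<forall>t\<ge>a. f t < 0)"
proof (cases "f a > 0")
  case True
  have "f t > 0" if t: "t \<ge> a" for t
  proof (rule ccontr)
    assume "\<not> f t > 0"
    then obtain s where "a \<le> s" "f s = 0"
      using IVT2'[of f t 0 a, OF _ _ t continuous_on_subset[OF assms(1)]] True by auto
    then show False using assms(2) by auto
  qed
  then show ?thesis by blast
next
  case False
  then have "f a < 0" using assms(2)[of a] by auto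
  have "f t < 0" if t: "t \<ge> a" for t
  proof (rule ccontr)
    assume "\<not> f t < 0"
    then obtain s where "a \<le> s" "f s = 0"
      using IVT'[of f a 0 t, OF _ _ t continuous_on_subset[OF assms(1)]] \<open>f a < 0\<close> by auto
    then show False using assms(2) by auto
  qed
  then show ?thesis by blast
qed

lemma increasing_bounded_convergent:
  fixes f :: "real \<Rightarrow> real"
  assumes "\<And>s t. a \<le> s \<Longrightarrow> s \<le> t \<Longrightarrow> f s \<le> f t" "\<And>t. a \<le> t \<Longrightarrow> f t \<le> b"
  shows "\<exists>L. (f \<longlongrightarrow> L) at_top"
proof -
  define L where "L = Sup (f ` {a..})"
  have bdd: "bdd_above (f ` {a..})" using assms(2) by (auto simp: bdd_above_def)
  have "(f \<longlongrightarrow> L) at_top"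
  proof (rule increasing_tendsto)
    show "eventually (\<lambda>t. f t \<le> L) at_top"
      using eventually_ge_at_top[of a]
      by eventually_elim (auto simp: L_def intro!: cSup_upper bdd)
    fix c assume "c < L"
    then obtain s where "s \<ge> a" "c < f s"
      using less_cSup_iff[of "f ` {a..}" c] bdd by (auto simp: L_def)
    then show "eventually (\<lambda>t. c < f t) at_top"
      using assms(1)[of s] by (intro eventually_at_top_linorderI[of s]) (meson less_le_trans)
  qed
  then show ?thesis by blast
qed

context emden_fowler
begin

text \<open>
  The estimate backward in time is as important as the forward one: it shows that two orbits with a common
  point have a common past, whence orbits that start differently never meet.
\<close>

lemma traj_gronwall:
  "\<exists>L\<ge>0. \<forall>x1 y1 x2 y2. traj x1 y1 \<longrightarrow> traj x2 y2 \<longrightarrow>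
     (\<forall>t\<ge>0. \<bar>x1 t\<bar> \<le> M \<and> \<bar>x2 t\<bar> \<le> M) \<longrightarrow>
     (\<forall>s t. 0 \<le> s \<longrightarrow> s \<le> t \<longrightarrow>
        (x1 t - x2 t)\<^sup>2 + (y1 t - y2 t)\<^sup>2 \<le> exp (L * (t - s)) * ((x1 s - x2 s)\<^sup>2 + (y1 s - y2 s)\<^sup>2) \<and>
        (x1 s - x2 s)\<^sup>2 + (y1 s - y2 s)\<^sup>2 \<le> exp (L * (t - s)) * ((x1 t - x2 t)\<^sup>2 + (y1 t - y2 t)\<^sup>2))"
proof -
  define R where "R = alpha * lam + K * ((q - 1) * M powr (q - 2))"
  define L where "L = 1 + R + 2 * damping"
  have R0: "0 \<le> R" using B_pos K_pos q_gt_2 by (simp add: R_def)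
  have L0: "0 \<le> L" using R0 damping_pos by (simp add: L_def)
  have lip: "\<bar>restoring a - restoring b\<bar> \<le> R * \<bar>a - b\<bar>" if "\<bar>a\<bar> \<le> M" "\<bar>b\<bar> \<le> M" for a b
  proof -
    have eq: "restoring a - restoring b = alpha * lam * (a - b) - K * (f a - f b)"
      by (simp add: restoring_def algebra_simps)
    have "\<bar>alpha * lam * (a - b)\<bar> = alpha * lam * \<bar>a - b\<bar>" using B_pos
      by (simp only: abs_mult[of "alpha * lam"] abs_of_pos)
    moreover have "\<bar>K * (f a - f b)\<bar> \<le> K * ((q - 1) * M powr (q - 2) * \<bar>a - b\<bar>)"
      using odd_power_lipschitz[OF q_gt_2 that] K_pos by (simp add: abs_mult)
    ultimately show ?thesis unfolding eq R_def by (simp add: algebra_simps)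
  qed
  {
    fix x1 y1 x2 y2 and s t :: real
    assume z: "traj x1 y1" "traj x2 y2" and bd: "\<forall>t\<ge>0. \<bar>x1 t\<bar> \<le> M \<and> \<bar>x2 t\<bar> \<le> M"
      and st: "0 \<le> s" "s \<le> t"
    define \<rho> where "\<rho> = (\<lambda>t. (x1 t - x2 t)\<^sup>2 + (y1 t - y2 t)\<^sup>2)"
    define \<rho>' where "\<rho>' = (\<lambda>t. 2 * (x1 t - x2 t) * (y1 t - y2 t) +
       2 * (y1 t - y2 t) * (restoring (x1 t) - restoring (x2 t) - damping * (y1 t - y2 t)))"
    have c: "continuous_on {s..t} \<rho>" unfolding \<rho>_def
      by (intro continuous_intros traj_cont[OF z(1)] traj_cont[OF z(2)]) (use st in auto)
    have d: "(\<rho> has_real_derivative \<rho>' u) (at u)" if "s < u" "u < t" for u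
    proof -
      have u: "0 < u" using that st by simp
      note d = DERIV_power[OF DERIV_diff[OF trajD(3)[OF z(1) u] trajD(3)[OF z(2) u]], of 2]
         DERIV_power[OF DERIV_diff[OF trajD(4)[OF z(1) u] trajD(4)[OF z(2) u]], of 2]
      show ?thesis unfolding \<rho>_def \<rho>'_def
        by (rule DERIV_cong[OF DERIV_add[OF d]]) (simp add: algebra_simps)
    qed
    have b: "\<bar>\<rho>' u\<bar> \<le> L * \<rho> u" if "s < u" for u
    proof -
      have u: "0 \<le> u" using that st by simp
      define a b c where "a = x1 u - x2 u" and "b = y1 u - y2 u" and "c = restoring (x1 u) - restoring (x2 u)"
      have "\<bar>c\<bar> \<le> R * \<bar>a\<bar>" using lip bd u by (simp add: a_def c_def)
      then have "\<bar>b * c\<bar> \<le> R * (\<bar>a\<bar> * \<bar>b\<bar>)"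
        using mult_left_mono[of "\<bar>c\<bar>" "R * \<bar>a\<bar>" "\<bar>b\<bar>"] by (simp add: abs_mult algebra_simps)
      moreover have ab: "2 * (\<bar>a\<bar> * \<bar>b\<bar>) \<le> a\<^sup>2 + b\<^sup>2"
        using sum_squares_bound[of "\<bar>a\<bar>" "\<bar>b\<bar>"] by simp
      then have "R * (2 * (\<bar>a\<bar> * \<bar>b\<bar>)) \<le> R * (a\<^sup>2 + b\<^sup>2)" using R0 by (rule mult_left_mono)
      moreover have "\<bar>\<rho>' u\<bar> \<le> 2 * (\<bar>a\<bar> * \<bar>b\<bar>) + 2 * \<bar>b * c\<bar> + 2 * damping * b\<^sup>2"
      proof -
        have "\<rho>' u = 2 * (a * b) + 2 * (b * c) - 2 * damping * b\<^sup>2"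
          unfolding \<rho>'_def a_def b_def c_def by (simp add: algebra_simps power2_eq_square)
        moreover have "0 \<le> 2 * damping * b\<^sup>2" using damping_pos by simp
        moreover have "\<bar>2 * (a * b)\<bar> = 2 * (\<bar>a\<bar> * \<bar>b\<bar>)" by (simp add: abs_mult)
        ultimately show ?thesis by linarith
      qed
      moreover have "2 * damping * b\<^sup>2 \<le> 2 * damping * (a\<^sup>2 + b\<^sup>2)"
        using damping_pos by (intro mult_left_mono) auto
      moreover have "L * \<rho> u = (a\<^sup>2 + b\<^sup>2) + R * (a\<^sup>2 + b\<^sup>2) + 2 * damping * (a\<^sup>2 + b\<^sup>2)"
        unfolding \<rho>_def L_def a_def b_def by (simp add: distrib_right)
      ultimately show ?thesis using ab by linarith
    qed
    have "\<rho> t \<le> exp (L * (t - s)) * \<rho> s"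
      by (rule gronwall_forward[OF st(2) c d]) (use b in \<open>force simp: abs_le_iff\<close>)+
    moreover have "\<rho> s \<le> exp (L * (t - s)) * \<rho> t"
      by (rule gronwall_backward[OF st(2) c d]) (use b in \<open>force simp: abs_le_iff\<close>)+
    ultimately have "(x1 t - x2 t)\<^sup>2 + (y1 t - y2 t)\<^sup>2 \<le> exp (L * (t - s)) * ((x1 s - x2 s)\<^sup>2
        + (y1 s - y2 s)\<^sup>2) \<and>
        (x1 s - x2 s)\<^sup>2 + (y1 s - y2 s)\<^sup>2 \<le> exp (L * (t - s)) * ((x1 t - x2 t)\<^sup>2 + (y1 t - y2 t)\<^sup>2)"
      by (simp add: \<rho>_def)
  }
  then show ?thesis using L0 by blast
qed

lemma traj_unique_backward:
  assumes "traj x1 y1" "traj x2 y2" "0 \<le> m" "m \<le> s" "m \<le> t" "x1 s = x2 t" "y1 s = y2 t"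
  shows "x1 (s - m) = x2 (t - m)" "y1 (s - m) = y2 (t - m)"
proof -
  have z: "traj (\<lambda>u. x1 (s - m + u)) (\<lambda>u. y1 (s - m + u))" "traj (\<lambda>u. x2 (t - m + u)) (\<lambda>u. y2 (t - m + u))"
    using assms by (intro traj_shift; simp)+
  obtain M1 where M1: "\<And>t. 0 \<le> t \<Longrightarrow> \<bar>x1 t\<bar> \<le> M1" using traj_bound[OF assms(1)] by metis
  obtain M2 where M2: "\<And>t. 0 \<le> t \<Longrightarrow> \<bar>x2 t\<bar> \<le> M2" using traj_bound[OF assms(2)] by metis
  have bd: "\<forall>u\<ge>0. \<bar>x1 (s - m + u)\<bar> \<le> max M1 M2 \<and> \<bar>x2 (t - m + u)\<bar> \<le> max M1 M2"
    using M1[of "s - m + _"] M2[of "t - m + _"] assms by (auto simp: le_max_iff_disj)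
  obtain L where "(x1 (s - m + 0) - x2 (t - m + 0))\<^sup>2 + (y1 (s - m + 0) - y2 (t - m + 0))\<^sup>2
     \<le> exp (L * (m - 0)) * ((x1 (s - m + m) - x2 (t - m + m))\<^sup>2 + (y1 (s - m + m) - y2 (t - m + m))\<^sup>2)"
    using traj_gronwall[of "max M1 M2"] z bd assms(3) by fast
  then have "(x1 (s - m) - x2 (t - m))\<^sup>2 + (y1 (s - m) - y2 (t - m))\<^sup>2 \<le> 0"
    using assms(6,7) by simp
  then have "(x1 (s - m) - x2 (t - m))\<^sup>2 + (y1 (s - m) - y2 (t - m))\<^sup>2 = 0"
    by (metis add_nonneg_nonneg antisym zero_le_power2)
  then show "x1 (s - m) = x2 (t - m)" "y1 (s - m) = y2 (t - m)"
    by (simp_all add: add_nonneg_eq_0_iff)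
qed

lemma traj_zero: "traj (\<lambda>_. 0) (\<lambda>_. 0)"
  by (auto simp: traj_def)

lemma nontrivial:
  assumes "traj x y" "x 0 \<noteq> 0 \<or> y 0 \<noteq> 0" "0 \<le> t"
  shows "x t \<noteq> 0 \<or> y t \<noteq> 0"
  using traj_unique_backward[OF assms(1) traj_zero assms(3) order_refl, of t] assms(2) by auto

section \<open>The dichotomy between slow and fast decay\<close>

text \<open>
  The quadratic term is the only negative one in the energy, so an energy below \<open>-e\<close> forces
  \<open>alpha lam x\<^sup>2/2 \<ge> e\<close>.
\<close>

lemma negative_energy_trapped:
  assumes "traj x y" "0 \<le> T" "energy (x T) (y T) < 0"
  shows "\<exists>c>0. (\<forall>t\<ge>T. c \<le> x t) \<or> (\<forall>t\<ge>T. x t \<le> - c)"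
proof -
  define e where "e = - energy (x T) (y T)"
  define c where "c = sqrt (2 * e / (alpha * lam))"
  have e: "e > 0" using assms by (simp add: e_def)
  have c: "c > 0" using e B_pos by (simp add: c_def)
  have c2: "c\<^sup>2 = 2 * e / (alpha * lam)" using e B_pos by (simp add: c_def)
  have big: "c \<le> \<bar>x t\<bar>" if "t \<ge> T" for t
  proof -
    have "energy (x t) (y t) \<le> - e" using energy_antimono[OF assms(1,2) that] by (simp add: e_def)
    moreover have "0 \<le> K * \<bar>x t\<bar> powr q / q" using K_pos q_gt_2 by simp
    moreover have "0 \<le> (y t)\<^sup>2 / 2" by simp
    ultimately have "e \<le> alpha * lam * (x t)\<^sup>2 / 2" unfolding energy_def potential_def by linarith
    then have "c\<^sup>2 \<le> (x t)\<^sup>2" using B_pos unfolding c2 by (simp add: field_simps)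
    then show ?thesis using c by (simp add: abs_le_square_iff[symmetric])
  qed
  have "(\<forall>t\<ge>T. x t > 0) \<or> (\<forall>t\<ge>T. x t < 0)"
    by (rule no_zero_constant_sign) (use traj_cont[OF assms(1)] assms big c in force)+
  then show ?thesis using big c by (intro exI[of _ c]) fastforce
qed

text \<open>
  The level \<open>p\<close> is chosen between the positive equilibrium and the positive zero of the potential. An orbit
  of nonnegative energy therefore passes through \<open>0 < |x| \<le> p\<close> with \<open>y\<^sup>2 \<ge> 2\<kappa>x\<^sup>2\<close>, while beyond \<open>p\<close> the
  force already pulls it back.
\<close>

lemma saddle_region:
  "\<exists>\<kappa>>0. \<exists>p>0. restoring p < 0 \<and> (\<forall>x. \<bar>x\<bar> \<le> p \<longrightarrow> potential x \<le> - \<kappa> * x\<^sup>2)"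
proof -
  define c where "c = (1 + q / 2) / 2"
  have c: "1 < c" "c < q / 2" using q_gt_2 by (auto simp: c_def)
  define p where "p = (c * (alpha * lam) / K) powr (1 / (q - 2))"
  have p: "p > 0" "p powr (q - 2) = c * (alpha * lam) / K"
    using c B_pos K_pos q_gt_2 by (auto simp: p_def powr_powr)
  define \<kappa> where "\<kappa> = alpha * lam * (1 / 2 - c / q)"
  have k: "\<kappa> > 0" using c q_gt_2 unfolding \<kappa>_def by (intro mult_pos_pos[OF B_pos]) (auto simp: field_simps)
  have "alpha * lam * 1 < alpha * lam * c" using B_pos c by (intro mult_strict_left_mono) auto
  then have "alpha * lam - K * p powr (q - 2) < 0" using K_pos unfolding p(2) by (simp add: algebra_simps)
  then have "restoring p < 0" using p(1) by (simp add: restoring_eq mult_pos_neg)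
  moreover have pos: "potential x \<le> - \<kappa> * x\<^sup>2" if "0 \<le> x" "x \<le> p" for x
  proof (cases "x = 0")
    case False
    then have x: "0 < x" using that by simp
    have "x powr (q - 2) \<le> p powr (q - 2)" using that q_gt_2 by (intro powr_mono2) auto
    then have "K * x powr (q - 2) / q \<le> K * (c * (alpha * lam) / K) / q"
      unfolding p(2)[symmetric] using K_pos q_gt_2 by (intro divide_right_mono mult_left_mono) auto
    then have "K * x powr (q - 2) / q - alpha * lam / 2 \<le> - \<kappa>"
      using K_pos by (simp add: \<kappa>_def algebra_simps)
    then have "x\<^sup>2 * (K * x powr (q - 2) / q - alpha * lam / 2) \<le> x\<^sup>2 * (- \<kappa>)"
      by (intro mult_left_mono) auto
    then show ?thesis unfolding potential_eq[OF x] by (simp only: mult.commute)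
  qed simp
  have "potential x \<le> - \<kappa> * x\<^sup>2" if "\<bar>x\<bar> \<le> p" for x
    using pos[of x] pos[of "- x"] that by (cases "0 \<le> x") auto
  ultimately show ?thesis using k p by blast
qed

text \<open>
  By \<open>fast_decay\<close> and \<open>slow_growth\<close> below, this condition on the energy separates the solutions of fast decay
  from those of slow decay.
\<close>

definition fast :: "(real \<Rightarrow> real) \<Rightarrow> (real \<Rightarrow> real) \<Rightarrow> bool" where
  "fast x y \<longleftrightarrow> (\<forall>t\<ge>0. 0 \<le> energy (x t) (y t))"

text \<open>
  This is Barbalat's argument. The acceleration is bounded, so each time at which \<open>|y| \<ge> \<epsilon>\<close> is followed by a
  time interval of fixed length with \<open>|y| \<ge> \<epsilon>/2\<close>, which costs a fixed amount of energy. But the energy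
  converges.
\<close>

lemma fast_velocity_tendsto_0:
  assumes "traj x y" "fast x y"
  shows "(y \<longlongrightarrow> 0) at_top"
proof -
  obtain M where M: "M > 0" "\<And>t. 0 \<le> t \<Longrightarrow> \<bar>x t\<bar> \<le> M" "\<And>t. 0 \<le> t \<Longrightarrow> \<bar>y t\<bar> \<le> M"
    using traj_bound[OF assms(1)] by metis
  have "bounded (restoring ` {-M..M})"
    by (intro compact_imp_bounded compact_continuous_image continuous_intros) simp
  then obtain C0 where C0: "\<And>z. \<bar>z\<bar> \<le> M \<Longrightarrow> \<bar>restoring z\<bar> \<le> C0"
    by (fastforce simp: bounded_iff abs_le_iff)
  define C where "C = 1 + \<bar>C0\<bar> + damping * M"
  have C: "C > 0" using M damping_pos by (simp add: C_def add_pos_nonneg)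
  have y': "\<bar>restoring (x t) - damping * y t\<bar> \<le> C" if "t \<ge> 0" for t
  proof -
    have "\<bar>damping * y t\<bar> \<le> damping * M" using M(3)[OF that] damping_pos by (simp add: abs_mult)
    then show ?thesis using C0[OF M(2)[OF that]] by (simp add: C_def)
  qed
  have "(\<lambda>t. - energy (x t) (y t)) s \<le> (\<lambda>t. - energy (x t) (y t)) t" if "0 \<le> s" "s \<le> t" for s t
    using energy_antimono[OF assms(1) that] by simp
  then obtain L where "((\<lambda>t. - energy (x t) (y t)) \<longlongrightarrow> L) at_top"
    using increasing_bounded_convergent[of 0 "\<lambda>t. - energy (x t) (y t)" 0] assms(2)
    by (auto simp: fast_def)
  then have L: "((\<lambda>t. energy (x t) (y t)) \<longlongrightarrow> - L) at_top"
    using tendsto_minus by fastforce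
  show ?thesis
  proof (rule tendstoI)
    fix \<epsilon> :: real assume e: "\<epsilon> > 0"
    define h where "h = \<epsilon> / (2 * C)"
    have h: "h > 0" using e C by (simp add: h_def)
    define l where "l = damping * (\<epsilon> / 2)\<^sup>2 * h"
    have l: "l > 0" using e h damping_pos by (simp add: l_def)
    have "eventually (\<lambda>t. dist (energy (x t) (y t)) (- L) < l / 2) at_top"
      using tendstoD[OF L, of "l / 2"] l by simp
    then obtain T where T: "\<And>t. t \<ge> T \<Longrightarrow> dist (energy (x t) (y t)) (- L) < l / 2"
      by (auto simp: eventually_at_top_linorder)
    have "\<bar>y t\<bar> < \<epsilon>" if t: "t \<ge> max 0 T" for t
    proof (rule ccontr)
      assume "\<not> \<bar>y t\<bar> < \<epsilon>"
      have near: "\<bar>y s - y t\<bar> \<le> \<epsilon> / 2" if s: "t \<le> s" "s \<le> t + h" for s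
      proof -
        have cy: "continuous_on {t..s} y" using t by (intro traj_cont[OF assms(1)]) auto
        have "y s \<le> y t + C * (s - t)"
          by (rule diff_le_if_deriv_le[OF s(1) cy trajD(4)[OF assms(1)]]) (use t y' in \<open>auto simp: abs_le_iff\<close>)
        moreover have "- y s \<le> - y t + C * (s - t)"
          by (rule diff_le_if_deriv_le[OF s(1) continuous_on_minus[OF cy] DERIV_minus[OF trajD(4)[OF assms(1)]]])
             (use t y' in \<open>force simp: abs_le_iff\<close>)+
        moreover have "C * (s - t) \<le> C * h" using s C by simp
        moreover have "C * h = \<epsilon> / 2" using C by (simp add: h_def)
        ultimately show ?thesis by linarith
      qed
      have "energy (x (t + h)) (y (t + h)) \<le> energy (x t) (y t) + (- damping * (\<epsilon> / 2)\<^sup>2) * (t + h - t)"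
      proof (rule diff_le_if_deriv_le)
        show "continuous_on {t..t + h} (\<lambda>t. energy (x t) (y t))"
          using t by (intro cont_energy[OF assms(1)]) auto
        show "((\<lambda>t. energy (x t) (y t)) has_real_derivative - damping * (y s)\<^sup>2) (at s)" if "t < s" for s
          using that t by (intro deriv_energy[OF assms(1)]) auto
        fix s assume "t < s" "s < t + h"
        then have "\<epsilon> / 2 \<le> \<bar>y s\<bar>" using near[of s] \<open>\<not> \<bar>y t\<bar> < \<epsilon>\<close> by linarith
        then have "(\<epsilon> / 2)\<^sup>2 \<le> (y s)\<^sup>2" using e abs_le_square_iff[of "\<epsilon> / 2" "y s"] by simp
        then show "- damping * (y s)\<^sup>2 \<le> - damping * (\<epsilon> / 2)\<^sup>2" using damping_pos by simp
      qed (use h in simp)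
      then have "l \<le> energy (x t) (y t) - energy (x (t + h)) (y (t + h))" by (simp add: l_def)
      moreover have "dist (energy (x t) (y t)) (- L) < l / 2"
          "dist (energy (x (t + h)) (y (t + h))) (- L) < l / 2"
        using T[of t] T[of "t + h"] t h by auto
      ultimately show False unfolding dist_real_def by linarith
    qed
    then show "eventually (\<lambda>t. dist (y t) 0 < \<epsilon>) at_top"
      by (intro eventually_at_top_linorderI[of "max 0 T"]) simp
  qed
qed

text \<open>
  Once \<open>|y|\<close> is small, the inequality \<open>y\<^sup>2 \<ge> 2\<kappa>x\<^sup>2\<close> for \<open>|x| \<le> p\<close> keeps the orbit out of
  \<open>p/2 \<le> |x| \<le> p\<close>. It cannot stay in \<open>|x| > p\<close> either, since there the force would make \<open>|y|\<close> large. So it ends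
  up in \<open>|x| < p/2\<close>, where the same inequality shows that \<open>x\<close> tends to \<open>0\<close> along with \<open>y\<close> and that \<open>y\<close> does not vanish.
\<close>

lemma fast_tail:
  assumes "traj x y" "x 0 \<noteq> 0 \<or> y 0 \<noteq> 0" "fast x y"
  shows "(x \<longlongrightarrow> 0) at_top"
    and "\<exists>T\<ge>0. (\<forall>t\<ge>T. 0 < x t \<and> y t < 0) \<or> (\<forall>t\<ge>T. x t < 0 \<and> 0 < y t)"
proof -
  obtain \<kappa> p where kp: "\<kappa> > 0" "p > 0" "restoring p < 0" "\<And>x. \<bar>x\<bar> \<le> p \<Longrightarrow> potential x \<le> - \<kappa> * x\<^sup>2"
    using saddle_region by blast
  have ylow: "2 * \<kappa> * (x t)\<^sup>2 \<le> (y t)\<^sup>2" if "t \<ge> 0" "\<bar>x t\<bar> \<le> p" for t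
  proof -
    have "0 \<le> (y t)\<^sup>2 / 2 + potential (x t)" using assms(3) that(1) by (simp add: fast_def energy_def)
    then show ?thesis using kp(4)[OF that(2)] by linarith
  qed
  define \<epsilon> where "\<epsilon> = min (sqrt (2 * \<kappa>) * (p / 2)) (- restoring p / (2 * damping))"
  have e: "\<epsilon> > 0" using kp damping_pos by (simp add: \<epsilon>_def divide_neg_pos)
  have e1: "\<epsilon>\<^sup>2 \<le> 2 * \<kappa> * (p / 2)\<^sup>2"
  proof -
    have "\<epsilon>\<^sup>2 \<le> (sqrt (2 * \<kappa>) * (p / 2))\<^sup>2" using e by (intro power_mono) (auto simp: \<epsilon>_def)
    also have "\<dots> = 2 * \<kappa> * (p / 2)\<^sup>2" using kp by (simp only: power_mult_distrib) simp
    finally show ?thesis .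
  qed
  have e2: "damping * \<epsilon> \<le> - restoring p / 2"
  proof -
    have "damping * \<epsilon> \<le> damping * (- restoring p / (2 * damping))" 
      using damping_pos by (intro mult_left_mono) (auto simp: \<epsilon>_def)
    then show ?thesis using damping_pos by simp
  qed
  note y0 = fast_velocity_tendsto_0[OF assms(1,3)]
  obtain T0 where T0: "\<And>t. t \<ge> T0 \<Longrightarrow> \<bar>y t\<bar> < \<epsilon>"
    using tendstoD[OF y0 e] by (auto simp: eventually_at_top_linorder)
  define T where "T = max 0 T0"
  have T: "T \<ge> 0" "\<And>t. t \<ge> T \<Longrightarrow> \<bar>y t\<bar> < \<epsilon>" using T0 by (auto simp: T_def)
  have gap: "\<bar>x t\<bar> < p / 2" if "t \<ge> T" "\<bar>x t\<bar> \<le> p" for t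
  proof -
    have "2 * \<kappa> * (x t)\<^sup>2 \<le> (y t)\<^sup>2" using ylow that T by simp
    also have "\<dots> < \<epsilon>\<^sup>2" using T(2)[OF that(1)] e
        by (metis abs_ge_zero power2_abs power_strict_mono zero_less_numeral)
    also note e1
    finally have "(x t)\<^sup>2 < (p / 2)\<^sup>2" using kp by simp
    then show ?thesis using kp abs_square_less_1
        by (metis abs_of_pos half_gt_zero_iff power2_abs power_less_imp_less_base abs_ge_zero less_imp_le)
  qed
  have trapped: False if z: "traj x y" and yb: "\<And>t. t \<ge> T \<Longrightarrow> \<bar>y t\<bar> < \<epsilon>" and gp: "\<And>t. t \<ge> T \<Longrightarrow> \<bar>x t\<bar> \<le> p
      \<Longrightarrow> \<bar>x t\<bar> < p / 2"
    and xT: "x T > p" for x y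
  proof -
    have "continuous_on {T..} (\<lambda>t. x t - p)" using T by (intro continuous_intros traj_cont[OF z]) auto
    then have "(\<forall>t\<ge>T. x t - p > 0) \<or> (\<forall>t\<ge>T. x t - p < 0)"
      by (rule no_zero_constant_sign) (use gp kp in force)
    then have xp: "x t > p" if "t \<ge> T" for t using xT that by force
    define t where "t = T + 4 * \<epsilon> / (- restoring p) "
    have t: "T \<le> t" using e kp by (simp add: t_def divide_pos_neg less_imp_le)
    have "y t \<le> y T + (restoring p / 2) * (t - T)"
    proof (rule diff_le_if_deriv_le[OF t _ trajD(4)[OF z]])
      show "continuous_on {T..t} y" using T by (intro traj_cont[OF z]) auto
      fix s assume s: "T < s" "s < t"
      then show "0 < s" using T by simp
      have "restoring (x s) \<le> restoring p" using restoring_antimono_neg[of p "x s"] xp[of s] s kp by simp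
      moreover have "- (damping * y s) \<le> damping * \<epsilon>" using yb[of s] s damping_pos
        using mult_left_mono[of "- y s" \<epsilon> damping] by auto
      ultimately show "restoring (x s) - damping * y s \<le> restoring p / 2" using e2 by linarith
    qed
    also have "(restoring p / 2) * (t - T) = - 2 * \<epsilon>" using kp by (simp add: t_def)
    finally show False using yb[of t] yb[of T] t e by (simp add: abs_less_iff)
  qed
  have "\<bar>x T\<bar> \<le> p"
  proof (rule ccontr)
    assume "\<not> \<bar>x T\<bar> \<le> p"
    then consider "x T > p" | "- x T > p" by linarith
    then show False
    proof cases
      case 1 then show False using trapped[OF assms(1) T(2) gap] by blast
    next
      case 2 then show False using trapped[OF traj_minus[OF assms(1)]] T(2) gap by auto
    qed
  qed
  have "continuous_on {T..} (\<lambda>t. \<bar>x t\<bar> - p)" using T by (intro continuous_intros traj_cont[OF assms(1)]) auto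
  then have "(\<forall>t\<ge>T. \<bar>x t\<bar> - p > 0) \<or> (\<forall>t\<ge>T. \<bar>x t\<bar> - p < 0)"
    by (rule no_zero_constant_sign) (use gap kp in force)
  then have small: "\<bar>x t\<bar> \<le> p" if "t \<ge> T" for t using \<open>\<bar>x T\<bar> \<le> p\<close> that by force
  have xy: "\<bar>x t\<bar> \<le> \<bar>y t\<bar> / sqrt (2 * \<kappa>)" if "t \<ge> T" for t
  proof -
    have "(sqrt (2 * \<kappa>) * \<bar>x t\<bar>)\<^sup>2 \<le> \<bar>y t\<bar>\<^sup>2"
      using ylow[of t] small[OF that] T that kp by (simp add: power_mult_distrib)
    then have "sqrt (2 * \<kappa>) * \<bar>x t\<bar> \<le> \<bar>y t\<bar>" by (rule power2_le_imp_le) simp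
    then show ?thesis using kp by (simp add: field_simps)
  qed
  have "((\<lambda>t. \<bar>y t\<bar> / sqrt (2 * \<kappa>)) \<longlongrightarrow> 0 / sqrt (2 * \<kappa>)) at_top"
    using kp by (intro tendsto_divide tendsto_const tendsto_rabs_zero y0) auto
  then show x0: "(x \<longlongrightarrow> 0) at_top"
    by (intro Lim_null_comparison[of x "\<lambda>t. \<bar>y t\<bar> / sqrt (2 * \<kappa>)"])
       (auto intro!: eventually_at_top_linorderI[of T] xy)
  have yn: "y t \<noteq> 0" if "t \<ge> T" for t
    using nontrivial[OF assms(1,2), of t] xy[OF that] that T by auto
  have tail: "0 < x t" if z: "traj x y" and lim: "(x \<longlongrightarrow> 0) at_top" and neg: "\<And>t. t \<ge> T
      \<Longrightarrow> y t < 0" and t: "t \<ge> T" for x y t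
  proof (rule ccontr)
    have dec: "x b < x a" if "T \<le> a" "a < b" for a b
      by (rule strict_decreasing_if_deriv_neg[OF that(2) _ trajD(3)[OF z]])
         (use that T neg traj_cont[OF z] in auto)
    assume "\<not> 0 < x t"
    then have n: "x (t + 1) < 0" using dec[of t "t + 1"] t by simp
    have "eventually (\<lambda>s. x (t + 1) < x s) at_top" using order_tendstoD(1)[OF lim n] .
    then obtain S where "\<And>s. s \<ge> S \<Longrightarrow> x (t + 1) < x s" by (auto simp: eventually_at_top_linorder)
    then have "x (t + 1) < x (max S (t + 2))" by simp
    moreover have "x (max S (t + 2)) < x (t + 1)" using t by (intro dec) auto
    ultimately show False by simp
  qed
  have "(\<forall>t\<ge>T. y t > 0) \<or> (\<forall>t\<ge>T. y t < 0)"
    by (rule no_zero_constant_sign) (use traj_cont[OF assms(1)] T yn in auto)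
  then show "\<exists>T\<ge>0. (\<forall>t\<ge>T. 0 < x t \<and> y t < 0) \<or> (\<forall>t\<ge>T. x t < 0 \<and> 0 < y t)"
  proof
    assume a: "\<forall>t\<ge>T. y t > 0"
    have "((\<lambda>t. - x t) \<longlongrightarrow> 0) at_top" using tendsto_minus[OF x0] by simp
    from tail[OF traj_minus[OF assms(1)] this] a show ?thesis using T(1) by auto
  next
    assume "\<forall>t\<ge>T. y t < 0"
    then show ?thesis using tail[OF assms(1) x0] T(1) by auto
  qed
qed

text \<open>
  The quantity \<open>w = y + lam x\<close> is the component in the unstable direction of the saddle, and
  \<open>w' = alpha w - K f(x)\<close>. As it tends to \<open>0\<close> although it is repelled, it satisfies
  \<open>0 \<le> w \<le> (K/alpha) f(x)\<close>. The function \<open>m = e\<^bsup>lam t\<^esup> x\<close> has derivative \<open>e\<^bsup>lam t\<^esup> w\<close>; the first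
  inequality makes it nondecreasing, and by the second \<open>m'/m \<le> (K/alpha) x\<^bsup>q-2\<^esup>\<close>, which is integrable as \<open>x\<close>
  decays exponentially. So \<open>m\<close> is bounded.
\<close>

lemma fast_decay_positive:
  assumes z: "traj x y" and T: "0 \<le> T" and sgn: "\<And>t. t \<ge> T \<Longrightarrow> 0 < x t \<and> y t < 0"
    and x0: "(x \<longlongrightarrow> 0) at_top" and y0: "(y \<longlongrightarrow> 0) at_top"
  shows "\<exists>L. ((\<lambda>t. exp (lam * t) * x t) \<longlongrightarrow> L) at_top"
proof -
  define w where "w = (\<lambda>t. y t + lam * x t)"
  have dw: "(w has_real_derivative alpha * w t - K * f (x t)) (at t)" if "t > 0" for t
    unfolding w_def
    by (rule DERIV_cong[OF DERIV_add[OF trajD(4)[OF z that] DERIV_cmult[OF trajD(3)[OF z that]]]])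
       (simp add: restoring_def damping_def algebra_simps)
  have cw: "continuous_on S w" if "S \<subseteq> {0..}" for S
    unfolding w_def by (intro continuous_intros traj_cont[OF z that])
  have w0: "(w \<longlongrightarrow> 0) at_top"
    using tendsto_add[OF y0 tendsto_mult[OF tendsto_const[of lam] x0]] by (simp add: w_def)
  \<comment> \<open>A function that grows at least at the rate \<open>alpha\<close> while positive cannot be positive and tend to \<open>0\<close>.\<close>
  have unstable: "\<psi> t \<le> 0" if lim: "(\<psi> \<longlongrightarrow> 0) at_top" and c: "continuous_on {T..} \<psi>"
    and d: "\<And>t. t > T \<Longrightarrow> (\<psi> has_real_derivative \<psi>' t) (at t)"
    and ge: "\<And>t. t > T \<Longrightarrow> alpha * \<psi> t \<le> \<psi>' t" and t: "t \<ge> T" for \<psi> \<psi>' t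
  proof (rule ccontr)
    assume n: "\<not> \<psi> t \<le> 0"
    have "\<psi> t \<le> \<psi> s" if "s \<ge> t" for s
    proof -
      have "\<psi> t \<le> exp (- alpha * (s - t)) * \<psi> s"
        by (rule gronwall_backward[OF that continuous_on_subset[OF c] d]) (use t ge in auto)
      moreover have "exp (- alpha * (s - t)) \<le> 1" using that alpha_pos by simp
      moreover have "0 < \<psi> s"
      proof (rule ccontr)
        assume "\<not> 0 < \<psi> s"
        then have "exp (- alpha * (s - t)) * \<psi> s \<le> 0" by (simp add: mult_nonneg_nonpos)
        then show False using \<open>\<psi> t \<le> exp (- alpha * (s - t)) * \<psi> s\<close> n by linarith
      qed
      ultimately show ?thesis
        by (meson less_imp_le mult_left_le_one_le exp_ge_zero order_trans)
    qed
    moreover have "eventually (\<lambda>s. \<psi> s < \<psi> t) at_top" using order_tendstoD(2)[OF lim, of "\<psi> t"] n by simp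
    then obtain S where "\<And>s. s \<ge> S \<Longrightarrow> \<psi> s < \<psi> t" by (auto simp: eventually_at_top_linorder)
    ultimately show False by (metis max.cobounded1 max.cobounded2 not_less)
  qed
  have fx0: "((\<lambda>t. f (x t)) \<longlongrightarrow> 0) at_top"
    using isCont_tendsto_compose[OF DERIV_isCont[OF has_real_derivative_odd_power[OF q_gt_2]] x0] by simp
  have w_le: "w t \<le> K / alpha * f (x t)" if "t \<ge> T" for t
  proof -
    define \<psi> where "\<psi> = (\<lambda>t. w t - K / alpha * f (x t))"
    define \<psi>' where "\<psi>' = (\<lambda>t. alpha * w t - K * f (x t) - K / alpha * ((q - 1) * \<bar>x t\<bar> powr (q - 2) * y t))"
    have "\<psi> t \<le> 0"
    proof (rule unstable[where \<psi> = \<psi> and \<psi>' = \<psi>'])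
      show "(\<psi> \<longlongrightarrow> 0) at_top"
        using tendsto_diff[OF w0 tendsto_mult[OF tendsto_const[of "K / alpha"] fx0]] by (simp add: \<psi>_def)
      show "continuous_on {T..} \<psi>" unfolding \<psi>_def using T
        by (intro continuous_intros cw traj_cont[OF z] q_gt_2) auto
      show "(\<psi> has_real_derivative \<psi>' t) (at t)" if "t > T" for t
      proof -
        have t: "0 < t" using that T by simp
        show ?thesis unfolding \<psi>_def \<psi>'_def
          by (rule DERIV_diff[OF dw[OF t] DERIV_cmult[OF has_real_derivative_odd_power_chain[OF q_gt_2 trajD(3)[OF z t]]]])
      qed
      show "alpha * \<psi> t \<le> \<psi>' t" if "t > T" for t
      proof -
        have "K / alpha * ((q - 1) * \<bar>x t\<bar> powr (q - 2) * y t) \<le> 0"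
          using sgn[of t] that K_pos alpha_pos q_gt_2 by (intro mult_nonneg_nonpos) auto
        moreover have "alpha * \<psi> t = alpha * w t - K * f (x t)"
          using alpha_pos by (simp add: \<psi>_def algebra_simps)
        ultimately show ?thesis unfolding \<psi>'_def by linarith
      qed
    qed (rule that)
    then show ?thesis by (simp add: \<psi>_def)
  qed
  have w_ge: "0 \<le> w t" if "t \<ge> T" for t
  proof -
    have "- w t \<le> 0"
    proof (rule unstable[where \<psi> = "\<lambda>t. - w t" and \<psi>' = "\<lambda>t. - (alpha * w t - K * f (x t))"])
      show "((\<lambda>t. - w t) \<longlongrightarrow> 0) at_top" using tendsto_minus[OF w0] by simp
      show "continuous_on {T..} (\<lambda>t. - w t)" using T by (intro continuous_intros cw) auto
      show "((\<lambda>t. - w t) has_real_derivative - (alpha * w t - K * f (x t))) (at t)" if "t > T" for t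
        using that T by (intro DERIV_minus dw) simp
      show "alpha * - w t \<le> - (alpha * w t - K * f (x t))" if "t > T" for t
        using odd_power_pos[of "x t" q] sgn[of t] K_pos that by simp
    qed (rule that)
    then show ?thesis by simp
  qed
  have f_eq: "f (x t) = x t powr (q - 2) * x t" if "t \<ge> T" for t
    using sgn[OF that] by (simp add: odd_power_def)
  define \<delta> where "\<delta> = (alpha * lam / (2 * K)) powr (1 / (q - 2))"
  have d: "\<delta> > 0" "\<delta> powr (q - 2) = alpha * lam / (2 * K)"
    using B_pos K_pos q_gt_2 by (auto simp: \<delta>_def powr_powr)
  have "eventually (\<lambda>t. x t < \<delta>) at_top" using order_tendstoD(2)[OF x0 d(1)] .
  then obtain T0 where T0: "\<And>t. t \<ge> T0 \<Longrightarrow> x t < \<delta>" by (auto simp: eventually_at_top_linorder)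
  define S where "S = max T T0"
  have S: "T \<le> S" "0 \<le> S" "\<And>t. t \<ge> S \<Longrightarrow> x t < \<delta>" using T0 T by (auto simp: S_def)
  have decay: "y t \<le> - (lam / 2) * x t" if "t \<ge> S" for t
  proof -
    have t: "T \<le> t" using that S by simp
    have "x t powr (q - 2) \<le> \<delta> powr (q - 2)" using S(3)[OF that] sgn[OF t] q_gt_2 by (intro powr_mono2) auto
    then have "K / alpha * x t powr (q - 2) \<le> K / alpha * (alpha * lam / (2 * K))"
      unfolding d(2) using K_pos alpha_pos by (intro mult_left_mono) auto
    also have "\<dots> = lam / 2" using K_pos alpha_pos by simp
    finally have "K / alpha * x t powr (q - 2) * x t \<le> lam / 2 * x t"
      using sgn[OF t] by (intro mult_right_mono) auto
    moreover have "w t \<le> K / alpha * x t powr (q - 2) * x t" using w_le[OF t] by (simp add: f_eq[OF t])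
    ultimately have "w t \<le> lam / 2 * x t" by linarith
    then show ?thesis by (simp add: w_def)
  qed
  have x_le: "x t \<le> exp (- (lam / 2) * (t - S)) * x S" if "t \<ge> S" for t
    by (rule gronwall_forward[OF that _ trajD(3)[OF z]])
       (use S decay traj_cont[OF z] in auto)
  define \<mu> where "\<mu> = lam / 2 * (q - 2)"
  have mu: "\<mu> > 0" using lam_pos q_gt_2 by (simp add: \<mu>_def)
  define X where "X = K / alpha * x S powr (q - 2)"
  have X: "0 \<le> X" using K_pos alpha_pos by (simp add: X_def)
  have coeff: "K / alpha * x t powr (q - 2) \<le> X * exp (- \<mu> * (t - S))" if "t \<ge> S" for t
  proof -
    have "x t powr (q - 2) \<le> (exp (- (lam / 2) * (t - S)) * x S) powr (q - 2)"
      using x_le[OF that] sgn[of t] S that q_gt_2 by (intro powr_mono2) auto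
    also have "\<dots> = exp (- \<mu> * (t - S)) * x S powr (q - 2)"
      using sgn[of S] S by (simp add: powr_mult exp_powr_real \<mu>_def algebra_simps)
    finally have "K / alpha * x t powr (q - 2) \<le> K / alpha * (exp (- \<mu> * (t - S)) * x S powr (q - 2))"
      using K_pos alpha_pos by (intro mult_left_mono) auto
    then show ?thesis by (simp add: X_def algebra_simps)
  qed
  define m where "m = (\<lambda>t. exp (lam * t) * x t)"
  have dm: "(m has_real_derivative exp (lam * t) * w t) (at t)" if "t > 0" for t
  proof -
    have e: "((\<lambda>t. exp (lam * t)) has_real_derivative exp (lam * t) * lam) (at t)"
      by (auto intro!: derivative_eq_intros)
    show ?thesis unfolding m_def
      by (rule DERIV_cong[OF DERIV_mult[OF e trajD(3)[OF z that]]]) (simp add: w_def algebra_simps)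
  qed
  have cm: "continuous_on A m" if "A \<subseteq> {0..}" for A
    unfolding m_def by (intro continuous_intros traj_cont[OF z that])
  have m_mono: "m s \<le> m t" if "S \<le> s" "s \<le> t" for s t
    by (rule increasing_if_deriv_nonneg[OF that(2) cm dm]) (use that S w_ge in auto)
  \<comment> \<open>The exponent is the integral from \<open>t\<close> to infinity of the bound for \<open>m'/m\<close>, so that \<open>m e\<close> is nonincreasing.\<close>
  define e where "e = (\<lambda>t. exp (X / \<mu> * exp (- \<mu> * (t - S))))"
  have de: "(e has_real_derivative e t * (- X * exp (- \<mu> * (t - S)))) (at t)" for t
    unfolding e_def using mu by (auto intro!: derivative_eq_intros)
  have e_bd: "1 \<le> e t" for t using X mu by (simp add: e_def)
  have bound: "m t \<le> m S * e S" if "t \<ge> S" for t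
  proof -
    have "m t * e t \<le> m S * e S"
    proof (rule decreasing_if_deriv_nonpos[OF that])
      show "continuous_on {S..t} (\<lambda>t. m t * e t)"
        unfolding e_def using S by (intro continuous_intros cm) auto
      fix s assume s: "S < s" "s < t"
      then have s0: "0 < s" using S by simp
      show "((\<lambda>t. m t * e t) has_real_derivative
          exp (lam * s) * w s * e s + (e s * (- X * exp (- \<mu> * (s - S)))) * m s) (at s)"
        by (rule DERIV_mult[OF dm[OF s0] de])
      have "w s \<le> K / alpha * x s powr (q - 2) * x s" using w_le[of s] f_eq[of s] s S by simp
      also have "\<dots> \<le> X * exp (- \<mu> * (s - S)) * x s"
        using coeff[of s] s sgn[of s] S by (intro mult_right_mono) auto
      finally have "exp (lam * s) * w s \<le> exp (lam * s) * (X * exp (- \<mu> * (s - S)) * x s)"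
        by (intro mult_left_mono) auto
      then have "exp (lam * s) * w s \<le> X * exp (- \<mu> * (s - S)) * m s" by (simp add: m_def algebra_simps)
      then have "exp (lam * s) * w s * e s \<le> X * exp (- \<mu> * (s - S)) * m s * e s"
        using e_bd[of s] by (intro mult_right_mono) auto
      then show "exp (lam * s) * w s * e s + (e s * (- X * exp (- \<mu> * (s - S)))) * m s \<le> 0"
        by (simp add: algebra_simps)
    qed
    moreover have "0 \<le> m t" using sgn[of t] S that by (simp add: m_def)
    then have "m t * 1 \<le> m t * e t" using e_bd by (intro mult_left_mono) auto
    ultimately show ?thesis by simp
  qed
  show ?thesis using increasing_bounded_convergent[of S m "m S * e S"] m_mono bound
    unfolding m_def by blast
qed

lemma fast_decay:
  assumes "traj x y" "x 0 \<noteq> 0 \<or> y 0 \<noteq> 0" "fast x y"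
  shows "\<exists>L. ((\<lambda>t. exp (lam * t) * x t) \<longlongrightarrow> L) at_top"
proof -
  note lims = fast_tail(1)[OF assms] fast_velocity_tendsto_0[OF assms(1,3)]
  obtain T where T: "T \<ge> 0" "(\<forall>t\<ge>T. 0 < x t \<and> y t < 0) \<or> (\<forall>t\<ge>T. x t < 0 \<and> 0 < y t)"
    using fast_tail(2)[OF assms] by blast
  from T(2) show ?thesis
  proof
    assume "\<forall>t\<ge>T. 0 < x t \<and> y t < 0"
    then show ?thesis using fast_decay_positive[OF assms(1) T(1) _ lims] by blast
  next
    assume "\<forall>t\<ge>T. x t < 0 \<and> 0 < y t"
    then obtain L where "((\<lambda>t. exp (lam * t) * (- x t)) \<longlongrightarrow> L) at_top"
      using fast_decay_positive[OF traj_minus[OF assms(1)] T(1)] tendsto_minus[OF lims(1)] tendsto_minus[OF lims(2)]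
      by auto
    from tendsto_minus[OF this] show ?thesis by auto
  qed
qed

text \<open>
  The factor \<open>e\<^bsup>lam t\<^esup>\<close> tends to infinity and \<open>x\<close> stays away from \<open>0\<close> with constant sign.
\<close>

lemma slow_growth:
  assumes "traj x y" "\<not> fast x y"
  shows "filterlim (\<lambda>t. exp (lam * t) * x t) at_top at_top \<or> filterlim (\<lambda>t. exp (lam * t) * x t) at_bot at_top"
proof -
  obtain T where T: "0 \<le> T" "energy (x T) (y T) < 0" using assms(2) by (auto simp: fast_def not_le)
  obtain c where c: "c > 0" "(\<forall>t\<ge>T. c \<le> x t) \<or> (\<forall>t\<ge>T. x t \<le> - c)"
    using negative_energy_trapped[OF assms(1) T] by blast
  have "filterlim (\<lambda>t::real. lam * t) at_top at_top"
    using filterlim_tendsto_pos_mult_at_top[OF tendsto_const lam_pos filterlim_ident] .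
  then have e: "filterlim (\<lambda>t. exp (lam * t)) at_top at_top"
    by (rule filterlim_compose[OF exp_at_top])
  have grow: "filterlim (\<lambda>t. exp (lam * t) * u t) at_top at_top" if "\<forall>t\<ge>T. c \<le> u t" for u
  proof (rule filterlim_at_top_mono)
    show "filterlim (\<lambda>t. c * exp (lam * t)) at_top at_top"
      using filterlim_tendsto_pos_mult_at_top[OF tendsto_const c(1) e] .
    show "eventually (\<lambda>t. c * exp (lam * t) \<le> exp (lam * t) * u t) at_top"
      using that by (intro eventually_at_top_linorderI[of T]) (simp add: mult.commute)
  qed
  from c(2) show ?thesis
  proof
    assume "\<forall>t\<ge>T. c \<le> x t" then show ?thesis using grow by blast
  next
    assume "\<forall>t\<ge>T. x t \<le> - c"
    then have "filterlim (\<lambda>t. exp (lam * t) * (- x t)) at_top at_top" using grow[of "\<lambda>t. - x t"] by force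
    then show ?thesis by (simp add: filterlim_uminus_at_top[symmetric] filterlim_uminus_at_bot)
  qed
qed

lemma rolle_velocity:
  assumes "traj x y" "0 \<le> s" "s < t" "x s = x t"
  obtains c where "s < c" "c < t" "y c = 0"
proof -
  have "\<exists>c. s < c \<and> c < t \<and> (\<lambda>v. y c * v) = (\<lambda>v. 0)"
    by (rule Rolle_deriv[where f = x and f' = "\<lambda>t v. y t * v", OF assms(3)])
       (use assms traj_cont[OF assms(1)] trajD(3)[OF assms(1)] in \<open>auto simp: has_field_derivative_def\<close>)
  then show ?thesis using that by (metis mult_cancel_left mult.right_neutral zero_neq_one)
qed

text \<open>
  Between two zeroes the orbit turns around at a point of nonnegative potential, hence with \<open>|x| > p\<close>. While
  \<open>x\<close> moves from \<open>p/2\<close> to \<open>p\<close> it has speed at least \<open>v\<close>, as its energy is nonnegative. Therefore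
  \<open>energy + damping v x\<close> is nonincreasing there and at least \<open>damping v p/2\<close> of energy is lost. The bound does
  not depend on the orbit, and it is what prevents the number of zeroes from jumping by two.
\<close>

lemma energy_loss_between_zeros:
  "\<exists>c0>0. \<forall>x y s1 s2. traj x y \<longrightarrow> (x 0 \<noteq> 0 \<or> y 0 \<noteq> 0) \<longrightarrow> 0 \<le> s1 \<longrightarrow> s1 < s2 \<longrightarrow>
     x s1 = 0 \<longrightarrow> x s2 = 0 \<longrightarrow> c0 \<le> energy (x s1) (y s1)"
proof -
  obtain \<kappa> p where kp: "\<kappa> > 0" "p > 0" "restoring p < 0" "\<And>x. \<bar>x\<bar> \<le> p \<Longrightarrow> potential x \<le> - \<kappa> * x\<^sup>2"
    using saddle_region by blast
  define v where "v = sqrt (2 * \<kappa>) * (p / 2)"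
  have v: "v > 0" "v\<^sup>2 = 2 * \<kappa> * (p / 2)\<^sup>2" using kp
      by (simp add: v_def, simp only: v_def power_mult_distrib) simp
  define c0 where "c0 = damping * v * (p / 2)"
  have c0: "c0 > 0" using damping_pos v kp by (simp add: c0_def)
  have loss: "c0 \<le> energy (x s) (y s)"
    if z: "traj x y" and s: "0 \<le> s" "s < c" "x s = 0" and c: "p < x c" "0 \<le> energy (x c) (y c)" for x y s c
  proof -
    have cx: "continuous_on {a..b} (\<lambda>t. x t - k)" if "0 \<le> a" for a b k
      using that by (intro continuous_intros traj_cont[OF z]) auto
    obtain b where b: "s < b" "b \<le> c" "x b = p" "\<And>t. s \<le> t \<Longrightarrow> t < b \<Longrightarrow> x t < p"
      using first_zero[of s c "\<lambda>t. x t - p", OF _ cx[OF s(1)]] s c kp by auto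
    obtain a where a: "s \<le> a" "a < b" "x a = p / 2" "\<And>t. a < t \<Longrightarrow> t \<le> b \<Longrightarrow> p / 2 < x t"
      using last_zero[of s b "\<lambda>t. x t - p / 2", OF _ cx[OF s(1)]] s b kp by auto
    have E0: "0 \<le> energy (x t) (y t)" if "0 \<le> t" "t \<le> c" for t
      using energy_antimono[OF z that] c(2) by linarith
    have "energy (x b) (y b) + damping * v * x b \<le> energy (x a) (y a) + damping * v * x a"
    proof (rule decreasing_if_deriv_nonpos[where f = "\<lambda>t. energy (x t) (y t) + damping * v * x t"
          and f' = "\<lambda>t. - damping * (y t)\<^sup>2 + damping * v * y t"])
      show "a \<le> b" using a by simp
      show "continuous_on {a..b} (\<lambda>t. energy (x t) (y t) + damping * v * x t)"
        using a s by (intro continuous_intros cont_energy[OF z] traj_cont[OF z]) auto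
      fix t assume t: "a < t" "t < b"
      then have t0: "0 < t" using a s by simp
      show "((\<lambda>t. energy (x t) (y t) + damping * v * x t) has_real_derivative
        - damping * (y t)\<^sup>2 + damping * v * y t) (at t)"
        by (rule DERIV_add[OF deriv_energy[OF z t0] DERIV_cmult[OF trajD(3)[OF z t0]]])
      have "p / 2 < x t" "x t < p" using t a b by auto
      then have "potential (x t) \<le> - \<kappa> * (x t)\<^sup>2" using kp by auto
      moreover have "0 \<le> (y t)\<^sup>2 / 2 + potential (x t)" using E0[of t] t b t0 by (simp add: energy_def)
      moreover have "(p / 2)\<^sup>2 \<le> (x t)\<^sup>2" using \<open>p / 2 < x t\<close> kp by (intro power_mono) auto
      then have "\<kappa> * (p / 2)\<^sup>2 \<le> \<kappa> * (x t)\<^sup>2" using kp by (intro mult_left_mono) auto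
      ultimately have "v\<^sup>2 \<le> \<bar>y t\<bar>\<^sup>2" unfolding v(2) power2_abs by linarith
      then have "v \<le> \<bar>y t\<bar>" by (rule power2_le_imp_le) simp
      then have "v * \<bar>y t\<bar> \<le> \<bar>y t\<bar> * \<bar>y t\<bar>" by (rule mult_right_mono) simp
      moreover have "v * y t \<le> v * \<bar>y t\<bar>" using v by (intro mult_left_mono) auto
      ultimately have "v * y t \<le> (y t)\<^sup>2" by (simp add: power2_eq_square)
      then have "damping * (v * y t) \<le> damping * (y t)\<^sup>2" using damping_pos by (intro mult_left_mono) auto
      then show "- damping * (y t)\<^sup>2 + damping * v * y t \<le> 0" by (simp add: algebra_simps)
    qed
    moreover have "0 \<le> energy (x b) (y b)" using E0[of b] b s by simp
    moreover have "energy (x a) (y a) \<le> energy (x s) (y s)" using energy_antimono[OF z s(1) a(1)] .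
    moreover have "damping * v * x b = c0 + damping * v * x a" unfolding a(3) b(3) c0_def
        by (simp add: algebra_simps)
    ultimately show ?thesis by linarith
  qed
  have "c0 \<le> energy (x s1) (y s1)"
    if z: "traj x y" "x 0 \<noteq> 0 \<or> y 0 \<noteq> 0" and s: "0 \<le> s1" "s1 < s2" "x s1 = 0" "x s2 = 0" for x y s1 s2
  proof -
    obtain c where c: "s1 < c" "c < s2" "y c = 0" using rolle_velocity[OF z(1) s(1,2)] s(3,4) by metis
    have "energy (x s2) (y s2) \<le> energy (x c) (y c)" using energy_antimono[OF z(1), of c s2] c s(1) by linarith
    moreover have "0 \<le> energy (x s2) (y s2)" using s(4) by (simp add: energy_def)
    ultimately have E: "0 \<le> energy (x c) (y c)" by linarith
    have "\<not> \<bar>x c\<bar> \<le> p"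
    proof
      assume "\<bar>x c\<bar> \<le> p"
      moreover have "x c \<noteq> 0" using nontrivial[OF z, of c] c s by auto
      then have "0 < \<kappa> * (x c)\<^sup>2" using kp by simp
      ultimately show False using E c(3) kp(4)[of "x c"] by (simp add: energy_def)
    qed
    then consider "p < x c" | "p < - x c" by linarith
    then show ?thesis
    proof cases
      case 1 then show ?thesis using loss[OF z(1) s(1) c(1) s(3) _ E] by blast
    next
      case 2
      have "- x s1 = 0" "0 \<le> energy (- x c) (- y c)" using s(3) E by auto
      from loss[OF traj_minus[OF z(1)] s(1) c(1) this(1) 2 this(2)] show ?thesis
        unfolding energy_minus .
    qed
  qed
  then show ?thesis using c0 by blast
qed

section \<open>Finiteness of the number of zeroes\<close>

definition zeros :: "(real \<Rightarrow> real) \<Rightarrow> real set" where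
  "zeros x = {t. 0 < t \<and> x t = 0}"

lemma eventually_nonzero:
  assumes "traj x y" "x 0 \<noteq> 0 \<or> y 0 \<noteq> 0"
  shows "\<exists>T\<ge>0. \<forall>t\<ge>T. x t \<noteq> 0"
proof (cases "fast x y")
  case True
  then show ?thesis using fast_tail(2)[OF assms] by fastforce
next
  case False
  then obtain T where T: "0 \<le> T" "energy (x T) (y T) < 0" by (auto simp: fast_def not_le)
  then show ?thesis using negative_energy_trapped[OF assms(1) T] by fastforce
qed

lemma finite_zeros:
  assumes z: "traj x y" and pos: "0 < x 0"
  shows "finite (zeros x)"
proof (rule ccontr)
  assume inf: "infinite (zeros x)"
  obtain T where T: "T \<ge> 0" "\<And>t. t \<ge> T \<Longrightarrow> x t \<noteq> 0" using eventually_nonzero[OF z] pos by auto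
  have sub: "zeros x \<subseteq> {0..T}" using T(2) by (auto simp: zeros_def) (meson linear)
  then obtain t where t: "t \<in> {0..T}" "t islimpt zeros x"
    using inf compact_eq_Bolzano_Weierstrass[of "{0..T}"] by auto
  have "continuous_on {0..T} x" using T by (intro traj_cont[OF z]) auto
  then have "closed ({0..T} \<inter> x -` {0})" by (rule continuous_closed_preimage) auto
  moreover have "t islimpt ({0..T} \<inter> x -` {0})"
    by (rule islimpt_subset[OF t(2)]) (use sub in \<open>auto simp: zeros_def\<close>)
  ultimately have "x t = 0" using closed_limpt by blast
  then have t0: "0 < t" using t(1) pos by (cases "t = 0") auto
  have "y t \<noteq> 0" using nontrivial[OF z, of t] \<open>x t = 0\<close> pos t0 by auto
  have "eventually (\<lambda>s. x s \<noteq> 0) (at t)"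
  proof -
    have "((\<lambda>s. (x s - x t) / (s - t)) \<longlongrightarrow> y t) (at t)"
      using trajD(3)[OF z t0] by (simp add: has_field_derivative_iff)
    then have "eventually (\<lambda>s. (x s - x t) / (s - t) \<noteq> 0) (at t)"
      using \<open>y t \<noteq> 0\<close> by (rule tendsto_imp_eventually_ne)
    then show ?thesis by eventually_elim (use \<open>x t = 0\<close> in auto)
  qed
  then have "\<not> t islimpt zeros x"
    by (auto simp: islimpt_iff_eventually zeros_def elim!: eventually_mono)
  then show False using t(2) by blast
qed

end

section \<open>Orbits that do not cross\<close>

text \<open>
  Over an arc on which \<open>x1\<close> is injective, the first curve is a graph over the \<open>x\<close>-axis, and the vertical
  distance of the second curve to this graph depends continuously on time. It has no zero if the curves are
  disjoint. Only continuity is used, so the argument also works at turning points, where the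
  graph is vertical.
\<close>

lemma graph_noncrossing:
  fixes x1 y1 x2 y2 :: "real \<Rightarrow> real"
  assumes c1: "continuous_on {a..b} x1" "continuous_on {a..b} y1"
    and c2: "continuous_on {c..e} x2" "continuous_on {c..e} y2" and "c \<le> e"
    and inj: "inj_on x1 {a..b}" and range: "\<And>t. c \<le> t \<Longrightarrow> t \<le> e \<Longrightarrow> x2 t \<in> x1 ` {a..b}"
    and disj: "\<And>s t. s \<in> {a..b} \<Longrightarrow> t \<in> {c..e} \<Longrightarrow> x1 s = x2 t \<Longrightarrow> y1 s \<noteq> y2 t"
    and start: "s0 \<in> {a..b}" "x1 s0 = x2 c" "y2 c < y1 s0"
    and final: "s1 \<in> {a..b}" "x1 s1 = x2 e"
  shows "y2 e < y1 s1"
proof (rule ccontr)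
  assume n: "\<not> y2 e < y1 s1"
  define \<sigma> where "\<sigma> = the_inv_into {a..b} x1"
  have \<sigma>: "\<sigma> (x1 s) = s" if "s \<in> {a..b}" for s
    unfolding \<sigma>_def by (rule the_inv_into_f_f[OF inj that])
  have "continuous_on (x1 ` {a..b}) \<sigma>"
    by (rule continuous_on_inv[OF c1(1)]) (use \<sigma> in auto)
  then have cs: "continuous_on {c..e} (\<lambda>t. \<sigma> (x2 t))"
    by (rule continuous_on_compose2[OF _ c2(1)]) (use range in auto)
  have s_in: "\<sigma> (x2 t) \<in> {a..b}" "x1 (\<sigma> (x2 t)) = x2 t" if t: "c \<le> t" "t \<le> e" for t
    using range[OF t] \<sigma> by (auto simp: image_iff)
  have "continuous_on {c..e} (\<lambda>t. y1 (\<sigma> (x2 t)))"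
    by (rule continuous_on_compose2[OF c1(2) cs]) (use s_in in auto)
  then have "continuous_on {c..e} (\<lambda>t. y2 t - y1 (\<sigma> (x2 t)))" by (intro continuous_intros c2)
  moreover have "y2 c - y1 (\<sigma> (x2 c)) \<le> 0" using \<sigma>[OF start(1)] start by simp
  moreover have "0 \<le> y2 e - y1 (\<sigma> (x2 e))" using \<sigma>[OF final(1)] final n by simp
  ultimately obtain t where "c \<le> t" "t \<le> e" "y2 t - y1 (\<sigma> (x2 t)) = 0"
    using IVT'[of "\<lambda>t. y2 t - y1 (\<sigma> (x2 t))" c 0 e] \<open>c \<le> e\<close> by blast
  then show False using disj[of "\<sigma> (x2 t)" t] s_in[of t] by auto
qed

context emden_fowler
begin

text \<open>
  Both orbits start in the upper half-plane, the second one not to the left of the first. If the first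
  orbit, while still in the upper half-plane, arrives above or below the starting point of the second, it
  arrives below. For initial points on the axis \<open>x = 0\<close> the condition just compares the velocities; the general
  form is needed for the initial points at \<open>r = 1\<close>.
\<close>

definition outside :: "(real \<Rightarrow> real) \<Rightarrow> (real \<Rightarrow> real) \<Rightarrow> (real \<Rightarrow> real) \<Rightarrow> (real \<Rightarrow> real) \<Rightarrow> bool" where
  "outside x1 y1 x2 y2 \<longleftrightarrow> 0 < y1 0 \<and> 0 < y2 0 \<and> 0 \<le> x1 0 \<and> x1 0 \<le> x2 0 \<and>
     (\<forall>t\<ge>0. (\<forall>s. 0 \<le> s \<and> s \<le> t \<longrightarrow> 0 < y1 s) \<longrightarrow> x1 t = x2 0 \<longrightarrow> y1 t < y2 0)"

lemma traj_increasing: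
  assumes "traj x y" "0 \<le> a" "a < b" "\<And>t. a < t \<Longrightarrow> t < b \<Longrightarrow> 0 < y t"
  shows "x a < x b"
  by (rule strict_increasing_if_deriv_pos[OF assms(3) _ trajD(3)[OF assms(1)]])
     (use assms traj_cont[OF assms(1)] in auto)

lemma traj_decreasing:
  assumes "traj x y" "0 \<le> a" "a < b" "\<And>t. a < t \<Longrightarrow> t < b \<Longrightarrow> y t < 0"
  shows "x b < x a"
  by (rule strict_decreasing_if_deriv_neg[OF assms(3) _ trajD(3)[OF assms(1)]])
     (use assms traj_cont[OF assms(1)] in auto)

text \<open>
  The first orbit rises to its turning point \<open>\<xi>\<close> and then moves back, as far as \<open>x1 b\<close>. The second orbit lies
  above the rising part, so it is still moving to the right when it reaches every \<open>x < \<xi>\<close>, and must turn beyond \<open>\<xi>\<close>.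
  It cannot turn again before it has returned to \<open>\<xi>\<close>, because the force is negative there; from then on it
  lies below the descending part of the first orbit, which forces it to move on to the left until it reaches
  \<open>x1 b\<close>. Taking \<open>b\<close> to be a zero of \<open>x1\<close> gives the comparison of one half turn, and letting \<open>x1 b\<close> be small
  handles an orbit that converges to the saddle.
\<close>

lemma outer_half_turn:
  assumes z1: "traj x1 y1" and z2: "traj x2 y2" and out: "outside x1 y1 x2 y2"
    and b: "0 < b" "\<And>t. 0 < t \<Longrightarrow> t < b \<Longrightarrow> 0 < x1 t" "0 \<le> x1 b" "y1 b < 0" "0 \<le> energy (x1 b) (y1 b)"
  shows "\<exists>s>0. x2 s = x1 b \<and> y2 s < y1 b \<and> (\<forall>t. 0 < t \<and> t < s \<longrightarrow> 0 < x2 t)"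
proof -
  have y10: "0 < y1 0" and y20: "0 < y2 0" and x10: "0 \<le> x1 0" and x12: "x1 0 \<le> x2 0"
    and outD: "\<And>t. 0 \<le> t \<Longrightarrow> (\<And>s. 0 \<le> s \<Longrightarrow> s \<le> t \<Longrightarrow> 0 < y1 s) \<Longrightarrow> x1 t = x2 0 \<Longrightarrow> y1 t < y2 0"
    using out unfolding outside_def by blast+
  note cont1 = traj_cont[OF z1] and cont2 = traj_cont[OF z2]
  \<comment> \<open>Nonnegative energy means that the velocity of the first orbit vanishes only while decreasing, hence once.\<close>
  obtain c1 where c1: "0 < c1" "c1 \<le> b" "y1 c1 = 0" "\<And>t. 0 \<le> t \<Longrightarrow> t < c1 \<Longrightarrow> 0 < y1 t"
    using first_zero[of 0 b "\<lambda>t. - y1 t"] b y10 continuous_on_minus[OF cont1(2), of "{0..b}"] by auto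
  have c1b: "c1 < b" using c1 b by (cases "c1 = b") auto
  have turn: "restoring (x1 t) < 0" if "0 < t" "t < b" "y1 t = 0" for t
  proof -
    have "0 \<le> energy (x1 t) (y1 t)" using energy_antimono[OF z1, of t b] that b by simp
    then show ?thesis using restoring_neg_if_potential_nonneg[OF b(2)] that by (simp add: energy_def)
  qed
  have y1neg: "y1 t < 0" if t: "c1 < t" "t \<le> b" for t
  proof (rule negative_after_zero[of c1 t y1, OF _ c1(3) t(1)])
    show "continuous_on {c1..t} y1" using c1 by (intro cont1) auto
    fix s assume s: "c1 \<le> s" "s \<le> t" "y1 s = 0"
    then have "s \<noteq> b" using b(4) by auto
    then have "0 < s" "s < b" using s c1(1) t by linarith+
    then show "\<exists>D<0. (y1 has_real_derivative D) (at s)"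
      using turn[of s] s(3) trajD(4)[OF z1, of s] by auto
  qed
  define \<xi> where "\<xi> = x1 c1"
  have r\<xi>: "restoring \<xi> < 0" unfolding \<xi>_def using turn c1 c1b by simp
  have inc1: "x1 s < x1 t" if "0 \<le> s" "s < t" "t \<le> c1" for s t
    using that c1 by (intro traj_increasing[OF z1]) auto
  have dec1: "x1 t < x1 s" if "c1 \<le> s" "s < t" "t \<le> b" for s t
    using that c1 y1neg by (intro traj_decreasing[OF z1]) auto
  have x1\<xi>: "x1 0 < \<xi>" "x1 b < \<xi>" unfolding \<xi>_def using inc1[of 0 c1] dec1[of c1 b] c1 c1b by auto
  have inj_up: "inj_on x1 {0..c1}"
    by (rule linorder_inj_onI') (use inc1 in fastforce)
  have inj_down: "inj_on x1 {c1..b}"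
    by (rule linorder_inj_onI') (use dec1 in fastforce)
  have im_up: "\<exists>s\<in>{0..c1}. x1 s = u" if "x1 0 \<le> u" "u \<le> \<xi>" for u
    using IVT'[of x1 0 u c1] that c1 cont1(1)[of "{0..c1}"] by (auto simp: \<xi>_def)
  have im_down: "\<exists>s\<in>{c1..b}. x1 s = u" if "x1 b \<le> u" "u \<le> \<xi>" for u
    using IVT2'[of x1 b u c1] that c1 c1b cont1(1)[of "{c1..b}"] by (auto simp: \<xi>_def)
  \<comment> \<open>If the orbits met, one could be followed back from the common point to the starting point of the
    other. The condition \<open>outside\<close> rules out that the second orbit starts on the first one, and the first
    cannot start on the second one, which begins to its right and moves to the right.\<close>
  have disj: "\<not> (x1 s = x2 t \<and> y1 s = y2 t)"
    if s: "0 \<le> s" "s \<le> b" and t: "0 \<le> t"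
      and ph: "\<And>u w. 0 \<le> w \<Longrightarrow> w \<le> u \<Longrightarrow> u \<le> t \<Longrightarrow> 0 < y2 u \<Longrightarrow> 0 < y2 w" for s t
  proof
    assume eq: "x1 s = x2 t \<and> y1 s = y2 t"
    show False
    proof (cases "t \<le> s")
      case True
      have e: "x1 (s - t) = x2 0" "y1 (s - t) = y2 0"
        using traj_unique_backward[OF z1 z2 t True order_refl] eq by auto
      have "s - t < c1" using e(2) y20 y1neg[of "s - t"] c1(3) s t by (cases "s - t = c1") force+
      then have "y1 (s - t) < y2 0" using True e c1(4) by (intro outD) auto
      then show False using e by simp
    next
      case False
      have e: "x1 0 = x2 (t - s)" "y1 0 = y2 (t - s)"
        using traj_unique_backward[OF z1 z2 s(1) order_refl, of t] eq False by auto
      have "x2 0 < x2 (t - s)"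
        by (rule traj_increasing[OF z2]) (use False ph[of _ "t - s"] e y10 s in auto)
      then show False using e x12 by simp
    qed
  qed
  \<comment> \<open>The level \<open>p\<close> lies just before the turning point, where the force is already negative. Up to this level the
    velocity of the first orbit is bounded away from \<open>0\<close>, hence so is that of the second; beyond it
    the force brings the second orbit to rest in finite time.\<close>
  obtain p where p: "x1 0 < p" "x1 b < p" "p < \<xi>" "0 < p" "restoring p < 0"
  proof -
    have "isCont restoring \<xi>"
      using continuous_restoring[of UNIV "\<lambda>x. x"] by (simp add: continuous_on_eq_continuous_at)
    then have "eventually (\<lambda>x. restoring x < 0) (at \<xi>)"
      using order_tendstoD(2)[OF _ r\<xi>] by (auto simp: isCont_def)
    then obtain d where d: "d > 0" "\<And>x. x \<noteq> \<xi> \<Longrightarrow> dist x \<xi> < d \<Longrightarrow> restoring x < 0"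
      by (auto simp: eventually_at)
    define p where "p = max (\<xi> - d / 2) (max ((x1 0 + \<xi>) / 2) ((x1 b + \<xi>) / 2))"
    have "p < \<xi>" "x1 0 < p" "x1 b < p" "dist p \<xi> < d"
      using d(1) x1\<xi> by (auto simp: p_def dist_real_def max_def)
    then show ?thesis using that[of p] d(2)[of p] x10 by auto
  qed
  have up: "y1 s < y2 t" if t: "0 \<le> t" "\<And>u. 0 \<le> u \<Longrightarrow> u < t \<Longrightarrow> 0 < y2 u" "x2 t < \<xi>"
    and s: "0 \<le> s" "s \<le> c1" "x1 s = x2 t" for s t
  proof -
    have inc2: "x2 u \<le> x2 w" if "0 \<le> u" "u \<le> w" "w \<le> t" for u w
      using traj_increasing[OF z2, of u w] that t(2) by (cases "u = w") (auto simp: less_imp_le)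
    obtain s0 where s0: "s0 \<in> {0..c1}" "x1 s0 = x2 0"
      using im_up[of "x2 0"] x12 inc2[of 0 t] t by auto
    have "s0 < c1" using s0 inc2[of 0 t] t by (cases "s0 = c1") (auto simp: \<xi>_def)
    then have lt: "y1 s0 < y2 0" using s0 c1(4) by (intro outD) auto
    have "- y2 t < - y1 s"
    proof (rule graph_noncrossing[where ?x1.0 = x1 and ?y1.0 = "\<lambda>s. - y1 s" and ?x2.0 = x2 and ?y2.0 =
        "\<lambda>s. - y2 s"
          and a = 0 and b = c1 and c = 0 and e = t and ?s0.0 = s0 and ?s1.0 = s])
      show "continuous_on {0..c1} x1" "continuous_on {0..c1} (\<lambda>s. - y1 s)"
        by (intro continuous_intros cont1; simp)+
      show "continuous_on {0..t} x2" "continuous_on {0..t} (\<lambda>s. - y2 s)"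
        by (intro continuous_intros cont2; simp)+
      show "x2 u \<in> x1 ` {0..c1}" if "0 \<le> u" "u \<le> t" for u
        using im_up[of "x2 u"] inc2[of 0 u] inc2[of u t] that t x12 by force
      show "- y1 s' \<noteq> - y2 u" if "s' \<in> {0..c1}" "u \<in> {0..t}" "x1 s' = x2 u" for s' u
      proof -
        have "0 < y2 w'" if "0 \<le> w'" "w' \<le> w" "w \<le> u" "0 < y2 w" for w w'
          using that \<open>u \<in> {0..t}\<close> t(2)[of w'] by (cases "w' = w") auto
        then show ?thesis using disj[of s' u] that c1 by auto
      qed
    qed (use s0 t s lt inj_up in auto)
    then show ?thesis by simp
  qed
  have "\<exists>t\<ge>0. y2 t = 0"
  proof (rule ccontr)
    assume "\<not> (\<exists>t\<ge>0. y2 t = 0)"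
    then have pos: "0 < y2 t" if "t \<ge> 0" for t
      using no_zero_constant_sign[of 0 y2] cont2(2)[of "{0..}"] y20 that by fastforce
    show False
    proof (cases "\<exists>t0\<ge>0. p \<le> x2 t0")
      case True
      then obtain t0 where t0: "0 \<le> t0" "p \<le> x2 t0" by blast
      define t where "t = t0 + y2 t0 / (- restoring p)"
      have t: "t0 \<le> t" using pos[OF t0(1)] p(5) by (simp add: t_def divide_pos_neg less_imp_le)
      have "y2 t \<le> y2 t0 + restoring p * (t - t0)"
      proof (rule diff_le_if_deriv_le[OF t _ trajD(4)[OF z2]])
        show "continuous_on {t0..t} y2" using t0 by (intro cont2) auto
        fix u assume u: "t0 < u" "u < t"
        then show "0 < u" using t0 by simp
        have "x2 t0 < x2 u" using u t0 pos by (intro traj_increasing[OF z2]) auto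
        then have "restoring (x2 u) \<le> restoring p" using t0 p by (intro restoring_antimono_neg) auto
        moreover have "0 < damping * y2 u" using pos[of u] u t0 damping_pos by simp
        ultimately show "restoring (x2 u) - damping * y2 u \<le> restoring p" by linarith
      qed
      also have "\<dots> = 0" using p(5) by (simp add: t_def)
      finally show False using pos[of t] t t0 by simp
    next
      case False
      obtain \<sigma> where \<sigma>: "\<sigma> \<in> {0..c1}" "x1 \<sigma> = p" using im_up[of p] p by auto
      then have "\<sigma> < c1" using p by (cases "\<sigma> = c1") (auto simp: \<xi>_def)
      obtain m where m: "m \<in> {0..\<sigma>}" "\<And>s. s \<in> {0..\<sigma>} \<Longrightarrow> y1 m \<le> y1 s"
        using continuous_attains_inf[of "{0..\<sigma>}" y1] \<sigma> cont1(2)[of "{0..\<sigma>}"] by auto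
      have l: "0 < y1 m" using m(1) c1(4) \<open>\<sigma> < c1\<close> by auto
      have low: "y1 m \<le> y2 t" if "0 \<le> t" for t
      proof -
        have xt: "x2 t < p" using False that by force
        moreover have "x1 0 \<le> x2 t" using traj_increasing[OF z2, of 0 t] pos that x12 by (cases "t = 0") force+
        ultimately obtain s where s: "s \<in> {0..c1}" "x1 s = x2 t" using im_up[of "x2 t"] p by auto
        have "s \<le> \<sigma>" using inc1[of \<sigma> s] s \<sigma> xt by force
        then have "y1 m \<le> y1 s" using s by (intro m(2)) auto
        also have "\<dots> < y2 t" using up[of t s] that pos xt p s by auto
        finally show ?thesis by simp
      qed
      define t where "t = (p - x2 0) / y1 m"
      have "x2 0 < p" using False by force
      then have t: "0 \<le> t" using l by (simp add: t_def)
      have "- x2 t \<le> - x2 0 + (- y1 m) * (t - 0)"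
        by (rule diff_le_if_deriv_le[OF t continuous_on_minus[OF cont2(1)] DERIV_minus[OF trajD(3)[OF z2]]])
           (use low in auto)
      also have "\<dots> = - p" using l by (simp add: t_def)
      finally show False using False t by force
    qed
  qed
  then obtain t0 where "0 \<le> t0" "y2 t0 = 0" by blast
  then obtain c2 where c2: "0 < c2" "y2 c2 = 0" "\<And>t. 0 \<le> t \<Longrightarrow> t < c2 \<Longrightarrow> 0 < y2 t"
    using first_zero[of 0 t0 "\<lambda>t. - y2 t"] y20 continuous_on_minus[OF cont2(2), of "{0..t0}"] by auto
  have inc2: "x2 0 < x2 t" if "0 < t" "t \<le> c2" for t
    using that c2 by (intro traj_increasing[OF z2]) auto
  have above: "\<xi> < x2 c2"
  proof (rule ccontr)
    assume "\<not> \<xi> < x2 c2"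
    then consider "x2 c2 < \<xi>" | "x2 c2 = \<xi>" by linarith
    then show False
    proof cases
      case 1
      obtain s where s: "s \<in> {0..c1}" "x1 s = x2 c2" using im_up[of "x2 c2"] 1 inc2[of c2] c2 x12 by auto
      then have "y1 s < y2 c2" using up[of c2 s] c2 1 by auto
      moreover have "0 \<le> y1 s" using s c1 by (cases "s = c1") (auto simp: less_imp_le)
      ultimately show False using c2 by simp
    next
      case 2
      have "0 < y2 w" if "0 \<le> w" "w \<le> u" "u \<le> c2" "0 < y2 u" for u w
        using that c2 by (cases "w = c2") auto
      then show False using disj[of c1 c2] 2 c1 c2 c1b by (auto simp: \<xi>_def)
    qed
  qed
  have down: "y2 t < y1 s" if t: "c2 < t" "\<And>u. c2 < u \<Longrightarrow> u < t \<Longrightarrow> y2 u < 0" "y2 t \<le> 0" "x2 t \<le> \<xi>"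
    and s: "c1 \<le> s" "s \<le> b" "x1 s = x2 t" for s t
  proof -
    have ph: "0 < y2 w" if "0 \<le> w" "w \<le> u" "u \<le> t" "0 < y2 u" for u w
    proof -
      have "u < c2" using that t(2)[of u] t(3) c2(2) by (cases "u = c2"; cases "u = t"; force)
      then show ?thesis using that c2 by auto
    qed
    have dec2: "x2 w \<le> x2 u" if "c2 \<le> u" "u \<le> w" "w \<le> t" for u w
      using traj_decreasing[OF z2, of u w] that t(2) c2 by (cases "u = w") (auto simp: less_imp_le)
    obtain e where e: "c2 \<le> e" "e \<le> t" "x2 e = \<xi>"
      using IVT2'[of x2 t \<xi> c2] t above cont2(1)[of "{c2..t}"] c2 by force
    have "c2 < e" using e above by (cases "c2 = e") auto
    have ye: "y2 e < 0"
    proof (cases "e = t")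
      case True
      have "x1 c1 = x2 e" using e by (simp add: \<xi>_def)
      then have "y2 t \<noteq> 0" using disj[of c1 t] ph c1 c1b t c2 True by auto
      then show ?thesis using t True by simp
    qed (use t e \<open>c2 < e\<close> in auto)
    show ?thesis
    proof (rule graph_noncrossing[where ?x1.0 = x1 and ?y1.0 = y1 and ?x2.0 = x2 and ?y2.0 = y2
          and a = c1 and b = b and c = e and e = t and ?s0.0 = c1 and ?s1.0 = s])
      show "continuous_on {c1..b} x1" "continuous_on {c1..b} y1" using c1 by (intro cont1; simp)+
      show "continuous_on {e..t} x2" "continuous_on {e..t} y2" using e c2 by (intro cont2; simp)+
      show "x2 u \<in> x1 ` {c1..b}" if u: "e \<le> u" "u \<le> t" for u
      proof -
        have "x1 b \<le> x1 s" using dec1[of s b] s by (cases "s = b") auto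
        then show ?thesis using im_down[of "x2 u"] dec2[of e u] dec2[of u t] u s e by force
      qed
      show "y1 s' \<noteq> y2 u" if "s' \<in> {c1..b}" "u \<in> {e..t}" "x1 s' = x2 u" for s' u
        using disj[of s' u] ph that c1 e c2 by auto
    qed (use e s c1 c1b ye inj_down in \<open>auto simp: \<xi>_def\<close>)
  qed
  have y2neg: "y2 t < 0" if t: "c2 < t" "\<And>u. c2 \<le> u \<Longrightarrow> u \<le> t \<Longrightarrow> x1 b \<le> x2 u" for t
  proof (rule ccontr)
    assume n: "\<not> y2 t < 0"
    have "restoring (x2 c2) \<le> restoring \<xi>" using above p by (intro restoring_antimono_neg r\<xi>) auto
    then have "restoring (x2 c2) - damping * y2 c2 < 0" using r\<xi> c2 by simp
    then obtain d where d: "d > 0" "\<And>h. 0 < h \<Longrightarrow> h < d \<Longrightarrow> y2 (c2 + h) < y2 c2"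
      using DERIV_neg_dec_right[OF trajD(4)[OF z2 c2(1)]] by blast
    define a where "a = c2 + min (d / 2) ((t - c2) / 2)"
    have near: "y2 u < 0" if "c2 < u" "u \<le> a" for u
      using d(2)[of "u - c2"] that d(1) c2 t by (auto simp: a_def)
    have a: "c2 < a" "a < t" using d(1) t by (auto simp: a_def min_def field_simps)
    obtain c3 where c3: "a < c3" "c3 \<le> t" "y2 c3 = 0" "\<And>u. a \<le> u \<Longrightarrow> u < c3 \<Longrightarrow> y2 u < 0"
      using first_zero[of a t y2] a near[of a] n cont2(2)[of "{a..t}"] c2 by auto
    have neg: "y2 u < 0" if "c2 < u" "u < c3" for u
      using near[of u] c3(4)[of u] that by (cases "u \<le> a") auto
    have c30: "0 < c3" using c3 a c2 by simp
    have "0 \<le> restoring (x2 c3)"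
    proof (rule ccontr)
      assume "\<not> 0 \<le> restoring (x2 c3)"
      then have "restoring (x2 c3) - damping * y2 c3 < 0" using c3 by simp
      then obtain e where e: "e > 0" "\<And>h. 0 < h \<Longrightarrow> h < e \<Longrightarrow> y2 c3 < y2 (c3 - h)"
        using DERIV_neg_dec_left[OF trajD(4)[OF z2 c30]] by blast
      define h where "h = min (e / 2) ((c3 - c2) / 2)"
      have h: "0 < h" "h < e" "h < c3 - c2" using e(1) c3 a by (auto simp: h_def min_def)
      show False using e(2)[OF h(1,2)] neg[of "c3 - h"] h c3(3) by simp
    qed
    then have lt: "x2 c3 < \<xi>" using restoring_antimono_neg[of \<xi> "x2 c3"] r\<xi> p by force
    then obtain s where s: "s \<in> {c1..b}" "x1 s = x2 c3" using im_down[of "x2 c3"] t(2)[of c3] c3 a by auto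
    then have "y2 c3 < y1 s" using down[of c3 s] neg c3 a lt by auto
    moreover have "y1 s \<le> 0" using y1neg[of s] s c1 by (cases "s = c1") (auto simp: less_imp_le)
    ultimately show False using c3 by simp
  qed
  have "\<exists>s\<ge>c2. x2 s = x1 b"
  proof (rule ccontr)
    assume "\<not> (\<exists>s\<ge>c2. x2 s = x1 b)"
    then have "(\<forall>t\<ge>c2. x2 t - x1 b > 0) \<or> (\<forall>t\<ge>c2. x2 t - x1 b < 0)"
      using c2 by (intro no_zero_constant_sign continuous_intros cont2) auto
    then have gt: "x1 b < x2 t" if "c2 \<le> t" for t using above x1\<xi> that by force
    have neg: "y2 t < 0" if "c2 < t" for t using y2neg[OF that] gt by (simp add: less_imp_le)
    show False
    proof (cases "\<exists>t0\<ge>c2. x2 t0 \<le> p")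
      case True
      then obtain t0 where t0: "c2 \<le> t0" "x2 t0 \<le> p" by blast
      then have c2t0: "c2 < t0" using above p by (cases "c2 = t0") auto
      obtain \<sigma> where \<sigma>: "\<sigma> \<in> {c1..b}" "x1 \<sigma> = p" using im_down[of p] p by auto
      then have "c1 < \<sigma>" using p by (cases "\<sigma> = c1") (auto simp: \<xi>_def)
      obtain m where m: "m \<in> {\<sigma>..b}" "\<And>s. s \<in> {\<sigma>..b} \<Longrightarrow> y1 s \<le> y1 m"
        using continuous_attains_sup[of "{\<sigma>..b}" y1] \<sigma> cont1(2)[of "{\<sigma>..b}"] c1 by auto
      have l: "y1 m < 0" using m(1) y1neg \<open>c1 < \<sigma>\<close> by auto
      have high: "y2 t \<le> y1 m" if "t0 \<le> t" for t
      proof -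
        have xt: "x2 t \<le> p" using traj_decreasing[OF z2, of t0 t] neg c2t0 c2 t0 that by (cases "t = t0") force+
        have "\<exists>s\<in>{c1..b}. x1 s = x2 t" using xt p gt[of t] that t0 by (intro im_down) auto
        then obtain s where s: "s \<in> {c1..b}" "x1 s = x2 t" by blast
        have "\<sigma> \<le> s" using dec1[of s \<sigma>] s \<sigma> xt by force
        then have "y1 s \<le> y1 m" using s by (intro m(2)) auto
        moreover have "c2 < t" using c2t0 that by simp
        moreover from this have "y2 t < y1 s"
          using less_imp_le[OF neg[of t]] neg xt p s by (intro down) auto
        ultimately show ?thesis by simp
      qed
      define t where "t = t0 + (x2 t0 - x1 b) / (- y1 m)"
      have t: "t0 \<le> t" using l gt[of t0] t0 by (simp add: t_def divide_nonneg_neg)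
      have "x2 t \<le> x2 t0 + y1 m * (t - t0)"
        by (rule diff_le_if_deriv_le[OF t cont2(1) trajD(3)[OF z2]]) (use high t0 c2 in auto)
      also have "\<dots> = x1 b" using l by (simp add: t_def)
      finally show False using gt[of t] t t0 by simp
    next
      case False
      then have gtp: "p < x2 t" if "c2 \<le> t" for t using that by force
      obtain M where M: "M > 0" "\<And>t. 0 \<le> t \<Longrightarrow> \<bar>x2 t\<bar> \<le> M" "\<And>t. 0 \<le> t \<Longrightarrow> \<bar>y2 t\<bar> \<le> M"
        using traj_bound[OF z2] by metis
      define v where "v = (\<lambda>t. y2 t + damping * x2 t)"
      have bd: "\<bar>v t\<bar> \<le> M + damping * M" if "0 \<le> t" for t
      proof -
        have "\<bar>damping * x2 t\<bar> \<le> damping * M" using M(2)[OF that] damping_pos by (simp add: abs_mult)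
        then show ?thesis using M(3)[OF that] by (simp add: v_def)
      qed
      define t where "t = c2 + (2 * (M + damping * M) + 1) / (- restoring p)"
      have t: "c2 \<le> t" using p M damping_pos
        by (simp add: t_def) (intro divide_nonneg_neg add_nonneg_nonneg mult_nonneg_nonneg; simp)
      have "v t \<le> v c2 + restoring p * (t - c2)"
      proof (rule diff_le_if_deriv_le[OF t])
        show "continuous_on {c2..t} v" unfolding v_def using c2 by (intro continuous_intros cont2) auto
        fix u assume u: "c2 < u" "u < t"
        then have u0: "0 < u" using c2 by simp
        show "(v has_real_derivative restoring (x2 u)) (at u)" unfolding v_def
          by (rule DERIV_cong[OF DERIV_add[OF trajD(4)[OF z2 u0] DERIV_cmult[OF trajD(3)[OF z2 u0]]]]) simp
        show "restoring (x2 u) \<le> restoring p" using gtp[of u] u p by (intro restoring_antimono_neg) auto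
      qed
      also have "restoring p * (t - c2) = - (2 * (M + damping * M) + 1)" using p(5) by (simp add: t_def)
      finally show False using bd[of t] bd[of c2] t c2 by (simp add: abs_le_iff)
    qed
  qed
  then obtain s' where s': "c2 \<le> s'" "x2 s' = x1 b" by blast
  have "continuous_on {c2..s'} (\<lambda>t. x1 b - x2 t)" using c2 by (intro continuous_intros cont2) auto
  moreover have "x1 b - x2 c2 < 0" "0 \<le> x1 b - x2 s'" using s' above x1\<xi> by auto
  ultimately obtain s where s0: "c2 < s" "x1 b - x2 s = 0" "\<And>t. c2 \<le> t \<Longrightarrow> t < s \<Longrightarrow> x1 b - x2 t < 0"
    using first_zero[OF s'(1)] by metis
  have s: "c2 < s" "x2 s = x1 b" "\<And>t. c2 \<le> t \<Longrightarrow> t < s \<Longrightarrow> x1 b < x2 t"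
    using s0(1,2) s0(3) by force+
  have neg: "y2 t < 0" if "c2 < t" "t \<le> s" for t
  proof (rule y2neg[OF that(1)])
    fix u assume "c2 \<le> u" "u \<le> t"
    then show "x1 b \<le> x2 u" using s(2) s(3)[of u] that by (cases "u = s") auto
  qed
  have "y2 s < y1 b"
  proof (rule down[OF s(1)])
    show "y2 u < 0" if "c2 < u" "u < s" for u using neg that by simp
    show "y2 s \<le> 0" using neg[OF s(1)] by simp
    show "x2 s \<le> \<xi>" "x1 b = x2 s" using s(2) x1\<xi>(2) by simp_all
  qed (use c1b in simp_all)
  moreover have "0 < x2 t" if "0 < t" "t < s" for t
  proof (cases "t \<le> c2")
    case True
    then show ?thesis using inc2[OF that(1)] x10 x12 by linarith
  next
    case False
    then show ?thesis using s(3)[OF _ that(2)] b(3) by linarith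
  qed
  moreover have "0 < s" using s(1) c2(1) by simp
  ultimately show ?thesis using s(2) by blast
qed

end

text \<open>
  The function \<open>\<sigma>\<close> tells when the first curve has the abscissa that the second has at time \<open>t\<close>. Comparing velocities at
  matched times is the same as comparing the graphs of the two orbits over the \<open>x\<close>-axis.
\<close>

lemma matched_time:
  fixes x1 y1 x2 y2 :: "real \<Rightarrow> real"
  assumes c1: "continuous_on {a..b} x1" and d1: "\<And>s. a < s \<Longrightarrow> s < b \<Longrightarrow> (x1 has_real_derivative y1 s) (at s)"
    and pos: "\<And>s. a < s \<Longrightarrow> s < b \<Longrightarrow> 0 < y1 s" and "a \<le> b"
    and c2: "continuous_on {c..e} x2" and d2: "\<And>t. c < t \<Longrightarrow> t < e \<Longrightarrow> (x2 has_real_derivative y2 t) (at t)"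
    and range: "\<And>t. c \<le> t \<Longrightarrow> t \<le> e \<Longrightarrow> x1 a \<le> x2 t \<and> x2 t \<le> x1 b"
    and inner: "\<And>t. c < t \<Longrightarrow> t < e \<Longrightarrow> x1 a < x2 t \<and> x2 t < x1 b"
  obtains \<sigma> where "continuous_on {c..e} \<sigma>"
    "\<And>t. c \<le> t \<Longrightarrow> t \<le> e \<Longrightarrow> a \<le> \<sigma> t \<and> \<sigma> t \<le> b \<and> x1 (\<sigma> t) = x2 t"
    "\<And>t. c < t \<Longrightarrow> t < e \<Longrightarrow> a < \<sigma> t \<and> \<sigma> t < b \<and> (\<sigma> has_real_derivative y2 t / y1 (\<sigma> t)) (at t)"
proof -
  have inc: "x1 s < x1 t" if "a \<le> s" "s < t" "t \<le> b" for s t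
    by (rule strict_increasing_if_deriv_pos[OF that(2) continuous_on_subset[OF c1] d1])
       (use that pos in auto)
  have inj: "inj_on x1 {a..b}" by (rule linorder_inj_onI') (use inc in fastforce)
  define g where "g = the_inv_into {a..b} x1"
  have g: "g (x1 s) = s" if "s \<in> {a..b}" for s
    unfolding g_def by (rule the_inv_into_f_f[OF inj that])
  have im: "\<exists>s\<in>{a..b}. x1 s = u" if "x1 a \<le> u" "u \<le> x1 b" for u
    using IVT'[of x1 a u b] that c1 \<open>a \<le> b\<close> by auto
  have gg: "g u \<in> {a..b}" "x1 (g u) = u" if "x1 a \<le> u" "u \<le> x1 b" for u
    using im[OF that] g by auto
  have "continuous_on (x1 ` {a..b}) g"
    by (rule continuous_on_inv[OF c1]) (use g in auto)
  then have cg: "continuous_on {x1 a..x1 b} g"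
    by (rule continuous_on_subset) (use im in fastforce)
  define \<sigma> where "\<sigma> = (\<lambda>t. g (x2 t))"
  show ?thesis
  proof
    show "continuous_on {c..e} \<sigma>" unfolding \<sigma>_def
      by (rule continuous_on_compose2[OF cg c2]) (use range in auto)
    show "a \<le> \<sigma> t \<and> \<sigma> t \<le> b \<and> x1 (\<sigma> t) = x2 t" if "c \<le> t" "t \<le> e" for t
      unfolding \<sigma>_def using gg[of "x2 t"] range[OF that] by auto
    show "a < \<sigma> t \<and> \<sigma> t < b \<and> (\<sigma> has_real_derivative y2 t / y1 (\<sigma> t)) (at t)" if t: "c < t" "t < e" for t
    proof -
      have x: "x1 a < x2 t" "x2 t < x1 b" using inner[OF t] by auto
      have s: "\<sigma> t \<in> {a..b}" "x1 (\<sigma> t) = x2 t" unfolding \<sigma>_def using gg[of "x2 t"] x by auto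
      have s': "a < \<sigma> t" "\<sigma> t < b" using s x by (cases "\<sigma> t = a"; cases "\<sigma> t = b"; auto)+
      have "isCont g (x2 t)"
        by (rule continuous_on_interior[OF cg]) (use x in \<open>auto simp: interior_atLeastAtMost_real\<close>)
      then have "DERIV g (x2 t) :> inverse (y1 (g (x2 t)))"
        using DERIV_inverse_function[where f = x1 and g = g and x = "x2 t" and D = "y1 (g (x2 t))" and a =
            "x1 a" and b = "x1 b"] d1[OF s'] pos[OF s'] x gg
        by (auto simp: \<sigma>_def)
      from DERIV_chain2[OF this d2[OF t]] show ?thesis
        using s' by (simp add: \<sigma>_def divide_inverse mult.commute)
    qed
  qed
qed

text \<open>
  With the integrating factor \<open>e\<^bsup>-A\<^esup>\<close>, \<open>A' = a\<close>, the function \<open>D\<close> becomes strictly increasing.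
\<close>

lemma linear_ode_positive:
  fixes D a p :: "real \<Rightarrow> real"
  assumes "c < e" "continuous_on {c..e} D" "continuous_on {c..e} a"
    and d: "\<And>t. c < t \<Longrightarrow> t < e \<Longrightarrow> (D has_real_derivative a t * D t + p t) (at t)"
    and p: "\<And>t. c < t \<Longrightarrow> t < e \<Longrightarrow> 0 < p t" and "0 \<le> D c"
  shows "0 < D e"
proof -
  define A where "A = (\<lambda>t. integral {c..t} a)"
  have dA: "(A has_real_derivative a t) (at t within {c..e})" if "t \<in> {c..e}" for t
    unfolding A_def by (rule integral_has_real_derivative[OF assms(3) that])
  have cA: "continuous_on {c..e} A"
    unfolding continuous_on_eq_continuous_within using dA DERIV_continuous by blast
  have "exp (- A c) * D c < exp (- A e) * D e"
  proof (rule strict_increasing_if_deriv_pos[OF assms(1), where f' = "\<lambda>t. exp (- A t) * p t"])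
    show "continuous_on {c..e} (\<lambda>t. exp (- A t) * D t)" by (intro continuous_intros cA assms)
    fix t assume t: "c < t" "t < e"
    have "(A has_real_derivative a t) (at t)"
      using dA[of t] t by (simp add: at_within_interior[of t "{c..e}"])
    then have "((\<lambda>t. exp (- A t)) has_real_derivative exp (- A t) * (- a t)) (at t)"
      by (auto intro!: derivative_eq_intros)
    from DERIV_mult[OF this d[OF t]]
    show "((\<lambda>t. exp (- A t) * D t) has_real_derivative exp (- A t) * p t) (at t)"
      by (simp add: algebra_simps)
    show "0 < exp (- A t) * p t" using p[OF t] by simp
  qed
  moreover have "0 \<le> exp (- A c) * D c" using assms by simp
  ultimately have "0 < exp (- A e) * D e" by linarith
  then show ?thesis by (simp add: zero_less_mult_iff)
qed

context emden_fowler
begin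

text \<open>
  The curve \<open>(X, Y)\<close> solves the system with an additional upward force \<open>p\<close>. Its height \<open>D\<close> above the graph of the
  first orbit satisfies \<open>D' = a D + p\<close> with \<open>a = -restoring(X)/y1\<close>, so it is positive right after the
  common starting point and remains positive. In the application \<open>p = (K\<^sub>2 - K\<^sub>1) f(X)\<close>: the curve is then an orbit
  of the system with coefficient \<open>K\<^sub>1\<close>.
\<close>

lemma outside_by_forcing:
  assumes z1: "traj x1 y1" and z2: "traj x2 y2" and ce: "c < e"
    and cX: "continuous_on {c..e} X" and cY: "continuous_on {c..e} Y"
    and dX: "\<And>t. c < t \<Longrightarrow> t < e \<Longrightarrow> (X has_real_derivative Y t) (at t)"
    and dY: "\<And>t. c < t \<Longrightarrow> t < e \<Longrightarrow> (Y has_real_derivative restoring (X t) - damping * Y t + p t) (at t)"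
    and p: "\<And>t. c < t \<Longrightarrow> t < e \<Longrightarrow> 0 < p t" and Y: "\<And>t. c \<le> t \<Longrightarrow> t \<le> e \<Longrightarrow> 0 < Y t"
    and init: "X c = x1 0" "Y c = y1 0" "0 \<le> x1 0" and final: "x2 0 = X e" "y2 0 = Y e"
  shows "outside x1 y1 x2 y2"
proof -
  have incX: "X s < X t" if "c \<le> s" "s < t" "t \<le> e" for s t
    by (rule strict_increasing_if_deriv_pos[OF that(2) continuous_on_subset[OF cX] dX])
       (use that Y in auto)
  have "y1 t < y2 0" if t: "0 \<le> t" and pos: "\<forall>s. 0 \<le> s \<and> s \<le> t \<longrightarrow> 0 < y1 s" and eq: "x1 t = x2 0" for t
  proof -
    have lt: "x1 0 < x1 t" using incX[of c e] ce init final eq by simp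
    then have t0: "0 < t" using t by (cases "t = 0") auto
    have range: "x1 0 \<le> X s \<and> X s \<le> x1 t" if "c \<le> s" "s \<le> e" for s
      using incX[of c s] incX[of s e] that init final eq by (cases "s = c"; cases "s = e") auto
    have inner: "x1 0 < X s \<and> X s < x1 t" if "c < s" "s < e" for s
      using incX[of c s] incX[of s e] that init final eq by auto
    obtain \<sigma> where \<sigma>: "continuous_on {c..e} \<sigma>"
      "\<And>s. c \<le> s \<Longrightarrow> s \<le> e \<Longrightarrow> 0 \<le> \<sigma> s \<and> \<sigma> s \<le> t \<and> x1 (\<sigma> s) = X s"
      "\<And>s. c < s \<Longrightarrow> s < e \<Longrightarrow> 0 < \<sigma> s \<and> \<sigma> s < t \<and> (\<sigma> has_real_derivative Y s / y1 (\<sigma> s)) (at s)"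
      by (rule matched_time[of 0 t x1 y1 c e X Y])
         (use t pos range inner trajD(3)[OF z1] traj_cont[OF z1] cX dX in auto)
    have y1\<sigma>: "0 < y1 (\<sigma> s)" if "c \<le> s" "s \<le> e" for s using \<sigma>(2)[OF that] pos by auto
    have inc1: "x1 s < x1 w" if "0 \<le> s" "s < w" "w \<le> t" for s w
      using that pos by (intro traj_increasing[OF z1]) auto
    have \<sigma>c: "\<sigma> c = 0" using \<sigma>(2)[of c] ce init(1) inc1[of 0 "\<sigma> c"] by force
    have \<sigma>e: "\<sigma> e = t" using \<sigma>(2)[of e] ce final(1) eq inc1[of "\<sigma> e" t] by force
    have cy: "continuous_on {c..e} (\<lambda>s. y1 (\<sigma> s))"
      by (rule continuous_on_compose2[OF trajD(2)[OF z1] \<sigma>(1)]) (use \<sigma>(2) in auto)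
    define D where "D = (\<lambda>s. Y s - y1 (\<sigma> s))"
    have "0 < D e"
    proof (rule linear_ode_positive[OF ce, where a = "\<lambda>s. - restoring (X s) / y1 (\<sigma> s)" and p = p])
      show "continuous_on {c..e} D" unfolding D_def by (intro continuous_intros cY cy)
      show "continuous_on {c..e} (\<lambda>s. - restoring (X s) / y1 (\<sigma> s))"
        by (intro continuous_intros cX cy) (use y1\<sigma> in force)
      fix s assume s: "c < s" "s < e"
      have y: "0 < y1 (\<sigma> s)" using y1\<sigma> s by simp
      have s': "0 < \<sigma> s" "x1 (\<sigma> s) = X s" using \<sigma>(2,3)[of s] s by auto
      have ds: "(\<sigma> has_real_derivative Y s / y1 (\<sigma> s)) (at s)" using \<sigma>(3)[OF s] by blast
      have dD: "(D has_real_derivative restoring (X s) - damping * Y s + p s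
         - (restoring (x1 (\<sigma> s)) - damping * y1 (\<sigma> s)) * (Y s / y1 (\<sigma> s))) (at s)"
        unfolding D_def by (rule DERIV_diff[OF dY[OF s] DERIV_chain2[OF trajD(4)[OF z1 s'(1)] ds]])
      show "(D has_real_derivative - restoring (X s) / y1 (\<sigma> s) * D s + p s) (at s)"
        by (rule DERIV_cong[OF dD]) (use y s' in \<open>simp add: D_def field_simps\<close>)
    qed (use p D_def \<sigma>c init in auto)
    then show ?thesis using \<sigma>e final by (simp add: D_def)
  qed
  then show ?thesis unfolding outside_def
    using Y[of c] Y[of e] ce init final incX[of c e] by auto
qed

text \<open>
  Near the saddle the height \<open>D\<close> of the second orbit above the first satisfies \<open>D' = a D\<close> with
  \<open>a = -restoring(x2)/y1 \<ge> 0\<close>, so \<open>|D|\<close> does not decrease. A second orbit below the first one hence keeps a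
  velocity below a negative constant and reaches \<open>x = 0\<close> in finite time, instead of converging to the saddle.
\<close>

lemma fast_orbit_unique:
  assumes z1: "traj x1 y1" and z2: "traj x2 y2" and q4: "\<And>t. 0 \<le> t \<Longrightarrow> 0 < x1 t \<and> y1 t < 0"
    and lim: "(x1 \<longlongrightarrow> 0) at_top" and start: "x2 0 = x1 0" "y2 0 < y1 0" and res: "0 \<le> restoring (x1 0)"
  shows "\<exists>s>0. x2 s = 0"
proof (rule ccontr)
  assume n: "\<not> (\<exists>s>0. x2 s = 0)"
  have x20: "0 < x2 0" using start q4 by simp
  have "x2 t \<noteq> 0" if "0 \<le> t" for t using n x20 that by (cases "t = 0") auto
  then have pos: "0 < x2 t" if "0 \<le> t" for t
    using no_zero_constant_sign[of 0 x2] trajD(1)[OF z2] x20 that by fastforce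
  define k where "k = y1 0 - y2 0"
  have k: "k > 0" using start by (simp add: k_def)
  have fastdown: "y2 t < - k / 2" if t0: "0 \<le> t" for t
  proof (rule ccontr)
    assume nn: "\<not> y2 t < - k / 2"
    have "y2 0 + k / 2 < 0" using start(2) q4[of 0] unfolding k_def by (simp add: field_simps)
    moreover have "continuous_on {0..t} (\<lambda>t. y2 t + k / 2)" by (intro continuous_intros traj_cont[OF z2]) auto
    moreover have "0 \<le> y2 t + k / 2" using nn by linarith
    ultimately obtain e where e: "0 < e" "e \<le> t" "y2 e + k / 2 = 0" "\<And>s. 0 \<le> s \<Longrightarrow> s < e \<Longrightarrow> y2 s + k / 2 < 0"
      using first_zero[OF t0] by blast
    have neg: "y2 s < 0" if "0 \<le> s" "s < e" for s using e(4)[OF that] k by linarith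
    have dec2: "x2 w < x2 s" if "0 \<le> s" "s < w" "w \<le> e" for s w
      using that neg by (intro traj_decreasing[OF z2]) auto
    have "eventually (\<lambda>s. x1 s < x2 e) at_top" using order_tendstoD(2)[OF lim pos] e by simp
    then obtain b0 where b0: "\<And>s. b0 \<le> s \<Longrightarrow> x1 s < x2 e" by (auto simp: eventually_at_top_linorder)
    define b where "b = max b0 1"
    have b: "0 < b" "x1 b < x2 e" using b0[of b] by (auto simp: b_def)
    have range: "- x1 0 \<le> - x2 s \<and> - x2 s \<le> - x1 b" if "0 \<le> s" "s \<le> e" for s
      using dec2[of 0 s] dec2[of s e] that start b by (cases "s = 0"; cases "s = e"; auto)
    have inner: "- x1 0 < - x2 s \<and> - x2 s < - x1 b" if "0 < s" "s < e" for s
      using dec2[of 0 s] dec2[of s e] that start b by auto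
    \<comment> \<open>Reflected orbits, as the matching of times is set up for increasing abscissae.\<close>
    obtain \<sigma> where \<sigma>: "continuous_on {0..e} \<sigma>"
      "\<And>s. 0 \<le> s \<Longrightarrow> s \<le> e \<Longrightarrow> 0 \<le> \<sigma> s \<and> \<sigma> s \<le> b \<and> - x1 (\<sigma> s) = - x2 s"
      "\<And>s. 0 < s \<Longrightarrow> s < e \<Longrightarrow> 0 < \<sigma> s \<and> \<sigma> s < b \<and> (\<sigma> has_real_derivative (- y2 s) / (- y1 (\<sigma> s))) (at s)"
      by (rule matched_time[of 0 b "\<lambda>t. - x1 t" "\<lambda>t. - y1 t" 0 e "\<lambda>t. - x2 t" "\<lambda>t. - y2 t"])
         (use b q4 range inner trajD(3)[OF traj_minus[OF z1]] trajD(3)[OF traj_minus[OF z2]]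
           traj_cont(1)[OF traj_minus[OF z1]] traj_cont(1)[OF traj_minus[OF z2]] in auto)
    have "x1 (\<sigma> 0) = x1 0" using \<sigma>(2)[of 0] e start by simp
    moreover have "x1 (\<sigma> 0) < x1 0" if "0 < \<sigma> 0" using that q4 by (intro traj_decreasing[OF z1]) auto
    ultimately have \<sigma>0: "\<sigma> 0 = 0" using \<sigma>(2)[of 0] e by force
    define D where "D = (\<lambda>s. y2 s - y1 (\<sigma> s))"
    have cD: "continuous_on {0..e} D" unfolding D_def
      by (intro continuous_intros traj_cont[OF z2] continuous_on_compose2[OF trajD(2)[OF z1] \<sigma>(1)]) (use \<sigma>(2) in auto)
    have D0: "D 0 = - k" by (simp add: D_def \<sigma>0 k_def)
    have grow: "k\<^sup>2 \<le> (D w)\<^sup>2" if w: "0 \<le> w" "w \<le> e" for w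
    proof -
      have "(D 0)\<^sup>2 \<le> (D w)\<^sup>2"
      proof (rule increasing_if_deriv_nonneg[OF w(1), where f' =
          "\<lambda>s. 2 * (- restoring (x2 s) / y1 (\<sigma> s)) * (D s)\<^sup>2"])
        show "continuous_on {0..w} (\<lambda>s. (D s)\<^sup>2)"
          by (intro continuous_intros continuous_on_subset[OF cD]) (use w in auto)
        fix s assume "0 < s" "s < w"
        then have s: "0 < s" "s < e" using w by auto
        have s': "0 < \<sigma> s" "x1 (\<sigma> s) = x2 s" using \<sigma>(2,3)[of s] s by auto
        have y: "y1 (\<sigma> s) < 0" using q4 s' by simp
        have ds: "(\<sigma> has_real_derivative y2 s / y1 (\<sigma> s)) (at s)" using \<sigma>(3)[OF s] by simp
        have dD: "(D has_real_derivative restoring (x2 s) - damping * y2 s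
           - (restoring (x1 (\<sigma> s)) - damping * y1 (\<sigma> s)) * (y2 s / y1 (\<sigma> s))) (at s)"
          unfolding D_def by (rule DERIV_diff[OF trajD(4)[OF z2 s(1)] DERIV_chain2[OF trajD(4)[OF z1 s'(1)] ds]])
        have "(D has_real_derivative - restoring (x2 s) / y1 (\<sigma> s) * D s) (at s)"
          by (rule DERIV_cong[OF dD]) (use y s' in \<open>simp add: D_def field_simps\<close>)
        from DERIV_power[OF this, of 2]
        show "((\<lambda>s. (D s)\<^sup>2) has_real_derivative 2 * (- restoring (x2 s) / y1 (\<sigma> s)) * (D s)\<^sup>2) (at s)"
          by (simp add: power2_eq_square algebra_simps)
        have "x2 s < x1 0" using dec2[of 0 s] s start by simp
        then have "0 < restoring (x2 s)" using restoring_pos_below[of "x2 s" "x1 0"] pos[of s] s res by simp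
        then have "0 \<le> - restoring (x2 s) / y1 (\<sigma> s)" using y by (intro divide_nonpos_neg) auto
        then show "0 \<le> 2 * (- restoring (x2 s) / y1 (\<sigma> s)) * (D s)\<^sup>2"
          by (intro mult_nonneg_nonneg) auto
      qed
      then show ?thesis by (simp add: D0)
    qed
    have "D e < 0"
    proof (rule ccontr)
      assume "\<not> D e < 0"
      then obtain w where "0 \<le> w" "w \<le> e" "D w = 0" using IVT'[of D 0 0 e] D0 k cD e by auto
      then show False using grow[of w] k by simp
    qed
    have "k\<^sup>2 \<le> (- D e)\<^sup>2" using grow[of e] e by simp
    then have "k \<le> - D e" by (rule power2_le_imp_le) (use \<open>D e < 0\<close> in simp)
    then have "y2 e < - k" using q4[of "\<sigma> e"] \<sigma>(2)[of e] e by (simp add: D_def)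
    then show False using e(3) k by linarith
  qed
  define t where "t = x2 0 / (k / 2)"
  have t: "0 \<le> t" using x20 k by (simp add: t_def)
  have "x2 t \<le> x2 0 + (- k / 2) * (t - 0)"
    by (rule diff_le_if_deriv_le[OF t traj_cont(1)[OF z2] trajD(3)[OF z2]]) (use fastdown less_imp_le in auto)
  also have "\<dots> = 0" using k by (simp add: t_def)
  finally show False using pos[OF t] by simp
qed

lemma pos_before_zero:
  assumes z: "traj x y" and "0 < y 0" "0 \<le> x 0" and nz: "\<And>t. 0 < t \<Longrightarrow> t < b \<Longrightarrow> x t \<noteq> 0"
    and t: "0 < t" "t < b"
  shows "0 < x t"
proof (rule ccontr)
  assume "\<not> 0 < x t"
  then have xt: "x t < 0" using nz[OF t] by auto
  have "((\<lambda>t. y t) \<longlongrightarrow> y 0) (at 0 within {0..})"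
    using trajD(2)[OF z] by (simp add: continuous_on_def)
  then have "eventually (\<lambda>t. 0 < y t) (at 0 within {0..})" using order_tendstoD(1) assms(2) by blast
  then obtain d where d: "d > 0" "\<And>s. 0 \<le> s \<Longrightarrow> s < d \<Longrightarrow> s \<noteq> 0 \<Longrightarrow> 0 < y s"
    by (auto simp: eventually_at dist_real_def)
  define a where "a = min (d / 2) (t / 2)"
  have a: "0 < a" "a < d" "a < t" using d t by (auto simp: a_def min_def)
  have "x 0 < x a" using a d by (intro traj_increasing[OF z]) auto
  then have "0 < x a" using assms by simp
  then obtain s where "a \<le> s" "s \<le> t" "x s = 0"
    using IVT2'[of x t 0 a] xt a traj_cont(1)[OF z, of "{a..t}"] by auto
  then show False using nz[of s] a t by auto
qed

text \<open>
  The reflected remainder of the orbit starts at \<open>x = 0\<close> with positive velocity, which makes an induction on the number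
  of zeroes possible.
\<close>

lemma zeros_step:
  assumes "0 < s" "x s = 0" "\<And>t. 0 < t \<Longrightarrow> t < s \<Longrightarrow> x t \<noteq> 0"
  shows "zeros x = insert s ((+) s ` zeros (\<lambda>t. - x (s + t)))"
proof (rule set_eqI)
  fix t
  show "t \<in> zeros x \<longleftrightarrow> t \<in> insert s ((+) s ` zeros (\<lambda>t. - x (s + t)))"
  proof (cases "s < t")
    case True
    then have "t \<in> (+) s ` zeros (\<lambda>t. - x (s + t)) \<longleftrightarrow> t - s \<in> zeros (\<lambda>t. - x (s + t))"
      by (auto simp: image_iff intro: bexI[of _ "t - s"])
    then show ?thesis using True assms by (auto simp: zeros_def)
  next
    case False
    then show ?thesis using assms by (cases "t = s") (auto simp: zeros_def)
  qed
qed

lemma zeros_step_card: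
  assumes "0 < s" "x s = 0" "\<And>t. 0 < t \<Longrightarrow> t < s \<Longrightarrow> x t \<noteq> 0" "finite (zeros x)"
  shows "finite (zeros (\<lambda>t. - x (s + t)))" "card (zeros x) = Suc (card (zeros (\<lambda>t. - x (s + t))))"
proof -
  note eq = zeros_step[of s x, OF assms(1-3)]
  have inj: "inj_on ((+) s) A" for A by (auto intro: inj_onI)
  have "finite ((+) s ` zeros (\<lambda>t. - x (s + t)))" using assms(4) by (simp only: eq finite_insert)
  then show fin: "finite (zeros (\<lambda>t. - x (s + t)))" using finite_imageD[OF _ inj] by blast
  have "s \<notin> (+) s ` zeros (\<lambda>t. - x (s + t))" by (auto simp: zeros_def)
  then show "card (zeros x) = Suc (card (zeros (\<lambda>t. - x (s + t))))"
    using fin arg_cong[OF eq, of card] by (simp add: card_image[OF inj])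
qed

lemma restoring_pos_near_0: "\<exists>\<delta>>0. \<forall>x. 0 < x \<and> x < \<delta> \<longrightarrow> 0 < restoring x"
proof -
  define \<delta> where "\<delta> = (alpha * lam / K) powr (1 / (q - 2))"
  have d: "\<delta> > 0" "\<delta> powr (q - 2) = alpha * lam / K"
    using B_pos K_pos q_gt_2 by (auto simp: \<delta>_def powr_powr)
  then have "restoring \<delta> = 0" using K_pos by (simp add: restoring_eq)
  then show ?thesis using d(1) restoring_pos_below[of _ \<delta>] by auto
qed

text \<open>
  By induction on the number of zeroes of the first orbit. As long as it has one, \<open>outer_half_turn\<close> provides
  a zero of the second orbit with a larger velocity, and the reflected remainders of both orbits are again in the
  relation \<open>outside\<close>. When it has none and converges to the saddle, \<open>outer_half_turn\<close> brings the second
  orbit below it in the region where \<open>fast_orbit_unique\<close> applies, and this yields one more zero.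
\<close>

lemma zero_count_outside:
  assumes "traj x1 y1" "traj x2 y2" "outside x1 y1 x2 y2" "finite (zeros x1)" "finite (zeros x2)"
  shows "card (zeros x1) \<le> card (zeros x2) \<and> (fast x1 y1 \<longrightarrow> card (zeros x1) < card (zeros x2))"
  using assms
proof (induction "card (zeros x1)" arbitrary: x1 y1 x2 y2)
  case 0
  note z1 = 0(2) and z2 = 0(3) and out = 0(4)
  have init: "0 < y1 0" "0 \<le> x1 0" using out by (auto simp: outside_def)
  have "zeros x1 = {}" using 0 by simp
  then have "x1 t \<noteq> 0" if "0 < t" for t using that by (auto simp: zeros_def)
  then have pos: "0 < x1 t" if "0 < t" for t
    using pos_before_zero[OF z1 init, of "t + 1" t] that by auto
  have "zeros x2 \<noteq> {}" if f: "fast x1 y1"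
  proof -
    have nt: "x1 0 \<noteq> 0 \<or> y1 0 \<noteq> 0" using init by simp
    obtain T where T: "T \<ge> 0" "(\<forall>t\<ge>T. 0 < x1 t \<and> y1 t < 0) \<or> (\<forall>t\<ge>T. x1 t < 0 \<and> 0 < y1 t)"
      using fast_tail(2)[OF z1 nt f] by blast
    have T': "0 < x1 t \<and> y1 t < 0" if "t \<ge> T + 1" for t
    proof -
      have "\<not> x1 t < 0" "t \<ge> T" using pos[of t] that T(1) by auto
      then show ?thesis using T(2) by blast
    qed
    note lim = fast_tail(1)[OF z1 nt f]
    obtain \<delta> where \<delta>: "\<delta> > 0" "\<And>x. 0 < x \<Longrightarrow> x < \<delta> \<Longrightarrow> 0 < restoring x" using restoring_pos_near_0 by blast
    have "eventually (\<lambda>t. x1 t < \<delta>) at_top" using order_tendstoD(2)[OF lim \<delta>(1)] .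
    then obtain S where S: "\<And>t. t \<ge> S \<Longrightarrow> x1 t < \<delta>" by (auto simp: eventually_at_top_linorder)
    define b where "b = max (T + 1) S"
    have b: "0 < b" "T + 1 \<le> b" "x1 b < \<delta>" using S[of b] T by (auto simp: b_def)
    have "\<exists>s>0. x2 s = x1 b \<and> y2 s < y1 b \<and> (\<forall>t. 0 < t \<and> t < s \<longrightarrow> 0 < x2 t)"
      using b pos T'[of b] f by (intro outer_half_turn[OF z1 z2 out b(1)]) (auto simp: fast_def less_imp_le)
    then obtain s where s: "s > 0" "x2 s = x1 b" "y2 s < y1 b" by blast
    have "\<exists>u>0. x2 (s + u) = 0"
    proof (rule fast_orbit_unique[where ?x2.0 = "\<lambda>t. x2 (s + t)" and ?y2.0 = "\<lambda>t. y2 (s + t)"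
          and ?x1.0 = "\<lambda>t. x1 (b + t)" and ?y1.0 = "\<lambda>t. y1 (b + t)"])
      show "traj (\<lambda>t. x1 (b + t)) (\<lambda>t. y1 (b + t))" "traj (\<lambda>t. x2 (s + t)) (\<lambda>t. y2 (s + t))"
        using traj_shift[OF z1] traj_shift[OF z2] b s by auto
      show "0 < x1 (b + t) \<and> y1 (b + t) < 0" if "0 \<le> t" for t using T'[of "b + t"] b that by simp
      show "((\<lambda>t. x1 (b + t)) \<longlongrightarrow> 0) at_top"
        by (rule filterlim_compose[OF lim filterlim_tendsto_add_at_top[OF tendsto_const filterlim_ident]])
      show "0 \<le> restoring (x1 (b + 0))" using \<delta>(2)[of "x1 b"] b T'[of b] by (simp add: less_imp_le)
    qed (use s in auto)
    then obtain u where "u > 0" "x2 (s + u) = 0" by blast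
    then have "s + u \<in> zeros x2" using s by (simp add: zeros_def)
    then show ?thesis by blast
  qed
  then show ?case using 0 by (auto simp: card_gt_0_iff)
next
  case (Suc k)
  note z1 = Suc(3) and z2 = Suc(4) and out = Suc(5) and fin = Suc(6,7)
  have init: "0 < y1 0" "0 \<le> x1 0" using out by (auto simp: outside_def)
  have ne: "zeros x1 \<noteq> {}" using Suc(2) by force
  define t1 where "t1 = Min (zeros x1)"
  have "t1 \<in> zeros x1" unfolding t1_def using fin ne by simp
  then have t1: "0 < t1" "x1 t1 = 0" by (auto simp: zeros_def)
  have nz1: "x1 t \<noteq> 0" if "0 < t" "t < t1" for t
    using Min_le[OF fin(1), of t] that by (force simp: t1_def zeros_def)
  have pos: "0 < x1 t" if "0 < t" "t < t1" for t
    using pos_before_zero[OF z1 init nz1 that] by blast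
  have "y1 t1 \<noteq> 0" using nontrivial[OF z1, of t1] init t1 by auto
  moreover have "\<not> 0 < y1 t1"
  proof
    assume "0 < y1 t1"
    then obtain d where d: "d > 0" "\<And>h. 0 < h \<Longrightarrow> h < d \<Longrightarrow> x1 (t1 - h) < x1 t1"
      using DERIV_pos_inc_left[OF trajD(3)[OF z1 t1(1)]] by blast
    define h where "h = min (d / 2) (t1 / 2)"
    have "0 < h" "h < d" "h < t1" using d(1) t1 by (auto simp: h_def min_def)
    then show False using d(2)[of h] pos[of "t1 - h"] t1 by simp
  qed
  ultimately have yneg: "y1 t1 < 0" by simp
  have "\<exists>s>0. x2 s = x1 t1 \<and> y2 s < y1 t1 \<and> (\<forall>t. 0 < t \<and> t < s \<longrightarrow> 0 < x2 t)"
    by (rule outer_half_turn[OF z1 z2 out t1(1) pos]) (use t1 yneg in \<open>auto simp: energy_def\<close>)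
  then obtain s where s: "s > 0" "x2 s = 0" "y2 s < y1 t1" "\<And>t. 0 < t \<Longrightarrow> t < s \<Longrightarrow> 0 < x2 t"
    using t1 by auto
  have nz2: "x2 t \<noteq> 0" if "0 < t" "t < s" for t using s(4)[OF that] by simp
  note step1 = zeros_step_card[of t1 x1, OF t1 nz1 fin(1)] and step2 = zeros_step_card[of s x2, OF s(1,2) nz2 fin(2)]
  have z1': "traj (\<lambda>t. - x1 (t1 + t)) (\<lambda>t. - y1 (t1 + t))" and z2': "traj (\<lambda>t. - x2 (s + t)) (\<lambda>t. - y2 (s + t))"
    using traj_minus[OF traj_shift[OF z1]] traj_minus[OF traj_shift[OF z2]] t1 s by auto
  have "outside (\<lambda>t. - x1 (t1 + t)) (\<lambda>t. - y1 (t1 + t)) (\<lambda>t. - x2 (s + t)) (\<lambda>t. - y2 (s + t))"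
  proof -
    have "t = 0" if "0 \<le> t" "\<forall>u. 0 \<le> u \<and> u \<le> t \<longrightarrow> 0 < - y1 (t1 + u)" "- x1 (t1 + t) = 0" for t
    proof (rule ccontr)
      assume "t \<noteq> 0"
      then have "- x1 (t1 + 0) < - x1 (t1 + t)" using that by (intro traj_increasing[OF z1']) auto
      then show False using that t1 by simp
    qed
    then show ?thesis unfolding outside_def using yneg s t1 by fastforce
  qed
  from Suc.hyps(1)[OF _ z1' z2' this step1(1) step2(1)]
  have "card (zeros (\<lambda>t. - x1 (t1 + t))) \<le> card (zeros (\<lambda>t. - x2 (s + t))) \<and>
    (fast (\<lambda>t. - x1 (t1 + t)) (\<lambda>t. - y1 (t1 + t)) \<longrightarrow> card (zeros (\<lambda>t. - x1 (t1 + t))) < card (zeros (\<lambda>t. - x2 (s + t))))"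
    using step1(2) Suc.hyps(2) by simp
  moreover have "fast (\<lambda>t. - x1 (t1 + t)) (\<lambda>t. - y1 (t1 + t))" if "fast x1 y1"
    using that t1 by (simp add: fast_def)
  ultimately show ?case using step1(2) step2(2) by simp
qed

section \<open>The number of zeroes of nearby orbits\<close>

lemma traj_depends_on_initial_values:
  assumes z: "traj x y" and "0 < \<epsilon>"
  shows "\<exists>\<delta>>0. \<forall>x' y'. traj x' y' \<longrightarrow> \<bar>x' 0 - x 0\<bar> < \<delta> \<longrightarrow> \<bar>y' 0 - y 0\<bar> < \<delta> \<longrightarrow>
     (\<forall>t. 0 \<le> t \<longrightarrow> t \<le> T \<longrightarrow> \<bar>x' t - x t\<bar> < \<epsilon> \<and> \<bar>y' t - y t\<bar> < \<epsilon>)"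
proof -
  obtain C where C: "C \<ge> 0" "\<And>x y t. traj x y \<Longrightarrow> 0 \<le> t \<Longrightarrow> (x t)\<^sup>2 + (y t)\<^sup>2 \<le> 2 * energy (x 0) (y 0) + C"
    using traj_bounded by blast
  define E where "E = (\<bar>y 0\<bar> + 1)\<^sup>2 / 2 + K * (\<bar>x 0\<bar> + 1) powr q / q"
  have E0: "0 \<le> E" using K_pos q_gt_2 by (simp add: E_def)
  define M where "M = 1 + 2 * E + C"
  have M: "1 \<le> M" using E0 C by (simp add: M_def)
  have bound: "\<bar>x' t\<bar> \<le> M"
      if z': "traj x' y'" and near: "\<bar>x' 0 - x 0\<bar> < 1" "\<bar>y' 0 - y 0\<bar> < 1" and t: "0 \<le> t" for x' y' t
  proof -
    have le: "\<bar>x' 0\<bar> \<le> \<bar>x 0\<bar> + 1" "\<bar>y' 0\<bar> \<le> \<bar>y 0\<bar> + 1" using near by linarith+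
    have "(y' 0)\<^sup>2 \<le> (\<bar>y 0\<bar> + 1)\<^sup>2" using power_mono[OF le(2), of 2] by simp
    moreover have "K * \<bar>x' 0\<bar> powr q / q \<le> K * (\<bar>x 0\<bar> + 1) powr q / q"
      using le(1) K_pos q_gt_2 by (intro divide_right_mono mult_left_mono powr_mono2) auto
    moreover have "0 \<le> alpha * lam * (x' 0)\<^sup>2 / 2" using B_pos by simp
    moreover have "energy (x' 0) (y' 0) = (y' 0)\<^sup>2 / 2 + (K * \<bar>x' 0\<bar> powr q / q - alpha * lam * (x' 0)\<^sup>2 / 2)"
      by (simp add: energy_def potential_def)
    ultimately have "energy (x' 0) (y' 0) \<le> E"
      unfolding E_def by linarith
    then have "(x' t)\<^sup>2 + (y' t)\<^sup>2 \<le> M" using C(2)[OF z' t] by (simp add: M_def)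
    then have "(x' t)\<^sup>2 \<le> M" using zero_le_power2[of "y' t"] by linarith
    also have "M \<le> M\<^sup>2" using M by (simp add: self_le_power)
    finally have "\<bar>x' t\<bar>\<^sup>2 \<le> M\<^sup>2" by simp
    then show ?thesis by (rule power2_le_imp_le) (use M in simp)
  qed
  obtain L where L: "L \<ge> 0" "\<forall>x1 y1 x2 y2. traj x1 y1 \<longrightarrow> traj x2 y2 \<longrightarrow>
     (\<forall>t\<ge>0. \<bar>x1 t\<bar> \<le> M \<and> \<bar>x2 t\<bar> \<le> M) \<longrightarrow>
     (\<forall>s t. 0 \<le> s \<longrightarrow> s \<le> t \<longrightarrow>
        (x1 t - x2 t)\<^sup>2 + (y1 t - y2 t)\<^sup>2 \<le> exp (L * (t - s)) * ((x1 s - x2 s)\<^sup>2 + (y1 s - y2 s)\<^sup>2) \<and>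
        (x1 s - x2 s)\<^sup>2 + (y1 s - y2 s)\<^sup>2 \<le> exp (L * (t - s)) * ((x1 t - x2 t)\<^sup>2 + (y1 t - y2 t)\<^sup>2))"
    using traj_gronwall[of M] by (elim exE conjE) (rule that)
  define \<delta> where "\<delta> = min 1 (\<epsilon> / (2 * exp (L * \<bar>T\<bar>)))"
  have d: "0 < \<delta>" "\<delta> \<le> 1" using assms by (auto simp: \<delta>_def)
  have d2: "exp (L * \<bar>T\<bar>) * (2 * \<delta>\<^sup>2) < \<epsilon>\<^sup>2"
  proof -
    define e where "e = exp (L * \<bar>T\<bar>)"
    have e: "1 \<le> e" using L(1) by (simp add: e_def)
    have "\<delta> \<le> \<epsilon> / (2 * e)" by (simp add: \<delta>_def e_def)
    then have "\<delta>\<^sup>2 \<le> (\<epsilon> / (2 * e))\<^sup>2" using d by (intro power_mono) auto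
    then have "e * (2 * \<delta>\<^sup>2) \<le> e * (2 * (\<epsilon> / (2 * e))\<^sup>2)" using e by (intro mult_left_mono) auto
    also have "\<dots> = \<epsilon>\<^sup>2 / (2 * e)" using e by (simp add: power2_eq_square field_simps)
    also have "\<dots> < \<epsilon>\<^sup>2 / 1" using e assms(2) by (intro divide_strict_left_mono) auto
    finally show ?thesis by (simp add: e_def)
  qed
  have "\<bar>x' t - x t\<bar> < \<epsilon> \<and> \<bar>y' t - y t\<bar> < \<epsilon>"
    if z': "traj x' y'" and near: "\<bar>x' 0 - x 0\<bar> < \<delta>" "\<bar>y' 0 - y 0\<bar> < \<delta>" and t: "0 \<le> t" "t \<le> T" for x' y' t
  proof -
    have bds: "\<bar>x' s\<bar> \<le> M \<and> \<bar>x s\<bar> \<le> M" if "s \<ge> 0" for s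
      using bound[OF z' _ _ that] bound[OF z _ _ that] near d by auto
    have "(x' t - x t)\<^sup>2 + (y' t - y t)\<^sup>2 \<le> exp (L * (t - 0)) * ((x' 0 - x 0)\<^sup>2 + (y' 0 - y 0)\<^sup>2)"
      by (rule conjunct1[OF L(2)[rule_format, OF z' z bds order_refl t(1)]])
    also have "\<dots> \<le> exp (L * \<bar>T\<bar>) * (2 * \<delta>\<^sup>2)"
    proof (rule mult_mono)
      show "exp (L * (t - 0)) \<le> exp (L * \<bar>T\<bar>)" using L(1) t by (simp add: mult_left_mono)
      have "\<bar>x' 0 - x 0\<bar>\<^sup>2 \<le> \<delta>\<^sup>2" "\<bar>y' 0 - y 0\<bar>\<^sup>2 \<le> \<delta>\<^sup>2"
        by (rule power_mono; use near in simp)+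
      then show "(x' 0 - x 0)\<^sup>2 + (y' 0 - y 0)\<^sup>2 \<le> 2 * \<delta>\<^sup>2" by simp
    qed auto
    also note d2
    finally have *: "(x' t - x t)\<^sup>2 + (y' t - y t)\<^sup>2 < \<epsilon>\<^sup>2" .
    then have "\<bar>x' t - x t\<bar>\<^sup>2 < \<epsilon>\<^sup>2" "\<bar>y' t - y t\<bar>\<^sup>2 < \<epsilon>\<^sup>2"
      using zero_le_power2[of "x' t - x t"] zero_le_power2[of "y' t - y t"] unfolding power2_abs by linarith+
    then show ?thesis using power_less_imp_less_base[of _ 2 \<epsilon>] assms(2) by (meson less_imp_le)
  qed
  then show ?thesis using d by blast
qed

text \<open>
  As \<open>x\<close> and \<open>y\<close> never vanish together, \<open>max |x| |y|\<close> has a positive minimum on \<open>[0, T]\<close>, which bounds \<open>|y|\<close>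
  from below at all zeroes; uniform continuity extends the bound to neighbourhoods of a common size.
\<close>

lemma zeros_separated:
  assumes z: "traj x y" and nt: "x 0 \<noteq> 0 \<or> y 0 \<noteq> 0" and T: "0 \<le> T"
  shows "\<exists>\<delta>>0. \<exists>\<eta>>0. \<forall>s\<in>zeros x. s \<le> T \<longrightarrow> (\<forall>t\<ge>0. \<bar>t - s\<bar> < \<delta> \<longrightarrow> \<eta> < \<bar>y t\<bar>)"
proof -
  have "continuous_on {0..T} (\<lambda>t. max \<bar>x t\<bar> \<bar>y t\<bar>)"
    by (intro continuous_intros continuous_on_max traj_cont[OF z]) auto
  then obtain m where m: "m \<in> {0..T}" "\<And>t. t \<in> {0..T} \<Longrightarrow> max \<bar>x m\<bar> \<bar>y m\<bar> \<le> max \<bar>x t\<bar> \<bar>y t\<bar>"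
    using continuous_attains_inf[of "{0..T}" "\<lambda>t. max \<bar>x t\<bar> \<bar>y t\<bar>"] T by auto
  define \<eta> where "\<eta> = max \<bar>x m\<bar> \<bar>y m\<bar> / 2"
  have eta: "0 < \<eta>" using nontrivial[OF z nt, of m] m(1) by (auto simp: \<eta>_def less_max_iff_disj)
  have big: "2 * \<eta> \<le> \<bar>y s\<bar>" if "s \<in> zeros x" "s \<le> T" for s
    using m(2)[of s] that by (auto simp: \<eta>_def zeros_def)
  have "uniformly_continuous_on {0..T + 1} y"
    by (intro compact_uniformly_continuous traj_cont[OF z]) auto
  then obtain d where d: "d > 0" "\<And>s t. s \<in> {0..T+1} \<Longrightarrow> t \<in> {0..T+1} \<Longrightarrow> dist t s < d \<Longrightarrow> dist (y t) (y s) < \<eta>"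
    unfolding uniformly_continuous_on_def using eta by meson
  have "\<eta> < \<bar>y t\<bar>" if s: "s \<in> zeros x" "s \<le> T" and t: "0 \<le> t" "\<bar>t - s\<bar> < min d 1" for s t
  proof -
    have "dist (y t) (y s) < \<eta>" by (rule d(2)) (use s t in \<open>auto simp: zeros_def dist_real_def\<close>)
    then show ?thesis using big[OF s] by (simp add: dist_real_def)
  qed
  then show ?thesis using eta d(1) by (intro exI[of _ "min d 1"]) auto
qed

text \<open>
  Zeroes of a nearby orbit can only occur close to zeroes of the given one, and not twice close to the
  same zero, since by Rolle's theorem the velocity would vanish in between.
\<close>

lemma zero_count_upper_on_interval:
  assumes z: "traj x y" and pos: "0 < x 0" and T: "0 \<le> T" "x T \<noteq> 0"
  shows "\<exists>\<epsilon>>0. \<forall>x' y'. traj x' y' \<longrightarrow> (\<forall>t. 0 \<le> t \<longrightarrow> t \<le> T \<longrightarrow> \<bar>x' t - x t\<bar> < \<epsilon> \<and> \<bar>y' t - y t\<bar> < \<epsilon>) \<longrightarrow>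
     card (zeros x' \<inter> {..T}) \<le> card (zeros x \<inter> {..T})"
proof -
  have fin: "finite (zeros x \<inter> {..T})" using finite_zeros[OF z pos] by simp
  obtain \<delta> \<eta> where d: "\<delta> > 0" "\<eta> > 0"
    "\<And>s t. s \<in> zeros x \<Longrightarrow> s \<le> T \<Longrightarrow> 0 \<le> t \<Longrightarrow> \<bar>t - s\<bar> < \<delta> \<Longrightarrow> \<eta> < \<bar>y t\<bar>"
    using zeros_separated[OF z _ T(1)] pos by (metis less_irrefl)
  define C where "C = {0..T} - (\<Union>s\<in>zeros x \<inter> {..T}. ball s \<delta>)"
  have "compact C" unfolding C_def by (intro compact_diff) auto
  have nz: "x t \<noteq> 0" if "t \<in> C" for t
  proof
    assume "x t = 0"
    then have "t \<in> zeros x \<inter> {..T}" using that pos by (cases "t = 0") (auto simp: C_def zeros_def)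
    moreover have "t \<in> ball t \<delta>" using d(1) by simp
    ultimately show False using that unfolding C_def by blast
  qed
  have "\<exists>\<mu>>0. \<forall>t\<in>C. \<mu> \<le> \<bar>x t\<bar>"
  proof (cases "C = {}")
    case False
    have "continuous_on C (\<lambda>t. \<bar>x t\<bar>)" by (intro continuous_intros traj_cont[OF z]) (auto simp: C_def)
    then obtain m where "m \<in> C" "\<And>t. t \<in> C \<Longrightarrow> \<bar>x m\<bar> \<le> \<bar>x t\<bar>"
      using continuous_attains_inf[OF \<open>compact C\<close> False] by blast
    then show ?thesis using nz[of m] by (intro exI[of _ "\<bar>x m\<bar>"]) auto
  qed (auto intro: exI[of _ 1])
  then obtain \<mu> where \<mu>: "\<mu> > 0" "\<And>t. t \<in> C \<Longrightarrow> \<mu> \<le> \<bar>x t\<bar>" by blast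
  define \<epsilon> where "\<epsilon> = min \<mu> \<eta>"
  have "card (zeros x' \<inter> {..T}) \<le> card (zeros x \<inter> {..T})"
    if z': "traj x' y'" and near: "\<And>t. 0 \<le> t \<Longrightarrow> t \<le> T \<Longrightarrow> \<bar>x' t - x t\<bar> < \<epsilon> \<and> \<bar>y' t - y t\<bar> < \<epsilon>" for x' y'
  proof -
    have "\<exists>s\<in>zeros x \<inter> {..T}. \<bar>u - s\<bar> < \<delta>" if u: "u \<in> zeros x' \<inter> {..T}" for u
    proof (rule ccontr)
      assume "\<not> ?thesis"
      then have "u \<in> C" using u by (auto simp: C_def zeros_def dist_real_def abs_minus_commute)
      then have "\<mu> \<le> \<bar>x u\<bar>" by (rule \<mu>(2))
      moreover have "\<bar>x' u - x u\<bar> < \<epsilon>" "x' u = 0" using near[of u] u by (auto simp: zeros_def)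
      ultimately show False by (simp add: \<epsilon>_def)
    qed
    then obtain g where g: "\<And>u. u \<in> zeros x' \<inter> {..T} \<Longrightarrow> g u \<in> zeros x \<inter> {..T} \<and> \<bar>u - g u\<bar> < \<delta>"
      by metis
    have "False" if uw: "u \<in> zeros x' \<inter> {..T}" "w \<in> zeros x' \<inter> {..T}" "u < w" "g u = g w" for u w
    proof -
      have "x' u = x' w" "0 \<le> u" using uw by (auto simp: zeros_def)
      then obtain c where c: "u < c" "c < w" "y' c = 0" using rolle_velocity[OF z' _ uw(3)] by metis
      have cb: "0 \<le> c" "c \<le> T" using c uw by (auto simp: zeros_def)
      have "\<bar>c - g u\<bar> < \<delta>" using g[OF uw(1)] g[OF uw(2)] uw(4) c by (auto simp: abs_less_iff)
      then have "\<eta> < \<bar>y c\<bar>" using d(3)[of "g u" c] g[OF uw(1)] cb by auto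
      then show False using near[OF cb] c(3) by (simp add: \<epsilon>_def)
    qed
    then have "inj_on g (zeros x' \<inter> {..T})" by (intro linorder_inj_onI') blast
    then show ?thesis by (rule card_inj_on_le) (use g fin in auto)
  qed
  moreover have "\<epsilon> > 0" using \<mu> d by (simp add: \<epsilon>_def)
  ultimately show ?thesis by blast
qed

text \<open>
  At distance \<open>r\<close> on both sides of each zero, \<open>x\<close> has opposite signs, which nearby orbits inherit. The zeroes are
  more than \<open>2 r\<close> apart, so the zeroes found in this way are different.
\<close>

lemma zero_count_lower_on_interval:
  assumes z: "traj x y" and pos: "0 < x 0" and T: "0 \<le> T" "\<And>t. T \<le> t \<Longrightarrow> x t \<noteq> 0"
  shows "\<exists>\<epsilon>>0. \<forall>x' y'. traj x' y' \<longrightarrow> 0 < x' 0 \<longrightarrow> (\<forall>t. 0 \<le> t \<longrightarrow> t \<le> T + 1 \<longrightarrow> \<bar>x' t - x t\<bar> < \<epsilon>) \<longrightarrow>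
     card (zeros x) \<le> card (zeros x')"
proof (cases "zeros x = {}")
  case True
  then show ?thesis by (auto intro: exI[of _ 1])
next
  case ne: False
  have fin: "finite (zeros x)" using finite_zeros[OF z pos] .
  have leT: "s \<le> T" if "s \<in> zeros x" for s using T(2)[of s] that by (auto simp: zeros_def intro: ccontr)
  obtain \<delta> \<eta> where d: "\<delta> > 0" "\<eta> > 0"
    "\<And>s t. s \<in> zeros x \<Longrightarrow> s \<le> T \<Longrightarrow> 0 \<le> t \<Longrightarrow> \<bar>t - s\<bar> < \<delta> \<Longrightarrow> \<eta> < \<bar>y t\<bar>"
    using zeros_separated[OF z _ T(1)] pos by (metis less_irrefl)
  define r where "r = min (min (\<delta> / 3) 1) (Min (zeros x) / 2)"
  have "0 < Min (zeros x)" using Min_in[OF fin ne] by (simp add: zeros_def)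
  then have r: "0 < r" "r < \<delta>" "2 * r < \<delta>" "r \<le> 1" using d(1) by (auto simp: r_def min_def)
  have rs: "r < s" if "s \<in> zeros x" for s
    using Min_le[OF fin that] \<open>0 < Min (zeros x)\<close> by (auto simp: r_def min_def)
  have sep: "s + 2 * r < t" if st: "s \<in> zeros x" "t \<in> zeros x" "s < t" for s t
  proof (rule ccontr)
    assume "\<not> s + 2 * r < t"
    obtain c where c: "s < c" "c < t" "y c = 0"
      using rolle_velocity[OF z _ st(3)] st by (auto simp: zeros_def)
    have "\<eta> < \<bar>y c\<bar>"
      using d(3)[of s c] leT[OF st(1)] st c r(3) \<open>\<not> s + 2 * r < t\<close> by (auto simp: zeros_def)
    then show False using c(3) d(2) by simp
  qed
  have opp: "x (s - r) * x (s + r) < 0" if s: "s \<in> zeros x" for s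
  proof -
    have xs: "x s = 0" "r < s" "s \<le> T" using s rs leT by (auto simp: zeros_def)
    have ny: "y t \<noteq> 0" if "s - r \<le> t" "t \<le> s + r" for t
      using d(3)[OF s xs(3), of t] d(2) that xs r by (auto simp: abs_less_iff)
    consider "\<forall>t\<in>{s - r..s + r}. 0 < y t" | "\<forall>t\<in>{s - r..s + r}. y t < 0"
    proof (cases "0 < y s")
      case True
      have "0 < y t" if t: "t \<in> {s - r..s + r}" for t
      proof (rule ccontr)
        assume "\<not> 0 < y t"
        then have "\<exists>c. min s t \<le> c \<and> c \<le> max s t \<and> y c = 0"
          using IVT2'[of y t 0 s] IVT'[of y t 0 s] True traj_cont(2)[OF z, of "{min s t..max s t}"] t xs
          by (cases "s \<le> t") (auto simp: min_def max_def)
        then show False using ny t r by (auto simp: min_def max_def split: if_splits)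
      qed
      then show ?thesis using that by blast
    next
      case False
      then have ys: "y s < 0" using ny[of s] r by auto
      have "y t < 0" if t: "t \<in> {s - r..s + r}" for t
      proof (rule ccontr)
        assume "\<not> y t < 0"
        then have "\<exists>c. min s t \<le> c \<and> c \<le> max s t \<and> y c = 0"
          using IVT2'[of y s 0 t] IVT'[of y s 0 t] ys traj_cont(2)[OF z, of "{min s t..max s t}"] t xs
          by (cases "s \<le> t") (auto simp: min_def max_def)
        then show False using ny t r by (auto simp: min_def max_def split: if_splits)
      qed
      then show ?thesis using that by blast
    qed
    then show ?thesis
    proof cases
      case 1
      then have "x (s - r) < x s" "x s < x (s + r)" using xs r by (intro traj_increasing[OF z]; simp)+
      then show ?thesis using xs by (simp add: mult_neg_pos)
    next
      case 2
      then have "x s < x (s - r)" "x (s + r) < x s" using xs r by (intro traj_decreasing[OF z]; simp)+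
      then show ?thesis using xs by (simp add: mult_pos_neg)
    qed
  qed
  define W where "W = (\<lambda>s. min \<bar>x (s - r)\<bar> \<bar>x (s + r)\<bar>) ` zeros x"
  define \<epsilon> where "\<epsilon> = Min W"
  have "\<forall>w\<in>W. 0 < w" unfolding W_def using opp by force
  then have e: "0 < \<epsilon>" unfolding \<epsilon>_def using fin ne by (simp add: W_def)
  have el: "\<epsilon> \<le> \<bar>x (s - r)\<bar>" "\<epsilon> \<le> \<bar>x (s + r)\<bar>" if "s \<in> zeros x" for s
  proof -
    have "\<epsilon> \<le> min \<bar>x (s - r)\<bar> \<bar>x (s + r)\<bar>" unfolding \<epsilon>_def W_def using fin that by (intro Min_le) auto
    then show "\<epsilon> \<le> \<bar>x (s - r)\<bar>" "\<epsilon> \<le> \<bar>x (s + r)\<bar>" by auto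
  qed
  have "card (zeros x) \<le> card (zeros x')"
    if z': "traj x' y'" and pos': "0 < x' 0" and near: "\<And>t. 0 \<le> t \<Longrightarrow> t \<le> T + 1 \<Longrightarrow> \<bar>x' t - x t\<bar> < \<epsilon>" for x' y'
  proof -
    have "\<exists>u\<in>zeros x'. \<bar>u - s\<bar> \<le> r" if s: "s \<in> zeros x" for s
    proof -
      have "\<bar>x' (s - r) - x (s - r)\<bar> < \<epsilon>" "\<bar>x' (s + r) - x (s + r)\<bar> < \<epsilon>"
        using near[of "s - r"] near[of "s + r"] rs[OF s] leT[OF s] r by auto
      then have near': "\<bar>x' (s - r) - x (s - r)\<bar> < \<bar>x (s - r)\<bar>" "\<bar>x' (s + r) - x (s + r)\<bar> < \<bar>x (s + r)\<bar>"
        using el[OF s] by linarith+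
      have c: "continuous_on {s - r..s + r} x'" using rs[OF s] by (intro traj_cont[OF z']) auto
      consider "x (s - r) < 0" "0 < x (s + r)" | "0 < x (s - r)" "x (s + r) < 0"
        using opp[OF s] by (auto simp: mult_less_0_iff)
      then obtain u where u: "s - r \<le> u" "u \<le> s + r" "x' u = 0"
      proof cases
        case 1
        then have "x' (s - r) \<le> 0" "0 \<le> x' (s + r)" using near' by linarith+
        then show ?thesis using IVT'[of x' "s - r" 0 "s + r"] c r that by auto
      next
        case 2
        then have "0 \<le> x' (s - r)" "x' (s + r) \<le> 0" using near' by linarith+
        then show ?thesis using IVT2'[of x' "s + r" 0 "s - r"] c r that by auto
      qed
      then have "u \<in> zeros x'" using rs[OF s] by (simp add: zeros_def)
      then show ?thesis using u by (intro bexI[of _ u]) (auto simp: abs_le_iff)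
    qed
    then obtain g where g: "\<And>s. s \<in> zeros x \<Longrightarrow> g s \<in> zeros x' \<and> \<bar>g s - s\<bar> \<le> r" by metis
    have "inj_on g (zeros x)"
    proof (rule linorder_inj_onI')
      fix s t assume "s \<in> zeros x" "t \<in> zeros x" "s < t"
      then show "g s \<noteq> g t" using sep[of s t] g[of s] g[of t] by (auto simp: abs_le_iff)
    qed
    then show ?thesis by (rule card_inj_on_le) (use g finite_zeros[OF z' pos'] in auto)
  qed
  then show ?thesis using e by blast
qed

text \<open>
  Up to a late time \<open>T\<close> the zeroes correspond to each other. If the given orbit is not fast, both orbits
  have negative energy at \<open>T\<close> and no zeroes afterwards. If it is fast, the nearby orbit has at time \<open>T\<close>
  less energy than two more zeroes would cost.
\<close>

lemma zero_count_semicontinuous: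
  assumes z: "traj x y" and pos: "0 < x 0"
  shows "\<exists>\<delta>>0. \<forall>x' y'. traj x' y' \<longrightarrow> 0 < x' 0 \<longrightarrow> \<bar>x' 0 - x 0\<bar> < \<delta> \<longrightarrow> \<bar>y' 0 - y 0\<bar> < \<delta> \<longrightarrow>
    card (zeros x) \<le> card (zeros x') \<and> card (zeros x') \<le> card (zeros x) + (if fast x y then 1 else 0)"
proof -
  have nt: "x 0 \<noteq> 0 \<or> y 0 \<noteq> 0" using pos by simp
  obtain c0 where c0: "c0 > 0" "\<And>x y s1 s2. traj x y \<Longrightarrow> (x 0 \<noteq> 0 \<or> y 0 \<noteq> 0) \<Longrightarrow> 0 \<le> s1 \<Longrightarrow> s1 < s2 \<Longrightarrow>
     x s1 = 0 \<Longrightarrow> x s2 = 0 \<Longrightarrow> c0 \<le> energy (x s1) (y s1)"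
    using energy_loss_between_zeros by meson
  define e where "e = (if fast x y then c0 else 0)"
  obtain T0 where T0: "0 \<le> T0" "\<And>t. T0 \<le> t \<Longrightarrow> x t \<noteq> 0" using eventually_nonzero[OF z nt] by blast
  have "\<exists>S. \<forall>t\<ge>S. energy (x t) (y t) < e"
  proof (cases "fast x y")
    case True
    have ce: "((\<lambda>t. energy (x t) (y t)) \<longlongrightarrow> 0\<^sup>2 / 2 + potential 0) at_top" unfolding energy_def
      by (intro tendsto_intros fast_velocity_tendsto_0[OF z True]
          isCont_tendsto_compose[OF DERIV_isCont[OF deriv_potential] fast_tail(1)[OF z nt True]]) simp
    then have "eventually (\<lambda>t. energy (x t) (y t) < c0) at_top" using order_tendstoD(2)[OF ce, of c0] c0(1)
        by simp
    then show ?thesis using True by (simp add: e_def eventually_at_top_linorder)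
  next
    case False
    then obtain S where S: "0 \<le> S" "energy (x S) (y S) < 0" by (auto simp: fast_def not_le)
    then show ?thesis using energy_antimono[OF z S(1)] False by (intro exI[of _ S]) (force simp: e_def)
  qed
  then obtain S where S: "\<And>t. t \<ge> S \<Longrightarrow> energy (x t) (y t) < e" by blast
  define T where "T = max T0 S"
  have T: "0 \<le> T" "\<And>t. T \<le> t \<Longrightarrow> x t \<noteq> 0" "energy (x T) (y T) < e" using T0 S by (auto simp: T_def)
  have leT: "zeros x \<inter> {..T} = zeros x"
  proof -
    have "t \<le> T" if "t \<in> zeros x" for t
      using T(2)[of t] that by (cases "t \<le> T") (auto simp: zeros_def)
    then show ?thesis by auto
  qed
  obtain \<epsilon>1 where e1: "\<epsilon>1 > 0" "\<And>x' y'. traj x' y' \<Longrightarrow>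
     (\<And>t. 0 \<le> t \<Longrightarrow> t \<le> T \<Longrightarrow> \<bar>x' t - x t\<bar> < \<epsilon>1 \<and> \<bar>y' t - y t\<bar> < \<epsilon>1) \<Longrightarrow>
     card (zeros x' \<inter> {..T}) \<le> card (zeros x \<inter> {..T})"
    using zero_count_upper_on_interval[OF z pos T(1) T(2)[OF order_refl]] by blast
  obtain \<epsilon>2 where e2: "\<epsilon>2 > 0" "\<And>x' y'. traj x' y' \<Longrightarrow> 0 < x' 0 \<Longrightarrow>
     (\<And>t. 0 \<le> t \<Longrightarrow> t \<le> T + 1 \<Longrightarrow> \<bar>x' t - x t\<bar> < \<epsilon>2) \<Longrightarrow> card (zeros x) \<le> card (zeros x')"
    using zero_count_lower_on_interval[OF z pos T(1,2)] by blast
  have "continuous_on UNIV (\<lambda>p::real \<times> real. energy (fst p) (snd p))"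
    unfolding energy_def by (intro continuous_intros) simp
  then have "isCont (\<lambda>p::real \<times> real. energy (fst p) (snd p)) (x T, y T)"
    by (simp add: continuous_on_eq_continuous_at)
  then have "((\<lambda>p. energy (fst p) (snd p)) \<longlongrightarrow> energy (x T) (y T)) (nhds (x T, y T))"
    unfolding isCont_def
    using tendsto_at_iff_tendsto_nhds[of "\<lambda>p. energy (fst p) (snd p)" "(x T, y T)"] by simp
  then have "eventually (\<lambda>p. energy (fst p) (snd p) < e) (nhds (x T, y T))"
    using T(3) by (rule order_tendstoD(2))
  then obtain \<epsilon>3 where e3: "\<epsilon>3 > 0" "\<And>p. dist p (x T, y T) < \<epsilon>3 \<Longrightarrow> energy (fst p) (snd p) < e"
    by (auto simp: eventually_nhds_metric)
  define \<epsilon> where "\<epsilon> = min (min \<epsilon>1 \<epsilon>2) (\<epsilon>3 / 2)"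
  have e: "\<epsilon> > 0" using e1 e2 e3 by (simp add: \<epsilon>_def)
  obtain \<delta> where d: "\<delta> > 0" "\<And>x' y' t. traj x' y' \<Longrightarrow> \<bar>x' 0 - x 0\<bar> < \<delta> \<Longrightarrow> \<bar>y' 0 - y 0\<bar> < \<delta> \<Longrightarrow>
     0 \<le> t \<Longrightarrow> t \<le> T + 1 \<Longrightarrow> \<bar>x' t - x t\<bar> < \<epsilon> \<and> \<bar>y' t - y t\<bar> < \<epsilon>"
    using traj_depends_on_initial_values[OF z e, of "T + 1"] by blast
  have "card (zeros x) \<le> card (zeros x') \<and> card (zeros x') \<le> card (zeros x) + (if fast x y then 1 else 0)"
    if z': "traj x' y'" and pos': "0 < x' 0" and near: "\<bar>x' 0 - x 0\<bar> < \<delta>" "\<bar>y' 0 - y 0\<bar> < \<delta>" for x' y'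
  proof
    note close = d(2)[OF z' near]
    show "card (zeros x) \<le> card (zeros x')" using close by (intro e2(2)[OF z' pos']) (auto simp: \<epsilon>_def)
    have up: "card (zeros x' \<inter> {..T}) \<le> card (zeros x)"
      using e1(2)[OF z'] close unfolding leT by (force simp: \<epsilon>_def)
    have "dist (x' T, y' T) (x T, y T) \<le> \<bar>x' T - x T\<bar> + \<bar>y' T - y T\<bar>"
      unfolding dist_Pair_Pair dist_real_def using sqrt_sum_squares_le_sum_abs by auto
    also have "\<dots> < \<epsilon>3" using close[of T] T(1) by (auto simp: \<epsilon>_def)
    finally have E': "energy (x' T) (y' T) < e" using e3(2)[of "(x' T, y' T)"] by simp
    have nt': "x' 0 \<noteq> 0 \<or> y' 0 \<noteq> 0" using pos' by simp
    have late: "0 \<le> energy (x' s) (y' s)" "energy (x' s) (y' s) < e" if "s \<in> zeros x'" "T < s" for s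
      using energy_antimono[OF z' T(1), of s] E' that by (auto simp: zeros_def energy_def)
    have "card (zeros x' \<inter> {T<..}) \<le> (if fast x y then 1 else 0)"
    proof (cases "fast x y")
      case False
      then have "zeros x' \<inter> {T<..} = {}" using late by (force simp: e_def)
      then show ?thesis by simp
    next
      case True
      have "s = t" if "s \<in> zeros x' \<inter> {T<..}" "t \<in> zeros x' \<inter> {T<..}" for s t
      proof (rule ccontr)
        assume "s \<noteq> t"
        define u w where "u = min s t" and "w = max s t"
        have uw: "u < w" "u \<in> zeros x'" "w \<in> zeros x'" "T < u"
          using that \<open>s \<noteq> t\<close> by (auto simp: u_def w_def min_def max_def)
        then have "c0 \<le> energy (x' u) (y' u)" by (intro c0(2)[OF z' nt']) (auto simp: zeros_def)
        then show False using late(2)[OF uw(2,4)] True by (simp add: e_def)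
      qed
      moreover have "finite (zeros x' \<inter> {T<..})" using finite_zeros[OF z' pos'] by simp
      ultimately have "card (zeros x' \<inter> {T<..}) \<le> 1" using card_le_Suc0_iff_eq[of "zeros x' \<inter> {T<..}"] by auto
      then show ?thesis using True by simp
    qed
    moreover have "card (zeros x') \<le> card (zeros x' \<inter> {..T}) + card (zeros x' \<inter> {T<..})"
    proof -
      have "zeros x' = (zeros x' \<inter> {..T}) \<union> (zeros x' \<inter> {T<..})" by auto
      then show ?thesis by (metis card_Un_le)
    qed
    ultimately show "card (zeros x') \<le> card (zeros x) + (if fast x y then 1 else 0)" using up by linarith
  qed
  then show ?thesis using d(1) by blast
qed

section \<open>Rotation at high energy\<close>

text \<open>
  If the energy is large, the quotient \<open>v = y/x\<close> satisfies \<open>v' \<le> -(1 + v\<^sup>2)/4\<close> wherever \<open>x \<noteq> 0\<close>. This means that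
  \<open>arctan v\<close> decreases with speed at least \<open>1/4\<close>; since its range has length \<open>\<pi> < 4\<close>, there is a zero of \<open>x\<close> in
  every time interval of length \<open>16\<close>. The energy decays at most exponentially, so it remains large on any
  prescribed time interval if it is large enough at the beginning.
\<close>

lemma many_zeros_if_energy_large:
  "\<exists>R. \<forall>x y. traj x y \<longrightarrow> 0 < x 0 \<longrightarrow> R \<le> energy (x 0) (y 0) \<longrightarrow> k \<le> card (zeros x)"
proof -
  \<comment> \<open>For \<open>|a| \<ge> x0\<close> the nonlinearity is strong enough for the Riccati inequality; for \<open>|a| < x0\<close> an energy above
    \<open>R0\<close> makes \<open>|b/a| \<ge> V\<close>, and then the quadratic term is.\<close>
  define V where "V = 4 * damping + 2 * (alpha * lam + 1)"
  have V: "1 \<le> V" "4 * damping \<le> V" "2 * (alpha * lam + 1) \<le> V" using damping_pos B_pos by (auto simp: V_def)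
  define x0 where "x0 = ((alpha * lam + 1 / 4 + damping\<^sup>2 / 3) / K) powr (1 / (q - 2))"
  have Bp: "0 < alpha * lam + 1 / 4 + damping\<^sup>2 / 3" using B_pos by (simp add: add_pos_nonneg)
  have x0: "x0 > 0" "K * x0 powr (q - 2) = alpha * lam + 1 / 4 + damping\<^sup>2 / 3"
    using Bp K_pos q_gt_2 by (auto simp: x0_def powr_powr)
  define R0 where "R0 = (V * x0)\<^sup>2 / 2 + K * x0 powr q / q"
  have riccati: "(restoring a - damping * b) / a - (b / a)\<^sup>2 \<le> - (1 + (b / a)\<^sup>2) / 4"
    if a: "a \<noteq> 0" and E: "R0 \<le> energy a b" for a b
  proof -
    define v where "v = b / a"
    have eq: "(restoring a - damping * b) / a = alpha * lam - K * \<bar>a\<bar> powr (q - 2) - damping * v"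
      using a by (simp add: restoring_def odd_power_def v_def field_simps)
    have main: "alpha * lam + 1 / 4 \<le> (3 / 4) * v\<^sup>2 + damping * v + K * \<bar>a\<bar> powr (q - 2)"
    proof (cases "x0 \<le> \<bar>a\<bar>")
      case True
      have "x0 powr (q - 2) \<le> \<bar>a\<bar> powr (q - 2)" using True x0 q_gt_2 by (intro powr_mono2) auto
      then have "K * x0 powr (q - 2) \<le> K * \<bar>a\<bar> powr (q - 2)" using K_pos by simp
      moreover have "0 \<le> 3 * (v / 2 + damping / 3)\<^sup>2" by simp
      then have "0 \<le> (3 / 4) * v\<^sup>2 + damping * v + damping\<^sup>2 / 3" by (simp add: power2_eq_square algebra_simps)
      ultimately show ?thesis unfolding x0(2) by linarith
    next
      case False
      have "K * \<bar>a\<bar> powr q / q \<le> K * x0 powr q / q"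
        using False K_pos q_gt_2 by (intro divide_right_mono mult_left_mono powr_mono2) auto
      moreover have "0 \<le> alpha * lam * a\<^sup>2 / 2" using B_pos by simp
      ultimately have "(V * x0)\<^sup>2 \<le> \<bar>b\<bar>\<^sup>2" using E unfolding energy_def potential_def R0_def power2_abs
          by linarith
      then have "V * x0 \<le> \<bar>b\<bar>" by (rule power2_le_imp_le) simp
      moreover have "V * \<bar>a\<bar> \<le> V * x0" using False V by (intro mult_left_mono) auto
      ultimately have "V * \<bar>a\<bar> \<le> \<bar>b\<bar>" by linarith
      then have v: "V \<le> \<bar>v\<bar>" using a by (simp add: v_def field_simps)
      have "\<bar>v\<bar> * V \<le> \<bar>v\<bar> * \<bar>v\<bar>" using v by (intro mult_left_mono) auto
      then have vV: "\<bar>v\<bar> * V \<le> v\<^sup>2" by (simp add: power2_eq_square)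
      have "1 * V \<le> \<bar>v\<bar> * V" using v V by (intro mult_right_mono) auto
      then have h1: "2 * (alpha * lam + 1) \<le> v\<^sup>2" using vV V(3) by linarith
      have "\<bar>v\<bar> * (4 * damping) \<le> \<bar>v\<bar> * V" using V(2) by (intro mult_left_mono) auto
      then have h2: "4 * (\<bar>v\<bar> * damping) \<le> v\<^sup>2" using vV by (simp add: algebra_simps)
      have "- v * damping \<le> \<bar>v\<bar> * damping" using damping_pos by (intro mult_right_mono) auto
      then have h3: "- (damping * v) \<le> \<bar>v\<bar> * damping" by (simp add: mult.commute)
      have h4: "0 \<le> K * \<bar>a\<bar> powr (q - 2)" using K_pos by simp
      show ?thesis using h1 h2 h3 h4 B_pos by (simp add: algebra_simps)
    qed
    then show ?thesis unfolding eq v_def[symmetric] by simp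
  qed
  obtain C where C: "C \<ge> 0" "\<And>x. x\<^sup>2 / 2 - C \<le> potential x" using potential_coercive by blast
  define R where "R = exp (2 * damping * (17 * real k)) * (\<bar>R0\<bar> + C) - C"
  have "k \<le> card (zeros x)" if z: "traj x y" and pos: "0 < x 0" and R: "R \<le> energy (x 0) (y 0)" for x y
  proof -
    have large: "R0 \<le> energy (x t) (y t)" if t: "0 \<le> t" "t \<le> 17 * real k" for t
    proof -
      define \<Phi> where "\<Phi> = (\<lambda>t. energy (x t) (y t) + C)"
      have "\<Phi> 0 \<le> exp (2 * damping * (t - 0)) * \<Phi> t"
      proof (rule gronwall_backward[OF t(1)])
        show "continuous_on {0..t} \<Phi>" unfolding \<Phi>_def by (intro continuous_intros cont_energy[OF z]) auto
        show "(\<Phi> has_real_derivative - damping * (y s)\<^sup>2) (at s)" if "0 < s" for s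
          unfolding \<Phi>_def using DERIV_add[OF deriv_energy[OF z that] DERIV_const] by simp
        show "- (2 * damping) * \<Phi> s \<le> - damping * (y s)\<^sup>2" for s
        proof -
          have "(y s)\<^sup>2 / 2 \<le> \<Phi> s" using C(2)[of "x s"] zero_le_power2[of "x s"] unfolding \<Phi>_def energy_def
              by linarith
          then have "damping * (y s)\<^sup>2 \<le> damping * (2 * \<Phi> s)" using damping_pos by (intro mult_left_mono) auto
          then show ?thesis by simp
        qed
      qed
      moreover have "exp (2 * damping * (17 * real k)) * (\<bar>R0\<bar> + C) \<le> \<Phi> 0" using R by (simp add: \<Phi>_def R_def)
      moreover have "exp (2 * damping * (t - 0)) * (\<bar>R0\<bar> + C) \<le> exp (2 * damping * (17 * real k)) * (\<bar>R0\<bar> + C)"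
        using t damping_pos C by (intro mult_right_mono) auto
      ultimately have "exp (2 * damping * (t - 0)) * (\<bar>R0\<bar> + C) \<le> exp (2 * damping * (t - 0)) * \<Phi> t" by linarith
      then have "\<bar>R0\<bar> + C \<le> \<Phi> t" by simp
      then show ?thesis by (simp add: \<Phi>_def)
    qed
    have ex: "\<exists>t. 17 * real i \<le> t \<and> t \<le> 17 * real i + 16 \<and> x t = 0" if i: "i < k" for i
    proof (rule ccontr)
      assume n: "\<not> ?thesis"
      define s where "s = 17 * real i"
      have s0: "0 \<le> s" by (simp add: s_def)
      have sk: "s + 16 \<le> 17 * real k"
      proof -
        have "real i + 1 \<le> real k" using i by linarith
        then show ?thesis by (simp add: s_def)
      qed
      have nz: "x t \<noteq> 0" if "s \<le> t" "t \<le> s + 16" for t using n that by (auto simp: s_def)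
      define \<theta> where "\<theta> = (\<lambda>t. arctan (y t / x t))"
      have "\<theta> (s + 16) \<le> \<theta> s + (- 1 / 4) * (s + 16 - s)"
      proof (rule diff_le_if_deriv_le)
        show "continuous_on {s..s + 16} \<theta>" unfolding \<theta>_def
          by (intro continuous_intros traj_cont[OF z]) (use s0 nz in auto)
        fix t assume t: "s < t" "t < s + 16"
        then have t0: "0 < t" using s0 by simp
        have nt: "x t \<noteq> 0" using nz t by simp
        define w where "w = (restoring (x t) - damping * y t) / x t - (y t / x t)\<^sup>2"
        have "((\<lambda>t. y t / x t) has_real_derivative w) (at t)"
          by (rule DERIV_cong[OF DERIV_divide[OF trajD(4)[OF z t0] trajD(3)[OF z t0] nt]])
             (use nt in \<open>simp add: w_def field_simps power2_eq_square\<close>)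
        from DERIV_chain2[OF DERIV_arctan this]
        show "(\<theta> has_real_derivative inverse (1 + (y t / x t)\<^sup>2) * w) (at t)" by (simp add: \<theta>_def)
        have "w \<le> - (1 + (y t / x t)\<^sup>2) / 4" unfolding w_def
          by (rule riccati[OF nt]) (use large[of t] t s0 sk in auto)
        then have "inverse (1 + (y t / x t)\<^sup>2) * w \<le> inverse (1 + (y t / x t)\<^sup>2) * (- (1 + (y t / x t)\<^sup>2) / 4)"
          by (intro mult_left_mono) auto
        also have "\<dots> = - 1 / 4"
        proof -
          have "1 + (y t / x t)\<^sup>2 \<noteq> 0" by (metis add_pos_nonneg less_irrefl zero_le_power2 zero_less_one)
          then show ?thesis by (simp add: field_simps)
        qed
        finally show "inverse (1 + (y t / x t)\<^sup>2) * w \<le> - 1 / 4" .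
      qed simp
      then have "\<theta> (s + 16) \<le> \<theta> s - 4" by simp
      moreover have "\<theta> s < pi / 2" "- (pi / 2) < \<theta> (s + 16)" unfolding \<theta>_def
        using arctan_ubound[of "y s / x s"] arctan_lbound[of "y (s + 16) / x (s + 16)"] by auto
      ultimately show False using pi_less_4 by linarith
    qed
    then obtain g where g: "\<And>i. i < k \<Longrightarrow> 17 * real i \<le> g i \<and> g i \<le> 17 * real i + 16 \<and> x (g i) = 0"
      by metis
    have "inj_on g {..<k}"
    proof (rule linorder_inj_onI')
      fix i j assume "i \<in> {..<k}" "j \<in> {..<k}" "i < j"
      then show "g i \<noteq> g j" using g[of i] g[of j] by (auto dest: order_antisym)
    qed
    moreover have "g ` {..<k} \<subseteq> zeros x"
    proof
      fix t assume "t \<in> g ` {..<k}"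
      then obtain i where i: "i < k" "t = g i" by auto
      then have "0 \<le> t" "x t = 0" using g[of i] by auto
      then show "t \<in> zeros x" using pos by (cases "t = 0") (auto simp: zeros_def)
    qed
    ultimately have "card {..<k} \<le> card (zeros x)"
      by (rule card_inj_on_le) (rule finite_zeros[OF z pos])
    then show ?thesis by simp
  qed
  then show ?thesis by blast
qed

section \<open>The shooting argument\<close>

text \<open>
  \<open>D k\<close> is the infimum of the parameters whose orbits have more than \<open>k\<close> zeroes. The lower bound in
  \<open>zero_count_semicontinuous\<close> shows that the infimum is not attained, the upper bound that the orbit at \<open>D k\<close> is fast
  and has exactly \<open>k\<close> zeroes. Between two such parameters there is no fast orbit, because the number of zeroes
  would increase immediately after it.
\<close>

theorem shooting:
  fixes xs ys :: "real \<Rightarrow> real \<Rightarrow> real"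
  assumes dstar: "0 < dstar"
    and z: "\<And>d. 0 < d \<Longrightarrow> d < dstar \<Longrightarrow> traj (xs d) (ys d)"
    and pos: "\<And>d. 0 < d \<Longrightarrow> d < dstar \<Longrightarrow> 0 < xs d 0"
    and out: "\<And>d d'. 0 < d \<Longrightarrow> d < d' \<Longrightarrow> d' < dstar \<Longrightarrow> outside (xs d) (ys d) (xs d') (ys d')"
    and contx: "\<And>d. 0 < d \<Longrightarrow> d < dstar \<Longrightarrow> isCont (\<lambda>d. xs d 0) d"
    and conty: "\<And>d. 0 < d \<Longrightarrow> d < dstar \<Longrightarrow> isCont (\<lambda>d. ys d 0) d"
    and large: "\<And>R. \<exists>d. 0 < d \<and> d < dstar \<and> R \<le> energy (xs d 0) (ys d 0)"
    and small: "\<exists>d. 0 < d \<and> d < dstar \<and> energy (xs d 0) (ys d 0) < 0"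
  shows "\<exists>D. strict_mono D \<and> (\<forall>k::nat. 0 < D k \<and> D k < dstar \<and> fast (xs (D k)) (ys (D k))
      \<and> card (zeros (xs (D k))) = k) \<and>
     (\<forall>d. 0 < d \<and> d < D 0 \<longrightarrow> \<not> fast (xs d) (ys d) \<and> card (zeros (xs d)) = 0) \<and>
     (\<forall>k d. D k < d \<and> d < D (Suc k) \<longrightarrow> \<not> fast (xs d) (ys d) \<and> card (zeros (xs d)) = Suc k)"
proof -
  define N where "N d = card (zeros (xs d))" for d
  have fin: "finite (zeros (xs d))" if "0 < d" "d < dstar" for d
    using finite_zeros[OF z[OF that] pos[OF that]] .
  have mono: "N d \<le> N d'" "fast (xs d) (ys d) \<Longrightarrow> N d < N d'" if "0 < d" "d < d'" "d' < dstar" for d d'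
    using zero_count_outside[OF z z out fin fin, of d d'] that by (auto simp: N_def)
  have semi: "\<exists>\<delta>>0. \<forall>d'. 0 < d' \<longrightarrow> d' < dstar \<longrightarrow> \<bar>d' - d\<bar> < \<delta> \<longrightarrow>
      N d \<le> N d' \<and> N d' \<le> N d + (if fast (xs d) (ys d) then 1 else 0)" if d: "0 < d" "d < dstar" for d
  proof -
    obtain \<epsilon> where e: "\<epsilon> > 0" "\<And>x' y'. traj x' y' \<Longrightarrow> 0 < x' 0 \<Longrightarrow> \<bar>x' 0 - xs d 0\<bar> < \<epsilon> \<Longrightarrow> \<bar>y' 0 - ys d 0\<bar> < \<epsilon> \<Longrightarrow>
      card (zeros (xs d)) \<le> card (zeros x') \<and> card (zeros x') \<le> card (zeros (xs d)) + (if fast (xs d) (ys d) then 1 else 0)"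
      using zero_count_semicontinuous[OF z[OF d] pos[OF d]] by meson
    obtain \<delta>1 where d1: "\<delta>1 > 0" "\<And>d'. dist d' d < \<delta>1 \<Longrightarrow> dist (xs d' 0) (xs d 0) < \<epsilon>"
      using contx[OF d] e(1) unfolding continuous_at_eps_delta by (auto simp: dist_real_def) 
    obtain \<delta>2 where d2: "\<delta>2 > 0" "\<And>d'. dist d' d < \<delta>2 \<Longrightarrow> dist (ys d' 0) (ys d 0) < \<epsilon>"
      using conty[OF d] e(1) unfolding continuous_at_eps_delta by (auto simp: dist_real_def)
    have "N d \<le> N d' \<and> N d' \<le> N d + (if fast (xs d) (ys d) then 1 else 0)"
      if "0 < d'" "d' < dstar" "\<bar>d' - d\<bar> < min \<delta>1 \<delta>2" for d'
      unfolding N_def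
      by (rule e(2)[OF z pos]) (use that d1(2)[of d'] d2(2)[of d'] in \<open>auto simp: dist_real_def\<close>)
    then show ?thesis using d1(1) d2(1) by (intro exI[of _ "min \<delta>1 \<delta>2"]) auto
  qed
  define S where "S k = {d. 0 < d \<and> d < dstar \<and> k < N d}" for k
  define D where "D k = Inf (S k)" for k
  have ne: "S k \<noteq> {}" for k
  proof -
    obtain R where R: "\<And>x y. traj x y \<Longrightarrow> 0 < x 0 \<Longrightarrow> R \<le> energy (x 0) (y 0) \<Longrightarrow> Suc k \<le> card (zeros x)"
      using many_zeros_if_energy_large[of "Suc k"] by meson
    obtain d where d: "0 < d" "d < dstar" "R \<le> energy (xs d 0) (ys d 0)" using large by blast
    then have "Suc k \<le> card (zeros (xs d))" by (intro R[OF z pos]) auto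
    then have "d \<in> S k" using d by (simp add: S_def N_def)
    then show ?thesis by blast
  qed
  have bdd: "bdd_below (S k)" for k by (auto simp: S_def bdd_below_def intro: less_imp_le)
  have above: "k < N d" if "D k < d" "d < dstar" for k d
  proof -
    have "\<exists>s\<in>S k. s < d" using cInf_less_iff[OF ne bdd, of k d] that(1) unfolding D_def by blast
    then obtain s where s: "s \<in> S k" "s < d" by blast
    then show ?thesis using mono(1)[of s d] that by (auto simp: S_def)
  qed
  have below: "N d \<le> k" if "0 < d" "d < D k" "d < dstar" for k d
  proof (rule ccontr)
    assume "\<not> N d \<le> k"
    then have "d \<in> S k" using that by (simp add: S_def)
    then show False using cInf_lower[OF _ bdd, of d k] that by (simp add: D_def)
  qed
  have D_less: "D k < dstar" for k
    using ne[of k] cInf_lower[OF _ bdd, of _ k] by (fastforce simp: S_def D_def)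
  obtain d0 where d0: "0 < d0" "d0 < dstar" "energy (xs d0 0) (ys d0 0) < 0" using small by blast
  have "N d0 = 0"
  proof -
    have "zeros (xs d0) = {}"
    proof (rule ccontr)
      assume "zeros (xs d0) \<noteq> {}"
      then obtain t where "0 < t" "xs d0 t = 0" by (auto simp: zeros_def)
      then have "0 \<le> t" by simp
      then have "0 \<le> energy (xs d0 t) (ys d0 t)" using \<open>xs d0 t = 0\<close> by (simp add: energy_def)
      then show False using energy_antimono[OF z[OF d0(1,2)] order_refl \<open>0 \<le> t\<close>] d0(3) by linarith
    qed
    then show ?thesis by (simp add: N_def)
  qed
  have D_ge: "d0 \<le> D k" for k
    using above[of k d0] \<open>N d0 = 0\<close> d0(2) by (force simp: not_le[symmetric])
  have D_pos: "0 < D k" for k using D_ge[of k] d0(1) by simp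
  have right: "\<exists>d. D k < d \<and> d < b" if "D k < b" for k and b :: real using dense that by blast
  have at: "fast (xs (D k)) (ys (D k)) \<and> N (D k) = k" for k
  proof -
    obtain \<delta> where d: "\<delta> > 0" "\<And>d'. 0 < d' \<Longrightarrow> d' < dstar \<Longrightarrow> \<bar>d' - D k\<bar> < \<delta> \<Longrightarrow>
        N (D k) \<le> N d' \<and> N d' \<le> N (D k) + (if fast (xs (D k)) (ys (D k)) then 1 else 0)"
      using semi[OF D_pos D_less] by meson
    define l where "l = D k - min (\<delta> / 2) (D k / 2)"
    have "0 < l" "l < D k" "\<bar>l - D k\<bar> < \<delta>" using d(1) D_pos[of k] by (auto simp: l_def min_def)
    then have le: "N (D k) \<le> k" using d(2)[of l] below[of l k] D_less[of k] by force
    define r where "r = D k + min (\<delta> / 2) ((dstar - D k) / 2)"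
    have r: "D k < r" "r < dstar" "\<bar>r - D k\<bar> < \<delta>"
      using d(1) D_less[of k] by (auto simp: r_def min_def field_simps)
    then have "k < N r" "N r \<le> N (D k) + (if fast (xs (D k)) (ys (D k)) then 1 else 0)"
      using above[of k r] d(2)[of r] D_pos[of k] by auto
    then show ?thesis using le by (auto split: if_splits)
  qed
  have "D k < D (Suc k)" for k
  proof -
    have "D (Suc k) \<in> S k" using at[of "Suc k"] D_pos D_less by (simp add: S_def)
    then have "D k \<le> D (Suc k)" unfolding D_def[of k] by (intro cInf_lower bdd)
    moreover have "D k \<noteq> D (Suc k)" using at[of k] at[of "Suc k"] by force
    ultimately show ?thesis by simp
  qed
  then have sm: "strict_mono D" by (simp add: strict_mono_Suc_iff)
  have between: "\<not> fast (xs d) (ys d)" if d: "0 < d" "d < D k" "k \<le> N d" for d k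
  proof
    assume f: "fast (xs d) (ys d)"
    obtain d' where d': "d < d'" "d' < D k" using dense d(2) by blast
    then have "N d < N d'" using mono(2)[OF d(1) d'(1) _ f] D_less[of k] by simp
    moreover have "N d' \<le> k" using below[of d' k] d d' D_less[of k] by simp
    ultimately show False using d(3) by simp
  qed
  have first: "\<not> fast (xs d) (ys d) \<and> N d = 0" if "0 < d" "d < D 0" for d
    using below[of d 0] between[of d 0] that D_less[of 0] by simp
  have succ: "\<not> fast (xs d) (ys d) \<and> N d = Suc k" if "D k < d" "d < D (Suc k)" for d k
  proof -
    have "0 < d" "d < dstar" using that D_pos[of k] D_less[of "Suc k"] by auto
    then have "N d = Suc k" using above[of k d] below[of d "Suc k"] that by simp
    then show ?thesis using between[of d "Suc k"] that \<open>0 < d\<close> by simp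
  qed
  show ?thesis
    using sm D_pos D_less at first succ unfolding N_def by (intro exI[of _ D]) auto
qed

end

section \<open>Existence of solutions of the radial equation\<close>

lemma continuous_on_half_line:
  fixes g :: "real \<Rightarrow> real"
  assumes "\<And>b. continuous_on {0..b} g"
  shows "continuous_on {0..} g"
  unfolding continuous_on_eq_continuous_within
proof
  fix s :: real assume s: "s \<in> {0..}"
  have "at s within {0..} = at s within {0..s + 1}"
    by (rule at_within_nhd[of _ "{..<s + 1}"]) auto
  moreover have "continuous (at s within {0..s + 1}) g"
    using assms[of "s + 1"] s by (simp add: continuous_on_eq_continuous_within)
  ultimately show "continuous (at s within {0..}) g" by simp
qed

lemma integral_exp_le:
  fixes \<mu> b :: real
  assumes "0 < \<mu>" "0 \<le> b"
  shows "integral {0..b} (\<lambda>s. exp (\<mu> * s)) \<le> exp (\<mu> * b) / \<mu>"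
proof -
  have "((\<lambda>s. exp (\<mu> * s)) has_integral (exp (\<mu> * b) / \<mu> - exp (\<mu> * 0) / \<mu>)) {0..b}"
  proof (rule fundamental_theorem_of_calculus[OF assms(2)])
    fix x assume "x \<in> {0..b}"
    have "((\<lambda>s. exp (\<mu> * s) / \<mu>) has_real_derivative exp (\<mu> * x)) (at x within {0..b})"
      using assms by (auto intro!: derivative_eq_intros)
    then show "((\<lambda>s. exp (\<mu> * s) / \<mu>) has_vector_derivative exp (\<mu> * x)) (at x within {0..b})"
      by (simp add: has_real_derivative_iff_has_vector_derivative)
  qed
  then show ?thesis using assms by (simp add: integral_unique)
qed

locale radial =
  fixes n :: nat and q K1 K2 :: real
  assumes n_ge_3: "3 \<le> n" and q_large: "q > 2 * real n / (real n - 2)"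
    and K1_neg: "K1 < 0" and K2_pos: "0 < K2"
begin

lemma q_gt_2: "2 < q"
proof -
  have "2 < 2 * real n / (real n - 2)" using n_ge_3 by (simp add: field_simps)
  then show ?thesis using q_large by simp
qed

text \<open>
  Regular solutions on \<open>[0, R]\<close> for a general nonlinearity \<open>\<phi>\<close>, which is later the power nonlinearity or a
  truncation of it; \<open>v\<close> is the derivative of \<open>u\<close>.
\<close>

definition rad :: "(real \<Rightarrow> real) \<Rightarrow> real \<Rightarrow> (real \<Rightarrow> real) \<Rightarrow> (real \<Rightarrow> real) \<Rightarrow> bool" where
  "rad \<phi> R u v \<longleftrightarrow> continuous_on {0..R} v \<and>
     (\<forall>r\<in>{0..R}. (u has_real_derivative v r) (at r within {0..R})) \<and> v 0 = 0 \<and>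
     (\<forall>r. 0 < r \<longrightarrow> r < R \<longrightarrow> r \<noteq> 1 \<longrightarrow>
        (v has_real_derivative - ((real n - 1) / r) * v r - k_coeff K1 K2 r * \<phi> (u r)) (at r))"

text \<open>
  This is the integral of \<open>\<sigma>\<^bsup>n-1\<^esup> k(\<sigma>) h(\<sigma>)\<close> over \<open>[0, s]\<close>. The jump of \<open>k\<close> is moved into the upper limit of the second
  integral, so that both integrands are continuous.
\<close>

definition weighted_integral :: "(real \<Rightarrow> real) \<Rightarrow> real \<Rightarrow> real" where
  "weighted_integral h s = K2 * integral {0..s} (\<lambda>\<sigma>. \<sigma> ^ (n - 1) * h \<sigma>)
     + (K1 - K2) * integral {0..min s 1} (\<lambda>\<sigma>. \<sigma> ^ (n - 1) * h \<sigma>)"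

text \<open>
  For \<open>h = \<phi> \<circ> u\<close> this is the derivative of the solution \<open>u\<close>, obtained by integrating
  \<open>(r\<^bsup>n-1\<^esup> u')' = -r\<^bsup>n-1\<^esup> k \<phi>(u)\<close> once. At \<open>s = 0\<close> the quotient is \<open>0/0\<close>, which has the value \<open>0\<close> as required.
\<close>

definition slope :: "(real \<Rightarrow> real) \<Rightarrow> real \<Rightarrow> real" where
  "slope h s = - weighted_integral h s / s ^ (n - 1)"

definition kap where "kap = \<bar>K2\<bar> + \<bar>K1 - K2\<bar>"

lemma kap_pos: "0 < kap" using K2_pos by (simp add: kap_def add_pos_nonneg)

lemma weighted_integral_bound:
  assumes h: "continuous_on UNIV h" and g: "continuous_on UNIV g" and "0 \<le> s"
    and le: "\<And>\<sigma>. 0 \<le> \<sigma> \<Longrightarrow> \<sigma> \<le> s \<Longrightarrow> \<bar>h \<sigma>\<bar> \<le> g \<sigma>"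
  shows "\<bar>weighted_integral h s\<bar> \<le> kap * (s ^ (n - 1) * integral {0..s} g)"
proof -
  have cont: "continuous_on S h" "continuous_on S g" for S using h g continuous_on_subset by blast+
  have gi: "g integrable_on {0..a}" for a by (intro integrable_continuous_interval cont)
  have one: "\<bar>integral {0..a} (\<lambda>\<sigma>. \<sigma> ^ (n - 1) * h \<sigma>)\<bar> \<le> s ^ (n - 1) * integral {0..s} g"
      if a: "0 \<le> a" "a \<le> s" for a
  proof -
    have "norm (integral {0..a} (\<lambda>\<sigma>. \<sigma> ^ (n - 1) * h \<sigma>)) \<le> integral {0..a} (\<lambda>\<sigma>. s ^ (n - 1) * g \<sigma>)"
    proof (rule integral_norm_bound_integral)
      show "(\<lambda>\<sigma>. \<sigma> ^ (n - 1) * h \<sigma>) integrable_on {0..a}" "(\<lambda>\<sigma>. s ^ (n - 1) * g \<sigma>) integrable_on {0..a}"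
        by (intro integrable_continuous_interval continuous_intros cont)+
      fix \<sigma> assume \<sigma>: "\<sigma> \<in> {0..a}"
      then have "\<sigma> ^ (n - 1) * \<bar>h \<sigma>\<bar> \<le> s ^ (n - 1) * g \<sigma>"
        using a le[of \<sigma>] by (intro mult_mono power_mono) auto
      then show "norm (\<sigma> ^ (n - 1) * h \<sigma>) \<le> s ^ (n - 1) * g \<sigma>" using \<sigma> by (simp add: abs_mult)
    qed
    also have "\<dots> = s ^ (n - 1) * integral {0..a} g" by simp
    also have "integral {0..a} g \<le> integral {0..s} g"
    proof (rule integral_subset_le[OF _ gi gi])
      show "\<forall>\<sigma>\<in>{0..s}. 0 \<le> g \<sigma>" proof
        fix \<sigma> assume "\<sigma> \<in> {0..s}"
        then show "0 \<le> g \<sigma>" using le[of \<sigma>] abs_ge_zero[of "h \<sigma>"] by auto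
      qed
    qed (use a in auto)
    then have "s ^ (n - 1) * integral {0..a} g \<le> s ^ (n - 1) * integral {0..s} g"
      using assms(3) by (intro mult_left_mono) auto
    finally show ?thesis by simp
  qed
  have "\<bar>weighted_integral h s\<bar> \<le> \<bar>K2\<bar> * \<bar>integral {0..s} (\<lambda>\<sigma>. \<sigma> ^ (n - 1) * h \<sigma>)\<bar>
     + \<bar>K1 - K2\<bar> * \<bar>integral {0..min s 1} (\<lambda>\<sigma>. \<sigma> ^ (n - 1) * h \<sigma>)\<bar>"
    unfolding weighted_integral_def abs_mult[symmetric] by (rule abs_triangle_ineq)
  also have "\<dots> \<le> \<bar>K2\<bar> * (s ^ (n - 1) * integral {0..s} g) + \<bar>K1 - K2\<bar> * (s ^ (n - 1) * integral {0..s} g)"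
    using one[of s] one[of "min s 1"] assms(3) by (intro add_mono mult_left_mono) auto
  finally show ?thesis by (simp add: kap_def algebra_simps)
qed

text \<open>
  The weight \<open>\<sigma>\<^bsup>n-1\<^esup> \<le> s\<^bsup>n-1\<^esup>\<close> cancels the singular factor, so the equation behaves like a regular Volterra
  equation of second order.
\<close>

lemma slope_bound:
  assumes h: "continuous_on UNIV h" and g: "continuous_on UNIV g" and "0 \<le> s"
    and le: "\<And>\<sigma>. 0 \<le> \<sigma> \<Longrightarrow> \<sigma> \<le> s \<Longrightarrow> \<bar>h \<sigma>\<bar> \<le> g \<sigma>"
  shows "\<bar>slope h s\<bar> \<le> kap * integral {0..s} g"
proof (cases "s = 0")
  case True
  then show ?thesis by (simp add: slope_def weighted_integral_def)
next
  case False
  then have s: "0 < s ^ (n - 1)" using assms(3) by simp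
  have "\<bar>slope h s\<bar> = \<bar>weighted_integral h s\<bar> / s ^ (n - 1)" using s by (simp add: slope_def abs_divide)
  also have "\<dots> \<le> (kap * (s ^ (n - 1) * integral {0..s} g)) / s ^ (n - 1)"
    by (rule divide_right_mono[OF weighted_integral_bound[OF assms]]) (use s in auto)
  also have "\<dots> = kap * integral {0..s} g" using s by simp
  finally show ?thesis .
qed

lemma weighted_integral_diff:
  assumes "continuous_on UNIV h" "continuous_on UNIV h'"
  shows "weighted_integral h s - weighted_integral h' s = weighted_integral (\<lambda>\<sigma>. h \<sigma> - h' \<sigma>) s"
proof -
  have cont: "continuous_on S h" "continuous_on S h'" for S using assms continuous_on_subset by blast+
  have eq: "integral {0..a} (\<lambda>\<sigma>. \<sigma> ^ (n - 1) * (h \<sigma> - h' \<sigma>))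
     = integral {0..a} (\<lambda>\<sigma>. \<sigma> ^ (n - 1) * h \<sigma>) - integral {0..a} (\<lambda>\<sigma>. \<sigma> ^ (n - 1) * h' \<sigma>)" for a
    unfolding right_diff_distrib
    by (rule integral_diff; intro integrable_continuous_interval continuous_intros cont)
  show ?thesis unfolding weighted_integral_def eq by (simp add: algebra_simps)
qed

lemma slope_diff:
  assumes "continuous_on UNIV h" "continuous_on UNIV h'"
  shows "slope h s - slope h' s = slope (\<lambda>\<sigma>. h \<sigma> - h' \<sigma>) s"
  unfolding slope_def weighted_integral_diff[OF assms, symmetric] by (simp add: diff_divide_distrib)

lemma slope_0: "slope h 0 = 0"
  using n_ge_3 by (simp add: slope_def)

lemma continuous_weighted_integral:
  assumes "continuous_on UNIV h"
  shows "continuous_on {0..b} (weighted_integral h)"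
proof -
  have cont: "continuous_on S h" for S using assms continuous_on_subset by blast
  define J where "J = (\<lambda>s. integral {0..s} (\<lambda>\<sigma>. \<sigma> ^ (n - 1) * h \<sigma>))"
  have cJ: "continuous_on {0..c} J" for c unfolding J_def
    by (intro indefinite_integral_continuous_1 integrable_continuous_interval continuous_intros cont)
  have "continuous_on {0..b} (\<lambda>s. J (min s 1))"
    by (rule continuous_on_compose2[OF cJ[of 1]]) (auto intro!: continuous_intros)
  then have "continuous_on {0..b} (\<lambda>s. K2 * J s + (K1 - K2) * J (min s 1))"
    by (intro continuous_intros cJ)
  then show ?thesis by (simp add: weighted_integral_def J_def)
qed

lemma continuous_slope:
  assumes h: "continuous_on UNIV h" and bd: "\<And>\<sigma>. \<bar>h \<sigma>\<bar> \<le> \<Phi> \<sigma>" "continuous_on UNIV \<Phi>"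
  shows "continuous_on {0..b} (slope h)"
  unfolding continuous_on_eq_continuous_within
proof
  fix s assume s: "s \<in> {0..b}"
  show "continuous (at s within {0..b}) (slope h)"
  proof (cases "s = 0")
    case False
    then show ?thesis unfolding slope_def using s continuous_weighted_integral[OF h, of b]
      by (intro continuous_intros) (auto simp: continuous_on_eq_continuous_within)
  next
    case True
    have int: "\<Phi> integrable_on {0..b}"
      by (intro integrable_continuous_interval continuous_on_subset[OF bd(2)]) auto
    have "continuous (at 0 within {0..b}) (\<lambda>s. integral {0..s} \<Phi>)"
      using indefinite_integral_continuous_1[OF int] s True by (auto simp: continuous_on_eq_continuous_within)
    then have "((\<lambda>s. kap * integral {0..s} \<Phi>) \<longlongrightarrow> kap * integral {0..0} \<Phi>) (at 0 within {0..b})"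
      unfolding continuous_within by (intro tendsto_intros)
    then have "((\<lambda>s. kap * integral {0..s} \<Phi>) \<longlongrightarrow> 0) (at 0 within {0..b})" by simp
    then have "(slope h \<longlongrightarrow> 0) (at 0 within {0..b})"
      by (rule Lim_null_comparison[rotated])
         (auto simp: eventually_at_filter intro!: always_eventually slope_bound[OF h bd(2)] bd(1))
    then show ?thesis using True by (simp add: continuous_within slope_0)
  qed
qed

lemma slope_deriv:
  assumes h: "continuous_on UNIV h" and s: "0 < s" "s \<noteq> 1"
  shows "(slope h has_real_derivative - ((real n - 1) / s) * slope h s - k_coeff K1 K2 s * h s) (at s)"
proof -
  have cont: "continuous_on S h" for S using assms continuous_on_subset by blast
  define w where "w = (\<lambda>\<sigma>. \<sigma> ^ (n - 1) * h \<sigma>)"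
  have cw: "continuous_on S w" for S unfolding w_def by (intro continuous_intros cont)
  have dJ: "((\<lambda>s. integral {0..s} w) has_real_derivative w t) (at t)" if "0 < t" for t
    using integral_has_real_derivative[OF cw, of t 0 "t + 1"] that
    by (simp add: at_within_interior[of t "{0..t + 1}"])
  have dmin: "((\<lambda>s. integral {0..min s 1} w) has_real_derivative (if s < 1 then w s else 0)) (at s)"
  proof (cases "s < 1")
    case True
    have "eventually (\<lambda>t. t < 1) (nhds s)" using True eventually_nhds_in_open[of "{..<1}" s] by simp
    then have "eventually (\<lambda>t. integral {0..min t 1} w = integral {0..t} w) (nhds s)"
      by eventually_elim (simp add: min_def)
    then have "((\<lambda>s. integral {0..min s 1} w) has_real_derivative w s) (at s)"
      using dJ[OF s(1)] by (subst DERIV_cong_ev[OF refl _ refl])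
    then show ?thesis using True by simp
  next
    case False
    then have s1: "1 < s" using s by simp
    have "eventually (\<lambda>t. 1 < t) (nhds s)" using s1 eventually_nhds_in_open[of "{1<..}" s] by simp
    then have ev: "eventually (\<lambda>t. integral {0..min t 1} w = integral {0..1} w) (nhds s)"
      by eventually_elim (simp add: min_def)
    have "((\<lambda>s. integral {0..min s 1} w) has_real_derivative 0) (at s)"
      by (simp add: DERIV_cong_ev[OF refl ev refl])
    then show ?thesis using False by simp
  qed
  have dI: "(weighted_integral h has_real_derivative k_coeff K1 K2 s * w s) (at s)"
  proof -
    have "((\<lambda>s. K2 * integral {0..s} w + (K1 - K2) * integral {0..min s 1} w) has_real_derivative
       K2 * w s + (K1 - K2) * (if s < 1 then w s else 0)) (at s)"
      by (intro DERIV_add DERIV_cmult dJ[OF s(1)] dmin)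
    moreover have "K2 * w s + (K1 - K2) * (if s < 1 then w s else 0) = k_coeff K1 K2 s * w s"
      using s by (auto simp: k_coeff_def algebra_simps)
    moreover have "weighted_integral h = (\<lambda>s. K2 * integral {0..s} w + (K1 - K2) * integral {0..min s 1} w)"
      by (auto simp: weighted_integral_def w_def)
    ultimately show ?thesis by simp
  qed
  have pw: "((\<lambda>s. s ^ (n - 1)) has_real_derivative real (n - 1) * s ^ (n - 2)) (at s)"
    using DERIV_pow[of "n - 1" s] n_ge_3 by (simp add: numeral_eq_Suc)
  have np: "s ^ (n - 1) \<noteq> 0" using s by simp
  have "((\<lambda>s. - weighted_integral h s / s ^ (n - 1)) has_real_derivative
     (- (k_coeff K1 K2 s * w s) * s ^ (n - 1) - - weighted_integral h s * (real (n - 1) * s ^ (n - 2)))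
       / (s ^ (n - 1) * s ^ (n - 1))) (at s)"
    by (rule DERIV_divide[OF DERIV_minus[OF dI] pw np])
  moreover have "(- (k_coeff K1 K2 s * w s) * s ^ (n - 1) - - weighted_integral h s * (real (n - 1) * s ^ (n - 2)))
       / (s ^ (n - 1) * s ^ (n - 1)) = - ((real n - 1) / s) * slope h s - k_coeff K1 K2 s * h s"
  proof -
    have e: "s ^ (n - 1) = s * s ^ (n - 2)"
    proof -
      have "n - 1 = Suc (n - 2)" using n_ge_3 by simp
      then show ?thesis by simp
    qed
    have "s ^ (n - 2) \<noteq> 0" using s by simp
    then show ?thesis using s n_ge_3 unfolding slope_def w_def e by (simp add: field_simps of_nat_diff)
  qed
  ultimately show ?thesis unfolding slope_def[abs_def] by simp
qed

text \<open>
  Integrating \<open>slope\<close> once more gives the fixed point equation \<open>u = T u\<close>. For functions of the form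
  \<open>u(r) = e\<^bsup>\<mu>r\<^esup> p(r)\<close> with \<open>p\<close> bounded, the two integrations gain a factor \<open>1/\<mu>\<^sup>2\<close>; for large \<open>\<mu>\<close> the map is a
  contraction in the supremum norm of \<open>p\<close>, on the whole half-line at once.
\<close>

lemma picard_existence:
  assumes bd: "\<And>x. \<bar>\<phi> x\<bar> \<le> \<Phi>" and lip: "\<And>x y. \<bar>\<phi> x - \<phi> y\<bar> \<le> L * \<bar>x - y\<bar>"
  shows "\<exists>u v. u 0 = d \<and> (\<forall>R>0. rad \<phi> R u v)"
proof -
  have L0: "0 \<le> L" using lip[of 0 1] by (simp add: order_trans[OF abs_ge_zero])
  have Phi0: "0 \<le> \<Phi>" using bd[of 0] by (simp add: order_trans[OF abs_ge_zero])
  define \<mu> where "\<mu> = 1 + 2 * (kap * L)"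
  have kL: "0 \<le> kap * L" using kap_pos L0 by simp
  have mu: "1 \<le> \<mu>" using kL by (simp add: \<mu>_def)
  have c\<phi>: "continuous_on UNIV (\<lambda>r. \<phi> (u r))" if "continuous_on UNIV u" for u
  proof -
    have "L-lipschitz_on UNIV \<phi>" using lip L0 by (auto simp: lipschitz_on_def dist_real_def)
    then have "continuous_on UNIV \<phi>" by (rule lipschitz_on_continuous_on)
    then show ?thesis using that by (rule continuous_on_compose2) simp
  qed
  define U where "U = (\<lambda>(p :: real \<Rightarrow>\<^sub>C real) r. exp (\<mu> * r) * apply_bcontfun p r)"
  have cU: "continuous_on UNIV (U p)" for p unfolding U_def by (intro continuous_intros) auto
  define V where "V = (\<lambda>p. slope (\<lambda>r. \<phi> (U p r)))"
  have cV: "continuous_on {0..b} (V p)" for b p unfolding V_def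
    by (rule continuous_slope[OF c\<phi>[OF cU], where \<Phi> = "\<lambda>_. \<Phi>"]) (auto simp: bd)
  define T where "T = (\<lambda>p r. d + integral {0..r} (V p))"
  have dT: "(T p has_real_derivative V p r) (at r within {0..R})" if "r \<in> {0..R}" for p r R
    unfolding T_def using DERIV_add[OF DERIV_const integral_has_real_derivative[OF cV that]] by simp
  have cT: "continuous_on {0..} (T p)" for p
  proof (rule continuous_on_half_line)
    show "continuous_on {0..b} (T p)" for b
      unfolding continuous_on_eq_continuous_within using dT DERIV_continuous by blast
  qed
  have V_le: "\<bar>V p s\<bar> \<le> kap * \<Phi> * s" if "0 \<le> s" for p s
  proof -
    have "\<bar>V p s\<bar> \<le> kap * integral {0..s} (\<lambda>_. \<Phi>)" unfolding V_def
      by (rule slope_bound[OF c\<phi>[OF cU] _ that]) (auto simp: bd)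
    then show ?thesis using that by (simp add: mult.commute mult.left_commute)
  qed
  have T_le: "\<bar>T p r\<bar> \<le> \<bar>d\<bar> + kap * \<Phi> * r\<^sup>2" if "0 \<le> r" for p r
  proof -
    have "norm (integral {0..r} (V p)) \<le> integral {0..r} (\<lambda>_. kap * \<Phi> * r)"
    proof (rule integral_norm_bound_integral)
      show "V p integrable_on {0..r}" by (rule integrable_continuous_interval[OF cV])
      fix s assume s: "s \<in> {0..r}"
      have "kap * \<Phi> * s \<le> kap * \<Phi> * r" using s kap_pos Phi0 by (intro mult_left_mono) auto
      then show "norm (V p s) \<le> kap * \<Phi> * r" using V_le[of s p] s by auto
    qed auto
    also have "\<dots> = kap * \<Phi> * r\<^sup>2" using that by (simp add: power2_eq_square)
    finally show ?thesis unfolding T_def by (smt (verit) real_norm_def)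
  qed
  \<comment> \<open>The argument is clamped at \<open>0\<close> only because bounded continuous functions live on the whole line.\<close>
  define F where "F = (\<lambda>p r. exp (- \<mu> * max r 0) * T p (max r 0))"
  have F_mem: "F p \<in> bcontfun" for p
  proof (rule bcontfun_normI)
    have "continuous_on UNIV (\<lambda>r. T p (max r 0))"
      by (rule continuous_on_compose2[OF cT]) (auto intro!: continuous_intros)
    then show "continuous_on UNIV (F p)" unfolding F_def by (intro continuous_intros)
    show "norm (F p r) \<le> \<bar>d\<bar> + kap * \<Phi> * 2" for r
    proof -
      define \<rho> where "\<rho> = max r 0"
      have r: "0 \<le> \<rho>" by (simp add: \<rho>_def)
      have "\<rho>\<^sup>2 / 2 \<le> exp \<rho>" using exp_lower_Taylor_quadratic[OF r] r by linarith
      also have "\<dots> \<le> exp (\<mu> * \<rho>)" using mu mult_right_mono[OF mu r] by simp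
      finally have "exp (- \<mu> * \<rho>) * \<rho>\<^sup>2 \<le> exp (- \<mu> * \<rho>) * (2 * exp (\<mu> * \<rho>))"
        by (intro mult_left_mono) auto
      also have "\<dots> = 2 * (exp (- \<mu> * \<rho>) * exp (\<mu> * \<rho>))" by simp
      also have "\<dots> = 2" by (simp only: exp_add[symmetric]) simp
      finally have a: "exp (- \<mu> * \<rho>) * \<rho>\<^sup>2 \<le> 2" .
      have "norm (F p r) = exp (- \<mu> * \<rho>) * \<bar>T p \<rho>\<bar>" by (simp add: F_def \<rho>_def abs_mult)
      also have "\<dots> \<le> exp (- \<mu> * \<rho>) * (\<bar>d\<bar> + kap * \<Phi> * \<rho>\<^sup>2)" using T_le[OF r] by (intro mult_left_mono) auto
      also have "\<dots> = exp (- \<mu> * \<rho>) * \<bar>d\<bar> + kap * \<Phi> * (exp (- \<mu> * \<rho>) * \<rho>\<^sup>2)" by (simp add: algebra_simps)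
      also have "\<dots> \<le> 1 * \<bar>d\<bar> + kap * \<Phi> * 2"
        using a kap_pos Phi0 mu r by (intro add_mono mult_right_mono mult_left_mono) auto
      finally show ?thesis by simp
    qed
  qed
  define Op where "Op = (\<lambda>p. Bcontfun (F p))"
  have Op: "apply_bcontfun (Op p) = F p" for p unfolding Op_def by (rule Bcontfun_inverse[OF F_mem])
  have contr: "dist (Op p) (Op p') \<le> (1 / 2) * dist p p'" for p p'
  proof (rule dist_bound)
    fix r :: real
    define \<rho> where "\<rho> = max r 0"
    define D where "D = dist p p'"
    have D0: "0 \<le> D" by (simp add: D_def)
    have r: "0 \<le> \<rho>" by (simp add: \<rho>_def)
    have Udiff: "\<bar>\<phi> (U p \<sigma>) - \<phi> (U p' \<sigma>)\<bar> \<le> L * D * exp (\<mu> * \<sigma>)" for \<sigma>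
    proof -
      have "\<bar>U p \<sigma> - U p' \<sigma>\<bar> = exp (\<mu> * \<sigma>) * \<bar>p \<sigma> - p' \<sigma>\<bar>"
        unfolding U_def right_diff_distrib[symmetric] by (simp add: abs_mult)
      also have "\<dots> \<le> exp (\<mu> * \<sigma>) * D"
        using dist_bounded[of p \<sigma> p'] by (intro mult_left_mono) (auto simp: D_def dist_real_def)
      finally have "L * \<bar>U p \<sigma> - U p' \<sigma>\<bar> \<le> L * (exp (\<mu> * \<sigma>) * D)" using L0 by (intro mult_left_mono) auto
      then show ?thesis using lip[of "U p \<sigma>" "U p' \<sigma>"] by (simp add: algebra_simps)
    qed
    have Vdiff: "\<bar>V p s - V p' s\<bar> \<le> kap * L * D / \<mu> * exp (\<mu> * s)" if s: "0 \<le> s" for s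
    proof -
      have "\<bar>V p s - V p' s\<bar> \<le> kap * integral {0..s} (\<lambda>\<sigma>. L * D * exp (\<mu> * \<sigma>))"
        unfolding V_def slope_diff[OF c\<phi>[OF cU] c\<phi>[OF cU]]
        by (rule slope_bound[OF _ _ s Udiff]) (intro continuous_intros c\<phi>[OF cU])+
      also have "\<dots> = kap * (L * D * integral {0..s} (\<lambda>\<sigma>. exp (\<mu> * \<sigma>)))" by simp
      also have "\<dots> \<le> kap * (L * D * (exp (\<mu> * s) / \<mu>))"
        using integral_exp_le[of \<mu> s] mu s kap_pos L0 D0 by (intro mult_left_mono) auto
      finally show ?thesis by (simp add: algebra_simps)
    qed
    have "T p \<rho> - T p' \<rho> = integral {0..\<rho>} (\<lambda>s. V p s - V p' s)"
      unfolding T_def by (simp add: integral_diff[OF integrable_continuous_interval[OF cV] integrable_continuous_interval[OF cV]])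
    also have "norm \<dots> \<le> integral {0..\<rho>} (\<lambda>s. kap * L * D / \<mu> * exp (\<mu> * s))"
    proof (rule integral_norm_bound_integral)
      show "(\<lambda>s. V p s - V p' s) integrable_on {0..\<rho>}"
        by (intro integrable_continuous_interval continuous_intros cV)
      show "(\<lambda>s. kap * L * D / \<mu> * exp (\<mu> * s)) integrable_on {0..\<rho>}"
        by (intro integrable_continuous_interval continuous_intros)
    qed (use Vdiff in auto)
    also have "\<dots> = kap * L * D / \<mu> * integral {0..\<rho>} (\<lambda>s. exp (\<mu> * s))" by simp
    also have "\<dots> \<le> kap * L * D / \<mu> * (exp (\<mu> * \<rho>) / \<mu>)"
      using integral_exp_le[of \<mu> \<rho>] mu r kL D0 by (intro mult_left_mono) auto
    finally have Tdiff: "\<bar>T p \<rho> - T p' \<rho>\<bar> \<le> kap * L * D / \<mu> * (exp (\<mu> * \<rho>) / \<mu>)" by simp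
    have half: "kap * L / \<mu> / \<mu> \<le> 1 / 2"
    proof -
      have "\<mu> * 1 \<le> \<mu> * \<mu>" using mu by (intro mult_left_mono) auto
      then have "2 * (kap * L) \<le> \<mu> * \<mu>" by (simp add: \<mu>_def)
      then show ?thesis using mu by (simp add: field_simps)
    qed
    have "dist (Op p r) (Op p' r) = exp (- \<mu> * \<rho>) * \<bar>T p \<rho> - T p' \<rho>\<bar>"
      unfolding Op F_def \<rho>_def[symmetric] dist_real_def right_diff_distrib[symmetric] by (simp add: abs_mult)
    also have "\<dots> \<le> exp (- \<mu> * \<rho>) * (kap * L * D / \<mu> * (exp (\<mu> * \<rho>) / \<mu>))"
      using Tdiff by (intro mult_left_mono) auto
    also have "\<dots> = (kap * L / \<mu> / \<mu>) * D" by (simp add: exp_minus)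
    also have "\<dots> \<le> (1 / 2) * D" using half D0 by (rule mult_right_mono)
    finally show "dist (Op p r) (Op p' r) \<le> (1 / 2) * dist p p'" by (simp add: D_def)
  qed
  obtain p where p: "Op p = p" using banach_fix_type[of "1 / 2" Op] contr by auto
  have fix_eq: "U p r = T p r" if "0 \<le> r" for r
  proof -
    have "p r = F p r" using Op[of p] p by simp
    then show ?thesis using that by (simp add: U_def F_def exp_minus)
  qed
  have "rad \<phi> R (T p) (V p)" if "0 < R" for R
    unfolding rad_def
  proof (intro conjI ballI allI impI)
    show "V p 0 = 0" by (simp add: V_def slope_0)
    fix r :: real assume "0 < r" "r \<noteq> 1"
    then show "(V p has_real_derivative - ((real n - 1) / r) * V p r - k_coeff K1 K2 r * \<phi> (T p r)) (at r)"
      using slope_deriv[OF c\<phi>[OF cU], of r p] fix_eq[of r] by (simp add: V_def)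
  qed (use cV dT in auto)
  moreover have "T p 0 = d" by (simp add: T_def)
  ultimately show ?thesis by blast
qed

section \<open>Uniqueness, continuous dependence and global existence\<close>

abbreviation f where "f \<equiv> odd_power q"

lemma rad_subinterval:
  assumes "rad \<phi> R u v" "R' \<le> R"
  shows "rad \<phi> R' u v"
proof -
  have "(u has_real_derivative v r) (at r within {0..R'})" if "r \<in> {0..R'}" for r
  proof -
    have "(u has_real_derivative v r) (at r within {0..R})" using assms that by (simp add: rad_def)
    then show ?thesis by (rule DERIV_subset) (use assms in auto)
  qed
  moreover have "continuous_on {0..R'} v"
    by (rule continuous_on_subset[of "{0..R}"]) (use assms in \<open>auto simp: rad_def\<close>)
  ultimately show ?thesis using assms unfolding rad_def by simp
qed

lemma rad_cong:
  assumes "rad \<phi> R u v" "\<And>r. 0 < r \<Longrightarrow> r < R \<Longrightarrow> \<phi> (u r) = \<psi> (u r)"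
  shows "rad \<psi> R u v"
  using assms unfolding rad_def by simp

lemma radD:
  assumes "rad \<phi> R u v"
  shows "continuous_on {0..R} u" "continuous_on {0..R} v" "v 0 = 0"
    "0 < r \<Longrightarrow> r < R \<Longrightarrow> (u has_real_derivative v r) (at r)"
    "0 < r \<Longrightarrow> r < R \<Longrightarrow> r \<noteq> 1
        \<Longrightarrow> (v has_real_derivative - ((real n - 1) / r) * v r - k_coeff K1 K2 r * \<phi> (u r)) (at r)"
proof -
  have d: "\<forall>r\<in>{0..R}. (u has_real_derivative v r) (at r within {0..R})" using assms by (simp add: rad_def)
  then show "continuous_on {0..R} u"
    unfolding continuous_on_eq_continuous_within using DERIV_continuous by blast
  show "(u has_real_derivative v r) (at r)" if "0 < r" "r < R"
  proof -
    have "(u has_real_derivative v r) (at r within {0..R})" using d that by simp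
    then show ?thesis using that by (simp add: at_within_interior[of r "{0..R}"])
  qed
qed (use assms in \<open>auto simp: rad_def\<close>)

text \<open>
  Despite the singularity, \<open>(u - w)\<^sup>2 + (v - z)\<^sup>2\<close> satisfies a Gronwall inequality down to \<open>r = 0\<close>, because
  the contribution \<open>-2((n-1)/r)(v - z)\<^sup>2\<close> of the singular term has a favourable sign. At \<open>r = 1\<close>, where \<open>v\<close> is not
  differentiable, the estimates on both sides are put together.
\<close>

lemma rad_gronwall:
  assumes s1: "rad \<phi> R u v" and s2: "rad \<psi> R w z" and L: "0 \<le> L"
    and lip: "\<And>r. 0 < r \<Longrightarrow> r < R \<Longrightarrow> \<bar>\<phi> (u r) - \<psi> (w r)\<bar> \<le> L * \<bar>u r - w r\<bar>"
    and r: "0 \<le> r" "r \<le> R"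
  shows "(u r - w r)\<^sup>2 + (v r - z r)\<^sup>2 \<le> exp ((1 + (\<bar>K1\<bar> + \<bar>K2\<bar>) * L) * r) * (u 0 - w 0)\<^sup>2"
proof -
  define C where "C = 1 + (\<bar>K1\<bar> + \<bar>K2\<bar>) * L"
  define \<rho> where "\<rho> = (\<lambda>r. (u r - w r)\<^sup>2 + (v r - z r)\<^sup>2)"
  have c\<rho>: "continuous_on {a..b} \<rho>" if "0 \<le> a" "b \<le> R" for a b
    unfolding \<rho>_def using that by (intro continuous_intros continuous_on_subset[OF radD(1)[OF s1]]
      continuous_on_subset[OF radD(1)[OF s2]] continuous_on_subset[OF radD(2)[OF s1]] continuous_on_subset[OF radD(2)[OF s2]]) auto
  define \<rho>' where "\<rho>' = (\<lambda>x. 2 * (u x - w x) * (v x - z x) + 2 * (v x - z x) *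
      (- ((real n - 1) / x) * (v x - z x) - k_coeff K1 K2 x * (\<phi> (u x) - \<psi> (w x))))"
  have d\<rho>: "(\<rho> has_real_derivative \<rho>' x) (at x)" if x: "0 < x" "x < R" "x \<noteq> 1" for x
  proof -
    note d = DERIV_power[OF DERIV_diff[OF radD(4)[OF s1 x(1,2)] radD(4)[OF s2 x(1,2)]], of 2]
       DERIV_power[OF DERIV_diff[OF radD(5)[OF s1 x] radD(5)[OF s2 x]], of 2]
    define m where "m = (real n - 1) / x"
    show ?thesis unfolding \<rho>_def \<rho>'_def
      by (rule DERIV_cong[OF DERIV_add[OF d]]) (unfold m_def[symmetric], simp add: algebra_simps)
  qed
  have b: "\<rho>' x \<le> C * \<rho> x" if x: "0 < x" "x < R" for x
  proof -
    define a b c where "a = u x - w x" and "b = v x - z x" and "c = \<phi> (u x) - \<psi> (w x)"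
    have k: "\<bar>k_coeff K1 K2 x\<bar> \<le> \<bar>K1\<bar> + \<bar>K2\<bar>" by (simp add: k_coeff_def)
    have "\<bar>c\<bar> \<le> L * \<bar>a\<bar>" using lip[OF x] by (simp add: a_def c_def)
    then have "\<bar>k_coeff K1 K2 x\<bar> * \<bar>c\<bar> \<le> (\<bar>K1\<bar> + \<bar>K2\<bar>) * (L * \<bar>a\<bar>)"
      using k by (intro mult_mono) auto
    then have "\<bar>b\<bar> * (\<bar>k_coeff K1 K2 x\<bar> * \<bar>c\<bar>) \<le> \<bar>b\<bar> * ((\<bar>K1\<bar> + \<bar>K2\<bar>) * (L * \<bar>a\<bar>))"
      by (intro mult_left_mono) auto
    then have kc: "- (b * (k_coeff K1 K2 x * c)) \<le> (\<bar>K1\<bar> + \<bar>K2\<bar>) * L * (\<bar>a\<bar> * \<bar>b\<bar>)"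
      using abs_ge_minus_self[of "b * (k_coeff K1 K2 x * c)"] by (simp add: abs_mult algebra_simps)
    have ab: "2 * (\<bar>a\<bar> * \<bar>b\<bar>) \<le> a\<^sup>2 + b\<^sup>2" using sum_squares_bound[of "\<bar>a\<bar>" "\<bar>b\<bar>"] by simp
    have "(\<bar>K1\<bar> + \<bar>K2\<bar>) * L * (2 * (\<bar>a\<bar> * \<bar>b\<bar>)) \<le> (\<bar>K1\<bar> + \<bar>K2\<bar>) * L * (a\<^sup>2 + b\<^sup>2)"
      using ab L by (intro mult_left_mono) auto
    moreover have "a * b \<le> \<bar>a\<bar> * \<bar>b\<bar>" using abs_ge_self[of "a * b"] by (simp add: abs_mult)
    moreover define m where "m = (real n - 1) / x"
    moreover have "0 \<le> m * b\<^sup>2" using x n_ge_3 by (simp add: m_def)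
    moreover have "\<rho>' x = 2 * (a * b) - 2 * (m * b\<^sup>2) - 2 * (b * (k_coeff K1 K2 x * c))"
      unfolding \<rho>'_def a_def b_def c_def m_def[symmetric] by (simp add: algebra_simps power2_eq_square)
    moreover have "C * \<rho> x = (a\<^sup>2 + b\<^sup>2) + (\<bar>K1\<bar> + \<bar>K2\<bar>) * L * (a\<^sup>2 + b\<^sup>2)"
      unfolding C_def \<rho>_def a_def b_def by (simp add: distrib_right)
    ultimately show ?thesis using kc ab by linarith
  qed
  have \<rho>0: "\<rho> 0 = (u 0 - w 0)\<^sup>2" using radD(3)[OF s1] radD(3)[OF s2] by (simp add: \<rho>_def)
  have "\<rho> r \<le> exp (C * r) * \<rho> 0"
  proof (cases "r \<le> 1")
    case True
    have "\<rho> r \<le> exp (C * (r - 0)) * \<rho> 0"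
      by (rule gronwall_forward[OF r(1) c\<rho>[OF order_refl r(2)] d\<rho>]) (use b r True in auto)
    then show ?thesis by simp
  next
    case False
    have g1: "\<rho> 1 \<le> exp (C * (1 - 0)) * \<rho> 0"
      by (rule gronwall_forward[OF _ c\<rho>[OF order_refl] d\<rho>]) (use b r False in auto)
    moreover have "\<rho> r \<le> exp (C * (r - 1)) * \<rho> 1"
      by (rule gronwall_forward[OF _ c\<rho>[OF _ r(2)] d\<rho>]) (use b r False in auto)
    moreover have "exp (C * (r - 1)) * \<rho> 1 \<le> exp (C * (r - 1)) * (exp (C * 1) * \<rho> 0)"
      using g1 by (intro mult_left_mono) auto
    ultimately have "\<rho> r \<le> exp (C * (r - 1)) * (exp (C * 1) * \<rho> 0)" by linarith
    also have "\<dots> = exp (C * (r - 1) + C * 1) * \<rho> 0" by (simp only: exp_add mult.assoc)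
    also have "C * (r - 1) + C * 1 = C * r" by (simp add: algebra_simps)
    finally show ?thesis .
  qed
  then show ?thesis unfolding \<rho>0 by (simp add: \<rho>_def C_def)
qed

lemma rad_unique:
  assumes s1: "rad f R u v" and s2: "rad f R w z" and eq: "u 0 = w 0" and r: "0 \<le> r" "r \<le> R"
  shows "u r = w r" "v r = z r"
proof -
  have "bounded (u ` {0..R})" "bounded (w ` {0..R})"
    using radD(1)[OF s1] radD(1)[OF s2] by (auto intro: compact_imp_bounded compact_continuous_image)
  then obtain B1 B2 where B: "\<And>x. x \<in> {0..R} \<Longrightarrow> \<bar>u x\<bar> \<le> B1" "\<And>x. x \<in> {0..R} \<Longrightarrow> \<bar>w x\<bar> \<le> B2"
    unfolding bounded_iff by (metis imageI real_norm_def)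
  define M where "M = max B1 B2"
  have "(u r - w r)\<^sup>2 + (v r - z r)\<^sup>2 \<le> exp ((1 + (\<bar>K1\<bar>
      + \<bar>K2\<bar>) * ((q - 1) * M powr (q - 2))) * r) * (u 0 - w 0)\<^sup>2"
  proof (rule rad_gronwall[OF s1 s2 _ _ r])
    show "0 \<le> (q - 1) * M powr (q - 2)" using q_gt_2 by simp
    fix x assume "0 < x" "x < R"
    then show "\<bar>f (u x) - f (w x)\<bar> \<le> (q - 1) * M powr (q - 2) * \<bar>u x - w x\<bar>"
      using B(1)[of x] B(2)[of x] by (intro odd_power_lipschitz q_gt_2) (auto simp: M_def)
  qed
  then have "(u r - w r)\<^sup>2 + (v r - z r)\<^sup>2 \<le> 0" using eq by simp
  then have "(u r - w r)\<^sup>2 + (v r - z r)\<^sup>2 = 0" by (metis add_nonneg_nonneg antisym zero_le_power2)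
  then show "u r = w r" "v r = z r" by (simp_all add: add_nonneg_eq_0_iff)
qed

text \<open>
  The truncation is bounded and Lipschitz continuous, as Picard iteration requires, and a solution of the truncated
  equation that stays in \<open>[-M, M]\<close> solves the original one.
\<close>

definition trunc :: "real \<Rightarrow> real \<Rightarrow> real" where
  "trunc M x = f (max (- M) (min M x))"

lemma trunc_eq: "\<bar>x\<bar> \<le> M \<Longrightarrow> trunc M x = f x"
proof -
  assume "\<bar>x\<bar> \<le> M"
  then have "max (- M) (min M x) = x" by auto
  then show ?thesis by (simp add: trunc_def)
qed

lemma trunc_nonneg: "0 < M \<Longrightarrow> 0 \<le> x \<Longrightarrow> 0 \<le> trunc M x"
  by (cases "x = 0") (auto simp: trunc_def max_def min_def intro: less_imp_le[OF odd_power_pos])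

lemma f_nonneg: "0 \<le> x \<Longrightarrow> 0 \<le> f x"
  by (simp add: odd_power_def)

lemma f_mono: "0 \<le> x \<Longrightarrow> x \<le> y \<Longrightarrow> f x \<le> f y"
  unfolding odd_power_def using q_gt_2 by (intro mult_mono powr_mono2) auto

lemma trunc_lipschitz:
  assumes "0 < M"
  shows "\<bar>trunc M x - trunc M y\<bar> \<le> (q - 1) * M powr (q - 2) * \<bar>x - y\<bar>"
proof -
  have "\<bar>trunc M x - trunc M y\<bar> \<le> (q - 1) * M powr (q - 2) * \<bar>max (- M) (min M x) - max (- M) (min M y)\<bar>"
    unfolding trunc_def using assms by (intro odd_power_lipschitz q_gt_2) auto
  also have "\<dots> \<le> (q - 1) * M powr (q - 2) * \<bar>x - y\<bar>"
    using q_gt_2 by (intro mult_left_mono) (auto simp: max_def min_def)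
  finally show ?thesis .
qed

lemma trunc_bounded:
  assumes "0 < M"
  shows "\<bar>trunc M x\<bar> \<le> (q - 1) * M powr (q - 2) * M"
proof -
  have "\<bar>f (max (- M) (min M x)) - f 0\<bar> \<le> (q - 1) * M powr (q - 2) * \<bar>max (- M) (min M x) - 0\<bar>"
    using assms by (intro odd_power_lipschitz q_gt_2) auto
  also have "\<dots> \<le> (q - 1) * M powr (q - 2) * M"
    using q_gt_2 assms by (intro mult_left_mono) auto
  finally show ?thesis by (simp add: trunc_def)
qed

definition tsol :: "real \<Rightarrow> real \<Rightarrow> (real \<Rightarrow> real) \<times> (real \<Rightarrow> real)" where
  "tsol M d = (SOME p. fst p 0 = d \<and> (\<forall>R>0. rad (trunc M) R (fst p) (snd p)))"

lemma tsol:
  assumes "0 < M"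
  shows "fst (tsol M d) 0 = d" "0 < R \<Longrightarrow> rad (trunc M) R (fst (tsol M d)) (snd (tsol M d))"
proof -
  obtain u v where "u 0 = d \<and> (\<forall>R>0. rad (trunc M) R u v)"
    using picard_existence[OF trunc_bounded[OF assms] trunc_lipschitz[OF assms]] by blast
  then have "\<exists>p. fst p 0 = d \<and> (\<forall>R>0. rad (trunc M) R (fst p) (snd p))" by (intro exI[of _ "(u, v)"]) simp
  then have "fst (tsol M d) 0 = d \<and> (\<forall>R>0. rad (trunc M) R (fst (tsol M d)) (snd (tsol M d)))"
    unfolding tsol_def by (rule someI_ex)
  then show "fst (tsol M d) 0 = d" "0 < R \<Longrightarrow> rad (trunc M) R (fst (tsol M d)) (snd (tsol M d))" by auto
qed

lemma trunc_gronwall: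
  assumes M: "0 < M" and s1: "rad (trunc M) R u v" and s2: "rad (trunc M) R w z" and r: "0 \<le> r" "r \<le> R"
  shows "(u r - w r)\<^sup>2 + (v r - z r)\<^sup>2 \<le> exp ((1 + (\<bar>K1\<bar>
      + \<bar>K2\<bar>) * ((q - 1) * M powr (q - 2))) * r) * (u 0 - w 0)\<^sup>2"
  by (rule rad_gronwall[OF s1 s2 _ trunc_lipschitz[OF M] r]) (use q_gt_2 in simp)

lemma trunc_unique:
  assumes M: "0 < M" and s: "rad (trunc M) R u v" "0 < R" and r: "0 \<le> r" "r \<le> R"
  shows "fst (tsol M (u 0)) r = u r" "snd (tsol M (u 0)) r = v r"
proof -
  have "(fst (tsol M (u 0)) r - u r)\<^sup>2 + (snd (tsol M (u 0)) r - v r)\<^sup>2 \<le> 0"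
    using trunc_gronwall[OF M tsol(2)[OF M s(2)] s(1) r, of "u 0"] tsol(1)[OF M] by simp
  then have "(fst (tsol M (u 0)) r - u r)\<^sup>2 + (snd (tsol M (u 0)) r - v r)\<^sup>2 = 0"
    by (metis add_nonneg_nonneg antisym zero_le_power2)
  then show "fst (tsol M (u 0)) r = u r" "snd (tsol M (u 0)) r = v r" by (simp_all add: add_nonneg_eq_0_iff)
qed

lemma weighted_slope_deriv:
  assumes s: "rad \<phi> R u v" and x: "0 < x" "x < R" "x \<noteq> 1"
  shows "((\<lambda>x. x ^ (n - 1) * v x) has_real_derivative - k_coeff K1 K2 x * (x ^ (n - 1) * \<phi> (u x))) (at x)"
proof -
  have e: "x ^ (n - 1) = x * x ^ (n - 2)"
  proof -
    have "n - 1 = Suc (n - 2)" using n_ge_3 by simp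
    then show ?thesis by simp
  qed
  have pw: "((\<lambda>s. s ^ (n - 1)) has_real_derivative real (n - 1) * x ^ (n - 2)) (at x)"
    using DERIV_pow[of "n - 1" x] n_ge_3 by (simp add: numeral_eq_Suc)
  show ?thesis
    by (rule DERIV_cong[OF DERIV_mult[OF pw radD(5)[OF s x]]])
       (insert x n_ge_3, unfold e, simp add: of_nat_diff field_simps)
qed

text \<open>
  Since \<open>K\<^sub>1 < 0\<close>, the function \<open>r\<^bsup>n-1\<^esup> v\<close> is nondecreasing as long as \<open>u\<close> is nonnegative. So \<open>u\<close> cannot have a first zero.
\<close>

lemma rad_positive:
  assumes s: "rad \<phi> R u v" and R: "R \<le> 1" and u0: "0 < u 0" and \<phi>: "\<And>x. 0 \<le> x \<Longrightarrow> 0 \<le> \<phi> x"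
  shows "\<And>r. 0 \<le> r \<Longrightarrow> r \<le> R \<Longrightarrow> 0 \<le> v r" "\<And>s r. 0 \<le> s \<Longrightarrow> s \<le> r \<Longrightarrow> r \<le> R \<Longrightarrow> u s \<le> u r"
proof -
  have v_nonneg: "0 \<le> v t" if t: "0 \<le> t" "t \<le> R" and nn: "\<And>x. 0 \<le> x \<Longrightarrow> x < t \<Longrightarrow> 0 \<le> u x" for t
  proof (cases "t = 0")
    case True
    then show ?thesis using radD(3)[OF s] by simp
  next
    case False
    then have t0: "0 < t" using t by simp
    have "0 ^ (n - 1) * v 0 \<le> t ^ (n - 1) * v t"
    proof (rule increasing_if_deriv_nonneg[OF t(1)])
      show "continuous_on {0..t} (\<lambda>x. x ^ (n - 1) * v x)"
        using t by (intro continuous_intros continuous_on_subset[OF radD(2)[OF s]]) auto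
      fix x assume x: "0 < x" "x < t"
      then show "((\<lambda>x. x ^ (n - 1) * v x) has_real_derivative - k_coeff K1 K2 x * (x ^ (n - 1) * \<phi> (u x))) (at x)"
        using t R by (intro weighted_slope_deriv[OF s]) auto
      have "0 \<le> - K1 * (x ^ (n - 1) * \<phi> (u x))" using x K1_neg \<phi> nn[of x] by (intro mult_nonneg_nonneg) auto
      then show "0 \<le> - k_coeff K1 K2 x * (x ^ (n - 1) * \<phi> (u x))" using x t R by (simp add: k_coeff_def)
    qed
    then have "0 \<le> t ^ (n - 1) * v t" using radD(3)[OF s] by simp
    then show ?thesis using mult_pos_neg[OF zero_less_power[OF t0, of "n - 1"], of "v t"] by linarith
  qed
  have inc: "u a \<le> u b" if "0 \<le> a" "a \<le> b" "b \<le> R" and nn: "\<And>x. 0 \<le> x \<Longrightarrow> x < b \<Longrightarrow> 0 \<le> u x" for a b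
  proof (rule increasing_if_deriv_nonneg[OF that(2) _ radD(4)[OF s]])
    show "continuous_on {a..b} u" using that by (intro continuous_on_subset[OF radD(1)[OF s]]) auto
    fix x assume "a < x" "x < b"
    then show "0 < x" "x < R" "0 \<le> v x" using that by (auto intro!: v_nonneg nn)
  qed
  have pos: "0 < u r" if r: "0 \<le> r" "r \<le> R" for r
  proof (rule ccontr)
    assume "\<not> 0 < u r"
    then have 1: "- u 0 < 0" "0 \<le> - u r" using u0 by auto
    have 2: "continuous_on {0..r} (\<lambda>x. - u x)"
      using r by (intro continuous_intros continuous_on_subset[OF radD(1)[OF s]]) auto
    obtain t where t: "0 < t" "t \<le> r" "- u t = 0" "\<And>x. 0 \<le> x \<Longrightarrow> x < t \<Longrightarrow> - u x < 0"
      using first_zero[OF r(1) 2 1] by blast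
    have "u 0 \<le> u t" using t r by (intro inc) (auto simp: less_imp_le)
    then show False using t u0 by simp
  qed
  show "0 \<le> v r" if "0 \<le> r" "r \<le> R" for r using that pos by (intro v_nonneg) (auto intro: less_imp_le)
  show "u s \<le> u r" if "0 \<le> s" "s \<le> r" "r \<le> R" for s r using that pos by (intro inc) (auto intro: less_imp_le)
qed

text \<open>
  These are the \<open>d > 0\<close> for which \<open>u(r,d)\<close> exists up to \<open>r = 1\<close>. On \<open>[0, 1]\<close> solutions are nondecreasing, whence the
  value at \<open>1\<close> decides whether the truncation is noticed.
\<close>

definition good :: "real \<Rightarrow> bool" where
  "good d \<longleftrightarrow> 0 < d \<and> (\<exists>M>0. fst (tsol M d) 1 < M)"

lemma trunc_sol_on_unit:
  assumes "0 < M" "0 < d" "fst (tsol M d) 1 < M"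
  shows "rad f 1 (fst (tsol M d)) (snd (tsol M d))"
    "\<And>r. 0 \<le> r \<Longrightarrow> r \<le> 1 \<Longrightarrow> 0 < fst (tsol M d) r \<and> fst (tsol M d) r < M"
proof -
  have s: "rad (trunc M) 1 (fst (tsol M d)) (snd (tsol M d))" using tsol(2)[OF assms(1)] by simp
  have "0 < fst (tsol M d) 0" using tsol(1)[OF assms(1)] assms(2) by simp
  note inc = rad_positive(2)[OF s order_refl this trunc_nonneg[OF assms(1)]]
  show b: "0 < fst (tsol M d) r \<and> fst (tsol M d) r < M" if "0 \<le> r" "r \<le> 1" for r
    using inc[of 0 r] inc[of r 1] that assms tsol(1)[OF assms(1), of d] by auto
  show "rad f 1 (fst (tsol M d)) (snd (tsol M d))"
  proof (rule rad_cong[OF s])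
    fix r :: real assume "0 < r" "r < 1"
    then show "trunc M (fst (tsol M d) r) = f (fst (tsol M d) r)" using b[of r] by (intro trunc_eq) auto
  qed
qed

lemma good_if_solution_on_unit:
  assumes s: "rad f 1 u v" and u0: "0 < u 0"
  shows "good (u 0)" "u 1 < M \<Longrightarrow> fst (tsol M (u 0)) 1 = u 1 \<and> snd (tsol M (u 0)) 1 = v 1"
proof -
  note inc = rad_positive(2)[OF s order_refl u0 f_nonneg]
  have *: "fst (tsol M (u 0)) 1 = u 1 \<and> snd (tsol M (u 0)) 1 = v 1" if M: "u 1 < M" for M
  proof -
    have M0: "0 < M" using inc[of 0 1] u0 M by simp
    have "rad (trunc M) 1 u v"
    proof (rule rad_cong[OF s])
      fix r :: real assume "0 < r" "r < 1"
      then show "f (u r) = trunc M (u r)" using inc[of 0 r] inc[of r 1] u0 M by (intro trunc_eq[symmetric]) auto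
    qed
    from trunc_unique[OF M0 this, of 1] show ?thesis by simp
  qed
  show "u 1 < M \<Longrightarrow> fst (tsol M (u 0)) 1 = u 1 \<and> snd (tsol M (u 0)) 1 = v 1" by (rule *)
  have "fst (tsol (u 1 + 1) (u 0)) 1 < u 1 + 1" using *[of "u 1 + 1"] by simp
  moreover have "0 < u 1 + 1" using inc[of 0 1] u0 by simp
  ultimately show "good (u 0)" using u0 unfolding good_def by blast
qed

text \<open>
  For \<open>r \<ge> 1\<close> the function \<open>v\<^sup>2/2 + K\<^sub>2|u|\<^sup>q/q\<close> is nonincreasing, so the solution of the equation truncated at a
  level \<open>M'\<close> which exceeds its value \<open>H\<close> at \<open>r = 1\<close> never reaches that level.
\<close>

lemma good_global:
  assumes "good d"
  shows "\<exists>p. fst p 0 = d \<and> (\<forall>R. rad f R (fst p) (snd p))"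
proof -
  obtain M where M: "0 < d" "0 < M" "fst (tsol M d) 1 < M" using assms by (auto simp: good_def)
  define u where "u = fst (tsol M d)"
  define v where "v = snd (tsol M d)"
  have s: "rad f 1 u v" and b: "\<And>r. 0 \<le> r \<Longrightarrow> r \<le> 1 \<Longrightarrow> 0 < u r \<and> u r < M"
    unfolding u_def v_def using trunc_sol_on_unit[OF M(2,1,3)] by auto
  have ud: "u 0 = d" unfolding u_def using tsol(1)[OF M(2)] .
  define H where "H = (v 1)\<^sup>2 / 2 + K2 * \<bar>u 1\<bar> powr q / q"
  have H: "0 \<le> H" using K2_pos q_gt_2 by (simp add: H_def)
  define M' where "M' = max M ((q * (H + 1) / K2) powr (1 / q))"
  have M': "M \<le> M'" "0 < M'" using M by (auto simp: M'_def)
  have big: "H < K2 * M' powr q / q"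
  proof -
    have "((q * (H + 1) / K2) powr (1 / q)) powr q \<le> M' powr q"
      using q_gt_2 by (intro powr_mono2) (auto simp: M'_def)
    then have "q * (H + 1) / K2 \<le> M' powr q" using q_gt_2 H K2_pos by (simp add: powr_powr)
    then show ?thesis using q_gt_2 K2_pos by (simp add: field_simps)
  qed
  define w where "w = fst (tsol M' d)"
  define z where "z = snd (tsol M' d)"
  have w: "rad (trunc M') R w z" if "0 < R" for R unfolding w_def z_def using tsol(2)[OF M'(2) that] .
  have eq: "w r = u r" "z r = v r" if "0 \<le> r" "r \<le> 1" for r
  proof -
    have "rad (trunc M') 1 u v"
    proof (rule rad_cong[OF s])
      fix r :: real assume "0 < r" "r < 1"
      then show "f (u r) = trunc M' (u r)" using b[of r] M' by (intro trunc_eq[symmetric]) auto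
    qed
    from trunc_unique[OF M'(2) this _ that] show "w r = u r" "z r = v r" by (simp_all add: w_def z_def ud)
  qed
  have bound: "\<bar>w r\<bar> < M'" if r: "0 \<le> r" for r
  proof (rule ccontr)
    assume n: "\<not> \<bar>w r\<bar> < M'"
    have r1: "1 \<le> r"
    proof (rule ccontr)
      assume "\<not> 1 \<le> r"
      then show False using n eq(1)[of r] b[of r] r M' by auto
    qed
    have w1: "\<bar>w 1\<bar> - M' < 0" using eq(1)[of 1] b[of 1] M' by auto
    have cont: "continuous_on {1..r} (\<lambda>x. \<bar>w x\<bar> - M')"
      using r1 by (intro continuous_intros continuous_on_subset[OF radD(1)[OF w[of r]]]) auto
    have wr0: "0 \<le> \<bar>w r\<bar> - M'" using n by simp
    obtain t where t: "1 < t" "t \<le> r" "\<bar>w t\<bar> - M' = 0" "\<And>x. 1 \<le> x \<Longrightarrow> x < t \<Longrightarrow> \<bar>w x\<bar> - M' < 0"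
      using first_zero[where f = "\<lambda>x. \<bar>w x\<bar> - M'", OF r1 cont w1 wr0] by blast
    define e where "e = (\<lambda>x. (z x)\<^sup>2 / 2 + K2 * \<bar>w x\<bar> powr q / q)"
    have wr: "rad (trunc M') (t + 1) w z" using w t by simp
    have "e t \<le> e 1"
    proof (rule decreasing_if_deriv_nonpos[where f = e and f' = "\<lambda>x. - ((real n - 1) / x) * (z x)\<^sup>2"])
      show "1 \<le> t" using t by simp
      have cw: "continuous_on {1..t} w" "continuous_on {1..t} z"
        using continuous_on_subset[OF radD(1)[OF wr]] continuous_on_subset[OF radD(2)[OF wr]] by auto
      have "continuous_on UNIV (\<lambda>x::real. \<bar>x\<bar> powr q)"
        by (intro continuous_at_imp_continuous_on ballI DERIV_isCont[OF has_real_derivative_abs_powr[OF q_gt_2]])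
      from continuous_on_compose2[OF this cw(1)] have cp: "continuous_on {1..t} (\<lambda>x. \<bar>w x\<bar> powr q)" by simp
      show "continuous_on {1..t} e" unfolding e_def using q_gt_2 by (intro continuous_intros cw cp) auto
      fix x assume x: "1 < x" "x < t"
      then have x0: "0 < x" "x < t + 1" "x \<noteq> 1" by auto
      have tr: "trunc M' (w x) = f (w x)" using t(4)[of x] x by (intro trunc_eq) auto
      have d1: "((\<lambda>x. (z x)\<^sup>2 / 2) has_real_derivative z x * (- ((real n - 1) / x) * z x - K2 * f (w x))) (at x)"
        by (rule DERIV_cong[OF DERIV_cdivide[OF DERIV_power[OF radD(5)[OF wr x0], of 2]]])
           (use x in \<open>simp add: tr k_coeff_def\<close>)
      have d2: "((\<lambda>x. K2 * \<bar>w x\<bar> powr q / q) has_real_derivative K2 * f (w x) * z x) (at x)"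
        by (rule DERIV_cong[OF DERIV_cdivide[OF DERIV_cmult[OF DERIV_chain2[OF has_real_derivative_abs_powr[OF q_gt_2] radD(4)[OF wr x0(1,2)]]]]])
           (use q_gt_2 in simp)
      show "(e has_real_derivative - ((real n - 1) / x) * (z x)\<^sup>2) (at x)"
        unfolding e_def by (rule DERIV_cong[OF DERIV_add[OF d1 d2]]) (simp add: algebra_simps power2_eq_square)
      have "0 \<le> (real n - 1) / x * (z x)\<^sup>2" using x n_ge_3
          by (intro mult_nonneg_nonneg divide_nonneg_nonneg) auto
      then show "- ((real n - 1) / x) * (z x)\<^sup>2 \<le> 0" by simp
    qed
    also have "e 1 = H" using eq[of 1] by (simp add: e_def H_def)
    also have "H < K2 * M' powr q / q" by (rule big)
    also have "\<dots> \<le> e t" using t(3) by (simp add: e_def)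
    finally show False by simp
  qed
  have pos: "rad f R w z" if "0 < R" for R
  proof (rule rad_cong[OF w[OF that]])
    fix r :: real assume "0 < r" "r < R"
    then show "trunc M' (w r) = f (w r)" using bound[of r] by (intro trunc_eq) auto
  qed
  have "rad f R w z" for R
    by (rule rad_subinterval[OF pos[of "max R 1"]]) auto
  moreover have "w 0 = d" unfolding w_def using tsol(1)[OF M'(2)] .
  ultimately show ?thesis by (intro exI[of _ "(w, z)"]) auto
qed

definition sol :: "real \<Rightarrow> (real \<Rightarrow> real) \<times> (real \<Rightarrow> real)" where
  "sol d = (SOME p. fst p 0 = d \<and> (\<forall>R. rad f R (fst p) (snd p)))"

lemma sol:
  assumes "good d"
  shows "fst (sol d) 0 = d" "rad f R (fst (sol d)) (snd (sol d))"
proof -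
  have "fst (sol d) 0 = d \<and> (\<forall>R. rad f R (fst (sol d)) (snd (sol d)))"
    unfolding sol_def by (rule someI_ex[OF good_global[OF assms]])
  then show "fst (sol d) 0 = d" "rad f R (fst (sol d)) (snd (sol d))" by auto
qed

definition alpha where "alpha = 2 / (q - 2)"
definition lam where "lam = real n - 2 - alpha"

lemma alpha_pos: "0 < alpha" using q_gt_2 by (simp add: alpha_def)

lemma alpha_less_lam: "alpha < lam"
proof -
  have n: "real n - 2 > 0" using n_ge_3 by simp
  have "2 * real n / (real n - 2) - 2 = 4 / (real n - 2)" using n by (simp add: field_simps)
  then have "4 / (real n - 2) < q - 2" using q_large by simp
  then have "4 < (q - 2) * (real n - 2)" using n by (simp add: field_simps)
  then have "2 * alpha < real n - 2" using q_gt_2 by (simp add: alpha_def field_simps)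
  then show ?thesis by (simp add: lam_def)
qed

text \<open>
  The equation with constant coefficient is invariant under this scaling. The hypothesis \<open>c \<le> 1\<close> keeps \<open>c r\<close> in
  \<open>[0, 1]\<close>, where the coefficient is \<open>K\<^sub>1\<close>.
\<close>

lemma rad_scale:
  assumes s: "rad f 1 u v" and c: "0 < c" "c \<le> 1"
  shows "rad f 1 (\<lambda>r. c powr alpha * u (c * r)) (\<lambda>r. c powr alpha * c * v (c * r))"
  unfolding rad_def
proof (intro conjI ballI allI impI)
  have im: "(\<lambda>r. c * r) ` {0..1} \<subseteq> {0..1}" using c by (auto simp: mult_le_one)
  show "continuous_on {0..1} (\<lambda>r. c powr alpha * c * v (c * r))"
    by (intro continuous_intros continuous_on_compose2[OF radD(2)[OF s] _ im])
  show "c powr alpha * c * v (c * 0) = 0" using radD(3)[OF s] by simp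
  have dc: "((\<lambda>r. c * r) has_real_derivative c) (at r within S)" for r S
    by (auto intro!: derivative_eq_intros)
  fix r :: real
  {
    assume r: "r \<in> {0..1}"
    have "c * r \<in> {0..1}" using im r by blast
    then have "(u has_real_derivative v (c * r)) (at (c * r) within {0..1})" using s by (simp add: rad_def)
    then have "(u has_real_derivative v (c * r)) (at (c * r) within (\<lambda>r. c * r) ` {0..1})"
      by (rule DERIV_subset[OF _ im])
    from DERIV_image_chain[OF this dc]
    have "((\<lambda>r. u (c * r)) has_real_derivative v (c * r) * c) (at r within {0..1})" by (simp add: o_def)
    from DERIV_cmult[OF this, of "c powr alpha"]
    show "((\<lambda>r. c powr alpha * u (c * r)) has_real_derivative c powr alpha * c * v (c * r)) (at r within {0..1})"
      by (simp add: algebra_simps)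
  }
  assume r: "0 < r" "r < 1"
  have cr: "0 < c * r" "c * r < 1"
  proof -
    show "0 < c * r" using c r by simp
    have "c * r \<le> 1 * r" using c r by (intro mult_right_mono) auto
    then show "c * r < 1" using r by linarith
  qed
  note d = radD(5)[OF s cr(1,2)]
  have "((\<lambda>r. c powr alpha * c * v (c * r)) has_real_derivative
      c powr alpha * c * ((- ((real n - 1) / (c * r)) * v (c * r) - k_coeff K1 K2 (c * r) * f (u (c * r))) * c)) (at r)"
    using d cr by (intro DERIV_cmult DERIV_chain2[OF _ dc]) auto
  moreover have "c powr alpha * c * ((- ((real n - 1) / (c * r)) * v (c * r) - k_coeff K1 K2 (c * r) * f (u (c * r))) * c)
     = - ((real n - 1) / r) * (c powr alpha * c * v (c * r)) - k_coeff K1 K2 r * f (c powr alpha * u (c * r))"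
  proof -
    have "(c powr alpha) powr (q - 1) = c powr (alpha * (q - 1))" by (simp add: powr_powr)
    also have "alpha * (q - 1) = alpha + 2" using q_gt_2 by (simp add: alpha_def field_simps)
    also have "c powr (alpha + 2) = c powr alpha * c\<^sup>2" using c powr_realpow[of c 2] by (simp add: powr_add)
    finally have "f (c powr alpha * u (c * r)) = c powr alpha * c\<^sup>2 * f (u (c * r))"
      using c odd_power_mult[of "c powr alpha" q] by simp
    moreover have "k_coeff K1 K2 (c * r) = k_coeff K1 K2 r" using cr r by (simp add: k_coeff_def)
    ultimately show ?thesis using c r by (simp add: field_simps power2_eq_square)
  qed
  ultimately show "((\<lambda>r. c powr alpha * c * v (c * r)) has_real_derivative
      - ((real n - 1) / r) * (c powr alpha * c * v (c * r)) - k_coeff K1 K2 r * f (c powr alpha * u (c * r))) (at r)"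
    by simp
qed

section \<open>The range of initial values\<close>

lemma sol_positive:
  assumes "good d"
  shows "0 \<le> r \<Longrightarrow> r \<le> 1 \<Longrightarrow> 0 \<le> snd (sol d) r"
    and "0 \<le> s \<Longrightarrow> s \<le> r \<Longrightarrow> r \<le> 1 \<Longrightarrow> fst (sol d) s \<le> fst (sol d) r"
    and "0 \<le> r \<Longrightarrow> r \<le> 1 \<Longrightarrow> d \<le> fst (sol d) r"
    and "0 \<le> r \<Longrightarrow> r \<le> 1 \<Longrightarrow> 0 < fst (sol d) r"
proof -
  have d: "0 < d" using assms by (simp add: good_def)
  have "0 < fst (sol d) 0" using sol(1)[OF assms] d by simp
  note p = rad_positive[OF sol(2)[OF assms, of 1] order_refl this f_nonneg]
  show "0 \<le> r \<Longrightarrow> r \<le> 1 \<Longrightarrow> 0 \<le> snd (sol d) r" using p(1) by blast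
  show "0 \<le> s \<Longrightarrow> s \<le> r \<Longrightarrow> r \<le> 1 \<Longrightarrow> fst (sol d) s \<le> fst (sol d) r" using p(2) by blast
  show a: "0 \<le> r \<Longrightarrow> r \<le> 1 \<Longrightarrow> d \<le> fst (sol d) r" using p(2)[of 0 r] sol(1)[OF assms] by simp
  show "0 \<le> r \<Longrightarrow> r \<le> 1 \<Longrightarrow> 0 < fst (sol d) r" using a d by simp
qed

lemma sol_scale:
  assumes "good d2" "0 < d1" "d1 < d2"
  obtains c where "0 < c" "c < 1" "good d1"
    "\<And>r. 0 \<le> r \<Longrightarrow> r \<le> 1 \<Longrightarrow> fst (sol d1) r = c powr alpha * fst (sol d2) (c * r)"
    "\<And>r. 0 \<le> r \<Longrightarrow> r \<le> 1 \<Longrightarrow> snd (sol d1) r = c powr alpha * c * snd (sol d2) (c * r)"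
proof -
  define c where "c = (d1 / d2) powr (1 / alpha)"
  have d: "0 < d1 / d2" "d1 / d2 < 1" using assms by auto
  have c: "0 < c" "c powr alpha = d1 / d2" using d alpha_pos assms by (auto simp: c_def powr_powr)
  have c1: "c < 1" unfolding c_def using powr_less_mono2[of "1 / alpha" "d1 / d2" 1] d alpha_pos by simp
  define w where "w = (\<lambda>r. c powr alpha * fst (sol d2) (c * r))"
  define z where "z = (\<lambda>r. c powr alpha * c * snd (sol d2) (c * r))"
  have s: "rad f 1 w z" unfolding w_def z_def using rad_scale[OF sol(2)[OF assms(1)] c(1)] c1 by simp
  have w0: "w 0 = d1" using assms sol(1)[OF assms(1)] by (simp add: w_def c)
  have g: "good d1" using good_if_solution_on_unit(1)[OF s] w0 assms by simp
  have eq: "fst (sol d1) r = w r" "snd (sol d1) r = z r" if "0 \<le> r" "r \<le> 1" for r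
    using rad_unique[OF sol(2)[OF g] s _ that] sol(1)[OF g] w0 by auto
  show ?thesis using that[OF c(1) c1 g] eq by (simp add: w_def z_def)
qed

lemma tsol_lipschitz:
  assumes "0 < M"
  shows "\<exists>C>0. \<forall>d d'. \<bar>fst (tsol M d) 1 - fst (tsol M d') 1\<bar> \<le> C * \<bar>d - d'\<bar>"
proof -
  define E where "E = exp ((1 + (\<bar>K1\<bar> + \<bar>K2\<bar>) * ((q - 1) * M powr (q - 2))) * 1)"
  have E: "0 < E" by (simp add: E_def)
  have "\<bar>fst (tsol M d) 1 - fst (tsol M d') 1\<bar> \<le> sqrt E * \<bar>d - d'\<bar>" for d d'
  proof -
    have "(fst (tsol M d) 1 - fst (tsol M d') 1)\<^sup>2 + (snd (tsol M d) 1 - snd (tsol M d') 1)\<^sup>2 \<le> E * (d - d')\<^sup>2"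
      unfolding E_def using trunc_gronwall[OF assms tsol(2)[OF assms] tsol(2)[OF assms], of 1 1 d d'] tsol(1)[OF assms] by simp
    then have "\<bar>fst (tsol M d) 1 - fst (tsol M d') 1\<bar>\<^sup>2 \<le> E * (d - d')\<^sup>2"
      using zero_le_power2[of "snd (tsol M d) 1 - snd (tsol M d') 1"] by (simp only: power2_abs)
    also have "\<dots> = (sqrt E * \<bar>d - d'\<bar>)\<^sup>2" using E by (simp add: power_mult_distrib)
    finally show ?thesis by (rule power2_le_imp_le) (use E in simp)
  qed
  then show ?thesis using E by (intro exI[of _ "sqrt E"]) auto
qed

lemma good_if_tsol_small:
  assumes "0 < M" "0 < d" "fst (tsol M d) 1 < M"
  shows "good d" "fst (sol d) 1 = fst (tsol M d) 1"
proof -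
  show g: "good d" using assms unfolding good_def by blast
  show "fst (sol d) 1 = fst (tsol M d) 1"
    using rad_unique[OF sol(2)[OF g] trunc_sol_on_unit(1)[OF assms], of 1] sol(1)[OF g] tsol(1)[OF assms(1)]
        by simp
qed

lemma tsol_eq_sol:
  assumes "good d" "fst (sol d) 1 < M"
  shows "fst (tsol M d) 1 = fst (sol d) 1"
  using good_if_solution_on_unit(2)[OF sol(2)[OF assms(1)], of M] sol(1)[OF assms(1)] assms
  by (simp add: good_def)

lemma good_open:
  assumes "good d"
  shows "\<exists>\<epsilon>>0. \<forall>d'. 0 < d' \<longrightarrow> \<bar>d' - d\<bar> < \<epsilon> \<longrightarrow> good d'"
proof -
  obtain M where M: "0 < d" "0 < M" "fst (tsol M d) 1 < M" using assms by (auto simp: good_def)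
  obtain C where C: "C > 0" "\<And>d d'. \<bar>fst (tsol M d) 1 - fst (tsol M d') 1\<bar> \<le> C * \<bar>d - d'\<bar>"
    using tsol_lipschitz[OF M(2)] by blast
  define \<epsilon> where "\<epsilon> = (M - fst (tsol M d) 1) / C"
  have e: "\<epsilon> > 0" using M C by (simp add: \<epsilon>_def)
  have "good d'" if "0 < d'" "\<bar>d' - d\<bar> < \<epsilon>" for d'
  proof (rule good_if_tsol_small[OF M(2) that(1)])
    have "C * \<bar>d' - d\<bar> < C * \<epsilon>" using that C by simp
    then have "C * \<bar>d' - d\<bar> < M - fst (tsol M d) 1" using C by (simp add: \<epsilon>_def)
    then show "fst (tsol M d') 1 < M" using C(2)[of d' d] by linarith
  qed
  then show ?thesis using e by blast
qed

lemma small_data: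
  assumes "0 < m"
  shows "\<exists>d. good d \<and> fst (sol d) 1 < m"
proof -
  have z: "rad (trunc m) 1 (\<lambda>_. 0) (\<lambda>_. 0)" unfolding rad_def using trunc_eq[of 0 m] assms by auto
  have t0: "fst (tsol m 0) 1 = 0" using trunc_unique(1)[OF assms z, of 1] by simp
  obtain C where C: "C > 0" "\<And>d d'. \<bar>fst (tsol m d) 1 - fst (tsol m d') 1\<bar> \<le> C * \<bar>d - d'\<bar>"
    using tsol_lipschitz[OF assms] by blast
  define d where "d = m / (2 * C)"
  have d: "0 < d" using assms C by (simp add: d_def)
  have "\<bar>fst (tsol m d) 1\<bar> \<le> C * \<bar>d\<bar>" using C(2)[of d 0] t0 by simp
  also have "\<dots> = m / 2" using C d assms by (simp add: d_def)
  finally have "fst (tsol m d) 1 < m" using assms by linarith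
  then show ?thesis using good_if_tsol_small[OF assms d] by auto
qed

text \<open>
  Solutions with large initial value blow up before \<open>r = 1\<close>. The quantity \<open>S = r\<^bsup>n-1\<^esup> v u\<^bsup>-q/2\<^esup>\<close> satisfies
  \<open>S' = u\<^bsup>q/2-1\<^esup>(-K\<^sub>1 r\<^bsup>n-1\<^esup> - (q/2)S\<^sup>2 r\<^bsup>1-n\<^esup>)\<close>. Here \<open>u \<ge> d\<close>, so for \<open>d\<close> large \<open>S\<close> exceeds a fixed \<open>\<sigma> > 0\<close> before
  \<open>r = 3/4\<close>, and remains above it. Then \<open>v \<ge> \<sigma> u\<^bsup>q/2\<^esup>\<close>, so \<open>u\<^bsup>1-q/2\<^esup>\<close> decreases at least linearly and would
  become negative by \<open>r = 1\<close>.
\<close>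

lemma good_bounded: "\<exists>C. \<forall>d. good d \<longrightarrow> d \<le> C"
proof -
  define \<kappa> where "\<kappa> = - K1"
  have \<kappa>: "0 < \<kappa>" using K1_neg by (simp add: \<kappa>_def)
  define \<beta> where "\<beta> = q / 2 - 1"
  have \<beta>: "0 < \<beta>" using q_gt_2 by (simp add: \<beta>_def)
  define \<delta> where "\<delta> = (1 / 2 :: real) ^ (n - 1)"
  have \<delta>: "0 < \<delta>" by (simp add: \<delta>_def)
  define \<sigma> where "\<sigma> = \<delta> * sqrt (\<kappa> / q)"
  have \<sigma>: "0 < \<sigma>" "q / 2 * \<sigma>\<^sup>2 / \<delta> = \<kappa> * \<delta> / 2"
    using \<delta> \<kappa> q_gt_2 by (auto simp: \<sigma>_def power_mult_distrib) (simp add: power2_eq_square)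
  define C where "C = (max (8 * \<sigma> / (\<kappa> * \<delta>)) (4 / (\<beta> * \<sigma>))) powr (1 / \<beta>)"
  have "d \<le> C" if g: "good d" for d
  proof (rule ccontr)
    assume "\<not> d \<le> C"
    then have dC: "C < d" by simp
    have d: "0 < d" using g by (simp add: good_def)
    have "C powr \<beta> < d powr \<beta>" using dC \<beta> by (intro powr_less_mono2) (auto simp: C_def)
    moreover have "C powr \<beta> = max (8 * \<sigma> / (\<kappa> * \<delta>)) (4 / (\<beta> * \<sigma>))"
      unfolding C_def using \<beta> \<sigma> \<kappa> \<delta> by (simp add: powr_powr max_def)
    ultimately have db: "8 * \<sigma> / (\<kappa> * \<delta>) < d powr \<beta>" "4 / (\<beta> * \<sigma>) < d powr \<beta>" by auto
    define u where "u = fst (sol d)"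
    define v where "v = snd (sol d)"
    have s: "rad f 2 u v" unfolding u_def v_def by (rule sol(2)[OF g])
    have upos: "0 < u r" "d \<le> u r" "0 \<le> v r" if "0 \<le> r" "r \<le> 1" for r
      unfolding u_def v_def using sol_positive[OF g] that by auto
    define S where "S = (\<lambda>r. r ^ (n - 1) * v r * u r powr (- (q / 2)))"
    define S' where "S' = (\<lambda>r. u r powr \<beta> * (\<kappa> * r ^ (n - 1) - q / 2 * (S r)\<^sup>2 / r ^ (n - 1)))"
    have cu: "continuous_on {a..b} u" "continuous_on {a..b} v" if "0 \<le> a" "b \<le> 1" for a b
      using continuous_on_subset[OF radD(1)[OF s]] continuous_on_subset[OF radD(2)[OF s]] that by auto
    have cS: "continuous_on {a..b} S" if "0 \<le> a" "b \<le> 1" for a b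
    proof -
      have "\<forall>x\<in>{a..b}. u x \<noteq> 0"
      proof
        fix x assume "x \<in> {a..b}"
        then show "u x \<noteq> 0" using upos(1)[of x] that by auto
      qed
      then show ?thesis unfolding S_def by (intro continuous_intros cu[OF that])
    qed
    have dS: "(S has_real_derivative S' r) (at r)" if r: "0 < r" "r < 1" for r
    proof -
      have r2: "r < 2" "r \<noteq> 1" using r by auto
      have u: "0 < u r" using upos r by simp
      define p where "p = r ^ (n - 1)"
      have p: "0 < p" using r by (simp add: p_def)
      have dw: "((\<lambda>r. r ^ (n - 1) * v r) has_real_derivative \<kappa> * (p * f (u r))) (at r)"
        using weighted_slope_deriv[OF s r(1) r2] r by (simp add: k_coeff_def \<kappa>_def p_def)
      have dp: "((\<lambda>r. u r powr (- (q / 2))) has_real_derivative - (q / 2) * u r powr (- (q / 2) - 1) * v r) (at r)"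
        using DERIV_chain2[OF has_real_derivative_powr[OF u, of "- (q / 2)"] radD(4)[OF s r(1) r2(1)]] by simp
      have f: "f (u r) * u r powr (- (q / 2)) = u r powr \<beta>"
      proof -
        have "f (u r) = u r powr 1 * u r powr (q - 2)" using u by (simp add: odd_power_def)
        then have "f (u r) * u r powr (- (q / 2)) = u r powr (1 + (q - 2) + - (q / 2))"
          by (simp only: powr_add)
        also have "1 + (q - 2) + - (q / 2) = \<beta>" by (simp add: \<beta>_def)
        finally show ?thesis .
      qed
      have g: "u r powr (- (q / 2) - 1) = u r powr \<beta> * (u r powr (- (q / 2)))\<^sup>2"
      proof -
        have "(u r powr (- (q / 2)))\<^sup>2 = u r powr (- (q / 2) + - (q / 2))"
            by (simp only: powr_add power2_eq_square)
        then have "u r powr \<beta> * (u r powr (- (q / 2)))\<^sup>2 = u r powr (\<beta> + (- (q / 2) + - (q / 2)))"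
          by (simp only: powr_add)
        also have "\<beta> + (- (q / 2) + - (q / 2)) = - (q / 2) - 1" by (simp add: \<beta>_def)
        finally show ?thesis by simp
      qed
      have "(S has_real_derivative \<kappa> * (p * f (u r)) * u r powr (- (q / 2)) +
         - (q / 2) * u r powr (- (q / 2) - 1) * v r * (p * v r)) (at r)"
        unfolding S_def p_def[symmetric] using DERIV_mult[OF dw dp] by (simp add: p_def)
      moreover have "\<kappa> * (p * f (u r)) * u r powr (- (q / 2))
          + - (q / 2) * u r powr (- (q / 2) - 1) * v r * (p * v r) = S' r"
      proof -
        have h1: "\<kappa> * (p * f (u r)) * u r powr (- (q / 2)) = \<kappa> * p * u r powr \<beta>"
          unfolding f[symmetric] by (simp add: mult.assoc)
        have h2: "q / 2 * (S r)\<^sup>2 / p = q / 2 * (p * (v r)\<^sup>2 * (u r powr (- (q / 2)))\<^sup>2)"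
        proof -
          have "S r = p * v r * u r powr (- (q / 2))" by (simp add: S_def p_def)
          then show ?thesis using p by (simp add: power2_eq_square)
        qed
        show ?thesis unfolding S'_def p_def[symmetric] g h1 h2
          by (simp add: algebra_simps power2_eq_square)
      qed
      ultimately show ?thesis by simp
    qed
    have S'_ge: "d powr \<beta> * (\<kappa> * \<delta> / 2) \<le> S' r" if r: "1 / 2 \<le> r" "r \<le> 1" and le: "S r \<le> \<sigma>" for r
    proof -
      have "\<delta> \<le> r ^ (n - 1)" unfolding \<delta>_def using r by (intro power_mono) auto
      have S0: "0 \<le> S r" using upos[of r] r by (simp add: S_def)
      have "(S r)\<^sup>2 \<le> \<sigma>\<^sup>2" using le S0 by (intro power_mono) auto
      then have "q / 2 * (S r)\<^sup>2 \<le> q / 2 * \<sigma>\<^sup>2" using q_gt_2 by (intro mult_left_mono) auto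
      then have "q / 2 * (S r)\<^sup>2 / r ^ (n - 1) \<le> q / 2 * \<sigma>\<^sup>2 / \<delta>"
        using \<delta> \<open>\<delta> \<le> r ^ (n - 1)\<close> q_gt_2 by (intro frac_le) auto
      moreover have "\<kappa> * \<delta> \<le> \<kappa> * r ^ (n - 1)" using \<open>\<delta> \<le> r ^ (n - 1)\<close> \<kappa> by (intro mult_left_mono) auto
      ultimately have "\<kappa> * \<delta> / 2 \<le> \<kappa> * r ^ (n - 1) - q / 2 * (S r)\<^sup>2 / r ^ (n - 1)" unfolding \<sigma>(2) by linarith
      moreover have "d powr \<beta> \<le> u r powr \<beta>" using upos(2)[of r] r d \<beta> by (intro powr_mono2) auto
      ultimately show ?thesis unfolding S'_def using \<kappa> \<delta> by (intro mult_mono) auto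
    qed
    have "\<exists>r0. 1 / 2 \<le> r0 \<and> r0 \<le> 3 / 4 \<and> \<sigma> \<le> S r0"
    proof (rule ccontr)
      assume "\<not> ?thesis"
      then have lt: "S r < \<sigma>" if "1 / 2 \<le> r" "r \<le> 3 / 4" for r using that by force
      have "- S (3 / 4) \<le> - S (1 / 2) + - (d powr \<beta> * (\<kappa> * \<delta> / 2)) * (3 / 4 - 1 / 2)"
      proof (rule diff_le_if_deriv_le[OF _ continuous_on_minus[OF cS] DERIV_minus[OF dS]])
        fix r :: real assume r: "1 / 2 < r" "r < 3 / 4"
        show "- S' r \<le> - (d powr \<beta> * (\<kappa> * \<delta> / 2))" using S'_ge[of r] lt[of r] r by simp
      qed simp_all
      moreover have "0 \<le> S (1 / 2)" using upos[of "1 / 2"] by (simp add: S_def)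
      ultimately have "d powr \<beta> * (\<kappa> * \<delta> / 2) * (1 / 4) \<le> S (3 / 4)" by simp
      moreover have "\<sigma> < d powr \<beta> * (\<kappa> * \<delta> / 2) * (1 / 4)" using db(1) \<kappa> \<delta> by (simp add: field_simps)
      ultimately show False using lt[of "3 / 4"] by simp
    qed
    then obtain r0 where r0: "1 / 2 \<le> r0" "r0 \<le> 3 / 4" "\<sigma> \<le> S r0" by blast
    have S_ge: "\<sigma> \<le> S r" if r: "3 / 4 \<le> r" "r \<le> 1" for r
    proof (rule ccontr)
      assume "\<not> \<sigma> \<le> S r"
      then have a: "\<sigma> - S r0 \<le> 0" "0 < \<sigma> - S r" using r0 by auto
      have c: "continuous_on {r0..r} (\<lambda>x. \<sigma> - S x)" using r0 r by (intro continuous_intros cS) auto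
      obtain t where t: "r0 \<le> t" "t < r" "\<sigma> - S t = 0" "\<And>x. t < x \<Longrightarrow> x \<le> r \<Longrightarrow> 0 < \<sigma> - S x"
        using last_zero[OF _ c a] r0 r by auto
      have "S t \<le> S r"
      proof (rule increasing_if_deriv_nonneg[OF _ cS dS])
        fix x assume x: "t < x" "x < r"
        have "0 \<le> d powr \<beta> * (\<kappa> * \<delta> / 2)" using \<kappa> \<delta> by simp
        also have "\<dots> \<le> S' x" using less_imp_le[OF t(4)[of x]] x t(1) r r0 by (intro S'_ge) auto
        finally show "0 \<le> S' x" .
      qed (use t r r0 in auto)
      then show False using t(3) a by simp
    qed
    define A where "A = (\<lambda>r. u r powr (- \<beta>))"
    have "A 1 \<le> A (3 / 4) + - (\<beta> * \<sigma>) * (1 - 3 / 4)"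
    proof (rule diff_le_if_deriv_le)
      have "\<forall>x\<in>{3 / 4..1}. u x \<noteq> 0"
      proof
        fix x :: real assume "x \<in> {3 / 4..1}"
        then show "u x \<noteq> 0" using upos(1)[of x] by auto
      qed
      then show "continuous_on {3 / 4..1} A" unfolding A_def by (intro continuous_intros cu) auto
      fix r :: real assume r: "3 / 4 < r" "r < 1"
      have u: "0 < u r" using upos r by simp
      show "(A has_real_derivative - \<beta> * u r powr (- \<beta> - 1) * v r) (at r)" unfolding A_def
        using DERIV_chain2[OF has_real_derivative_powr[OF u, of "- \<beta>"] radD(4)[OF s, of r]] r by simp
      have "\<sigma> \<le> S r" using S_ge r by simp
      also have "S r = r ^ (n - 1) * (v r * u r powr (- (q / 2)))" by (simp add: S_def)
      also have "\<dots> \<le> 1 * (v r * u r powr (- (q / 2)))"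
        using upos[of r] r by (intro mult_right_mono) (auto simp: power_le_one)
      also have "- (q / 2) = - \<beta> - 1" by (simp add: \<beta>_def)
      finally have "\<beta> * \<sigma> \<le> \<beta> * (v r * u r powr (- \<beta> - 1))" using \<beta> by (intro mult_left_mono) auto
      then show "- \<beta> * u r powr (- \<beta> - 1) * v r \<le> - (\<beta> * \<sigma>)" by (simp add: algebra_simps)
    qed simp
    then have "A 1 \<le> A (3 / 4) - \<beta> * \<sigma> / 4" by simp
    moreover have "0 < A 1" using upos(1)[of 1] by (simp add: A_def)
    moreover have "A (3 / 4) \<le> d powr (- \<beta>)" unfolding A_def
      using upos(2)[of "3 / 4"] d \<beta> by (intro powr_mono2') auto
    ultimately have "\<beta> * \<sigma> / 4 < d powr (- \<beta>)" by linarith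
    then have "\<beta> * \<sigma> / 4 * d powr \<beta> < d powr (- \<beta>) * d powr \<beta>"
      using d by (intro mult_strict_right_mono) auto
    also have "d powr (- \<beta>) * d powr \<beta> = 1" using d by (simp add: powr_add[symmetric])
    finally show False using db(2) \<beta> \<sigma> by (simp add: field_simps)
  qed
  then show ?thesis by blast
qed

definition dstar where "dstar = Sup {d. good d}"

lemma good_iff: "good d \<longleftrightarrow> 0 < d \<and> d < dstar"
proof -
  obtain C where C: "\<And>d. good d \<Longrightarrow> d \<le> C" using good_bounded by blast
  have bdd: "bdd_above {d. good d}" using C by (auto simp: bdd_above_def)
  have ne: "{d. good d} \<noteq> {}" using small_data[of 1] by auto
  show ?thesis
  proof
    assume g: "good d"
    then have d: "0 < d" by (simp add: good_def)
    obtain \<epsilon> where e: "\<epsilon> > 0" "\<And>d'. 0 < d' \<Longrightarrow> \<bar>d' - d\<bar> < \<epsilon> \<Longrightarrow> good d'" using good_open[OF g] by blast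
    have "good (d + \<epsilon> / 2)" using e(1) d by (intro e(2)) auto
    then have "d + \<epsilon> / 2 \<le> dstar" unfolding dstar_def using bdd by (intro cSup_upper) auto
    then show "0 < d \<and> d < dstar" using d e(1) by simp
  next
    assume d: "0 < d \<and> d < dstar"
    then obtain d2 where "good d2" "d < d2" using less_cSup_iff[OF ne bdd, of d] by (auto simp: dstar_def)
    then show "good d" using sol_scale[of d2 d] d by metis
  qed
qed

lemma dstar_pos: "0 < dstar"
  using small_data[of 1] good_iff by fastforce

text \<open>
  If \<open>u(1,d)\<close> were bounded for all admissible \<open>d\<close>, then by continuity the solution with the initial value \<open>dstar\<close>, which is not
  admissible, would also exist up to \<open>r = 1\<close>.
\<close>

lemma large_data: "\<exists>d. good d \<and> m < fst (sol d) 1"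
proof (rule ccontr)
  assume "\<not> ?thesis"
  then have le: "fst (sol d) 1 \<le> m" if "good d" for d using that by force
  define M where "M = max m 0 + 1"
  have M: "0 < M" "m < M" by (auto simp: M_def)
  obtain C where C: "C > 0" "\<And>d d'. \<bar>fst (tsol M d) 1 - fst (tsol M d') 1\<bar> \<le> C * \<bar>d - d'\<bar>"
    using tsol_lipschitz[OF M(1)] by blast
  have "fst (tsol M dstar) 1 < M"
  proof -
    define h where "h = min (dstar / 2) ((M - m) / (2 * C))"
    have h: "0 < h" "h < dstar" "C * h \<le> (M - m) / 2"
    proof -
      show "0 < h" using dstar_pos M C by (simp add: h_def)
      have "h \<le> dstar / 2" by (simp add: h_def)
      then show "h < dstar" using dstar_pos by linarith
      have "C * h \<le> C * ((M - m) / (2 * C))" using C by (intro mult_left_mono) (auto simp: h_def)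
      then show "C * h \<le> (M - m) / 2" using C by simp
    qed
    have g: "good (dstar - h)" using h good_iff by simp
    then have "fst (tsol M (dstar - h)) 1 \<le> m" using le[OF g] tsol_eq_sol[OF g, of M] M by simp
    then show ?thesis using C(2)[of dstar "dstar - h"] h M by simp
  qed
  then have "good dstar" using good_if_tsol_small[OF M(1) dstar_pos] by simp
  then show False using good_iff by simp
qed

text \<open>
  By scaling, all solutions with initial values below \<open>d2\<close> are bounded by \<open>u(1,d2)\<close> on \<open>[0, 1]\<close>, so they have a common
  Lipschitz constant in the Gronwall estimate.
\<close>

lemma sol_lipschitz:
  assumes g2: "good d2"
  shows "\<exists>C>0. \<forall>d d'. 0 < d \<longrightarrow> d < d2 \<longrightarrow> 0 < d' \<longrightarrow> d' < d2 \<longrightarrow>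
    \<bar>fst (sol d) 1 - fst (sol d') 1\<bar> \<le> C * \<bar>d - d'\<bar> \<and> \<bar>snd (sol d) 1 - snd (sol d') 1\<bar> \<le> C * \<bar>d - d'\<bar>"
proof -
  define M where "M = fst (sol d2) 1"
  have M: "0 < M" unfolding M_def using sol_positive(4)[OF g2, of 1] by simp
  have bound: "\<bar>fst (sol d) r\<bar> \<le> M" "good d" if d: "0 < d" "d < d2" and r: "0 \<le> r" "r \<le> 1" for d r
  proof -
    obtain c where c: "0 < c" "c < 1" "good d" "\<And>r. 0 \<le> r \<Longrightarrow> r \<le> 1
        \<Longrightarrow> fst (sol d) r = c powr alpha * fst (sol d2) (c * r)"
      using sol_scale[OF g2 d] by metis
    show "good d" by (rule c(3))
    have cr: "0 \<le> c * r" "c * r \<le> 1" using c r by (auto simp: mult_le_one)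
    have ca: "c powr alpha \<le> 1" using c alpha_pos by (intro powr_le1) auto
    have "fst (sol d) r \<le> 1 * fst (sol d2) (c * r)" unfolding c(4)[OF r]
      using sol_positive(4)[OF g2 cr] ca by (intro mult_right_mono) auto
    also have "\<dots> \<le> M" unfolding M_def using sol_positive(2)[OF g2 cr] by simp
    finally show "\<bar>fst (sol d) r\<bar> \<le> M" using sol_positive(4)[OF c(3) r] by simp
  qed
  define L where "L = (q - 1) * M powr (q - 2)"
  have L: "0 \<le> L" using q_gt_2 by (simp add: L_def)
  define E where "E = exp ((1 + (\<bar>K1\<bar> + \<bar>K2\<bar>) * L) * 1)"
  have E: "0 < E" by (simp add: E_def)
  have "\<bar>fst (sol d) 1 - fst (sol d') 1\<bar> \<le> sqrt E * \<bar>d - d'\<bar>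
      \<and> \<bar>snd (sol d) 1 - snd (sol d') 1\<bar> \<le> sqrt E * \<bar>d - d'\<bar>"
    if d: "0 < d" "d < d2" "0 < d'" "d' < d2" for d d'
  proof -
    have g: "good d" "good d'" using bound(2)[of d 0] bound(2)[of d' 0] d by auto
    have "(fst (sol d) 1 - fst (sol d') 1)\<^sup>2 + (snd (sol d) 1 - snd (sol d') 1)\<^sup>2
        \<le> E * (fst (sol d) 0 - fst (sol d') 0)\<^sup>2"
      unfolding E_def
    proof (rule rad_gronwall[OF sol(2)[OF g(1)] sol(2)[OF g(2)] L])
      fix r :: real assume "0 < r" "r < 1"
      then show "\<bar>f (fst (sol d) r) - f (fst (sol d') r)\<bar> \<le> L * \<bar>fst (sol d) r - fst (sol d') r\<bar>"
        unfolding L_def using bound(1)[of d r] bound(1)[of d' r] d by (intro odd_power_lipschitz q_gt_2) auto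
    qed auto
    then have "(fst (sol d) 1 - fst (sol d') 1)\<^sup>2 + (snd (sol d) 1 - snd (sol d') 1)\<^sup>2 \<le> E * (d - d')\<^sup>2"
      using sol(1)[OF g(1)] sol(1)[OF g(2)] by simp
    also have "E * (d - d')\<^sup>2 = (sqrt E * \<bar>d - d'\<bar>)\<^sup>2" using E by (simp add: power_mult_distrib)
    finally have *: "(fst (sol d) 1 - fst (sol d') 1)\<^sup>2 + (snd (sol d) 1 - snd (sol d') 1)\<^sup>2
        \<le> (sqrt E * \<bar>d - d'\<bar>)\<^sup>2" .
    have nn: "0 \<le> sqrt E * \<bar>d - d'\<bar>" using E by simp
    have "\<bar>fst (sol d) 1 - fst (sol d') 1\<bar>\<^sup>2 \<le> (sqrt E * \<bar>d - d'\<bar>)\<^sup>2"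
        "\<bar>snd (sol d) 1 - snd (sol d') 1\<bar>\<^sup>2 \<le> (sqrt E * \<bar>d - d'\<bar>)\<^sup>2"
      using * zero_le_power2[of "fst (sol d) 1 - fst (sol d') 1"] zero_le_power2[of
          "snd (sol d) 1 - snd (sol d') 1"]
      unfolding power2_abs by linarith+
    then show ?thesis using power2_le_imp_le[OF _ nn] by blast
  qed
  then show ?thesis using E by (intro exI[of _ "sqrt E"]) auto
qed

lemma sol_continuous:
  assumes "0 < d" "d < dstar"
  shows "isCont (\<lambda>d. fst (sol d) 1) d" "isCont (\<lambda>d. snd (sol d) 1) d"
proof -
  obtain d2 where d2: "d < d2" "d2 < dstar" using assms dense by blast
  then have "good d2" using good_iff assms by simp
  then obtain C where C: "C > 0" "\<And>d d'. 0 < d \<Longrightarrow> d < d2 \<Longrightarrow> 0 < d' \<Longrightarrow> d' < d2 \<Longrightarrow>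
    \<bar>fst (sol d) 1 - fst (sol d') 1\<bar> \<le> C * \<bar>d - d'\<bar> \<and> \<bar>snd (sol d) 1 - snd (sol d') 1\<bar> \<le> C * \<bar>d - d'\<bar>"
    using sol_lipschitz by metis
  have "eventually (\<lambda>d'. d' \<in> {0<..<d2}) (at d)"
    using assms d2 by (intro eventually_at_in_open') auto
  then have ev: "eventually (\<lambda>d'. \<bar>fst (sol d') 1 - fst (sol d) 1\<bar> \<le> C * \<bar>d' - d\<bar> \<and>
      \<bar>snd (sol d') 1 - snd (sol d) 1\<bar> \<le> C * \<bar>d' - d\<bar>) (at d)"
    by eventually_elim (use C(2) assms d2 in auto)
  have lim: "((\<lambda>d'. C * \<bar>d' - d\<bar>) \<longlongrightarrow> 0) (at d)"
  proof -
    have "((\<lambda>d'. C * \<bar>d' - d\<bar>) \<longlongrightarrow> C * \<bar>d - d\<bar>) (at d)" by (intro tendsto_intros)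
    then show ?thesis by simp
  qed
  have "((\<lambda>d'. fst (sol d') 1 - fst (sol d) 1) \<longlongrightarrow> 0) (at d)"
    by (rule Lim_null_comparison[OF _ lim]) (use ev in \<open>auto elim!: eventually_mono\<close>)
  then show "isCont (\<lambda>d. fst (sol d) 1) d" by (simp add: isCont_def LIM_zero_iff)
  have "((\<lambda>d'. snd (sol d') 1 - snd (sol d) 1) \<longlongrightarrow> 0) (at d)"
    by (rule Lim_null_comparison[OF _ lim]) (use ev in \<open>auto elim!: eventually_mono\<close>)
  then show "isCont (\<lambda>d. snd (sol d) 1) d" by (simp add: isCont_def LIM_zero_iff)
qed

lemma slope_le_at_1:
  assumes g: "good d"
  shows "snd (sol d) 1 \<le> - K1 * f (fst (sol d) 1)"
proof -
  have s: "rad f 2 (fst (sol d)) (snd (sol d))" by (rule sol(2)[OF g])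
  have "1 ^ (n - 1) * snd (sol d) 1 \<le> 0 ^ (n - 1) * snd (sol d) 0 + (- K1 * f (fst (sol d) 1)) * (1 - 0)"
  proof (rule diff_le_if_deriv_le[where f = "\<lambda>x. x ^ (n - 1) * snd (sol d) x"])
    show "continuous_on {0..1} (\<lambda>x. x ^ (n - 1) * snd (sol d) x)"
      by (intro continuous_intros continuous_on_subset[OF radD(2)[OF s]]) auto
    fix x :: real assume x: "0 < x" "x < 1"
    then show "((\<lambda>x. x ^ (n - 1) * snd (sol d) x) has_real_derivative
      - k_coeff K1 K2 x * (x ^ (n - 1) * f (fst (sol d) x))) (at x)"
      by (intro weighted_slope_deriv[OF s]) auto
    have "x ^ (n - 1) * f (fst (sol d) x) \<le> 1 * f (fst (sol d) 1)"
      using x sol_positive(2)[OF g, of x 1] sol_positive(4)[OF g, of x]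
      by (intro mult_mono f_mono f_nonneg) (auto simp: power_le_one)
    then have "- K1 * (x ^ (n - 1) * f (fst (sol d) x)) \<le> - K1 * f (fst (sol d) 1)"
      using K1_neg by (intro mult_left_mono) auto
    then show "- k_coeff K1 K2 x * (x ^ (n - 1) * f (fst (sol d) x)) \<le> - K1 * f (fst (sol d) 1)"
      using x by (simp add: k_coeff_def)
  qed simp
  then show ?thesis using radD(3)[OF s] by simp
qed

end

section \<open>The Fowler transformation\<close>

sublocale radial \<subseteq> ef: emden_fowler alpha lam K2 q
  by unfold_locales (rule alpha_pos alpha_less_lam K2_pos q_gt_2)+

context radial
begin

definition fowler :: "(real \<Rightarrow> real) \<Rightarrow> real \<Rightarrow> real" where
  "fowler u t = exp (alpha * t) * u (exp t)"

definition fowler_velocity :: "(real \<Rightarrow> real) \<Rightarrow> (real \<Rightarrow> real) \<Rightarrow> real \<Rightarrow> real" where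
  "fowler_velocity u v t = exp (alpha * t) * (alpha * u (exp t) + exp t * v (exp t))"

text \<open>
  The last term vanishes for \<open>r > 1\<close>; for \<open>r < 1\<close> it is the upward force in \<open>outside_by_forcing\<close>.
\<close>

lemma fowler_deriv:
  assumes s: "rad f R u v" and t: "exp t < R"
  shows "(fowler u has_real_derivative fowler_velocity u v t) (at t)"
    and "exp t \<noteq> 1 \<Longrightarrow> (fowler_velocity u v has_real_derivative
      ef.restoring (fowler u t) - ef.damping * fowler_velocity u v t + (K2 - k_coeff K1 K2 (exp t)) * f (fowler u t)) (at t)"
proof -
  have de: "((\<lambda>t. exp (alpha * t)) has_real_derivative exp (alpha * t) * alpha) (at t)"
    by (auto intro!: derivative_eq_intros)
  have dx: "(exp has_real_derivative exp t) (at t)" by (rule DERIV_exp)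
  have du: "((\<lambda>t. u (exp t)) has_real_derivative v (exp t) * exp t) (at t)"
    by (rule DERIV_chain2[OF radD(4)[OF s exp_gt_zero t] dx])
  show "(fowler u has_real_derivative fowler_velocity u v t) (at t)"
    unfolding fowler_def[abs_def] fowler_velocity_def
    by (rule DERIV_cong[OF DERIV_mult[OF de du]]) (simp add: algebra_simps)
  assume ne: "exp t \<noteq> 1"
  define E where "E = exp (alpha * t)"
  define r where "r = exp t"
  define N where "N = real n - 1"
  define k where "k = k_coeff K1 K2 r"
  have r: "0 < r" by (simp add: r_def)
  have dv: "((\<lambda>t. v (exp t)) has_real_derivative (- (N / r) * v r - k * f (u r)) * r) (at t)"
    unfolding N_def k_def r_def by (rule DERIV_chain2[OF radD(5)[OF s exp_gt_zero t ne] dx])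
  have dY: "(fowler_velocity u v has_real_derivative
      E * alpha * (alpha * u r + r * v r) + (alpha * (v r * r) + (r * v r + (- (N / r) * v r - k * f (u r)) * r * r)) * E) (at t)"
    unfolding fowler_velocity_def[abs_def] E_def r_def
    by (rule DERIV_cong[OF DERIV_mult[OF de DERIV_add[OF DERIV_cmult[OF du, of alpha] DERIV_mult[OF dx dv]]]])
       (simp add: r_def)
  have fX: "f (fowler u t) = E * r\<^sup>2 * f (u r)"
  proof -
    have "f (fowler u t) = E powr (q - 1) * f (u r)"
      unfolding fowler_def E_def r_def by (rule odd_power_mult) simp
    also have "E powr (q - 1) = exp (alpha * (q - 1) * t)" by (simp add: E_def exp_powr_real algebra_simps)
    also have "alpha * (q - 1) = alpha + 2" using q_gt_2 by (simp add: alpha_def field_simps)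
    also have "exp ((alpha + 2) * t) = E * r\<^sup>2"
      by (simp add: E_def r_def power2_eq_square exp_add[symmetric] algebra_simps)
    finally show ?thesis by simp
  qed
  have X: "fowler u t = E * u r" and Y: "fowler_velocity u v t = E * (alpha * u r + r * v r)"
    by (simp_all add: fowler_def fowler_velocity_def E_def r_def)
  have eq: "E * alpha * (alpha * u r + r * v r) + (alpha * (v r * r) + (r * v r
      + (- (N / r) * v r - k * f (u r)) * r * r)) * E
    = ef.restoring (fowler u t) - ef.damping * fowler_velocity u v t + (K2 - k) * f (fowler u t)"
  proof -
    have Nr: "(- (N / r) * v r - k * f (u r)) * r * r = - N * r * v r - k * (r\<^sup>2 * f (u r))"
      using r by (simp add: field_simps power2_eq_square)
    have N: "N = lam + alpha + 1" by (simp add: N_def lam_def)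
    have R: "ef.restoring (fowler u t) = alpha * lam * (E * u r) - K2 * (E * r\<^sup>2 * f (u r))"
      unfolding ef.restoring_def fX unfolding X by simp
    show ?thesis unfolding Nr unfolding R N fX Y ef.damping_def by (simp add: algebra_simps power2_eq_square)
  qed
  show "(fowler_velocity u v has_real_derivative
      ef.restoring (fowler u t) - ef.damping * fowler_velocity u v t + (K2 - k_coeff K1 K2 (exp t)) * f (fowler u t)) (at t)"
    using dY unfolding eq by (simp add: k_def r_def)
qed

lemma fowler_cont:
  assumes "\<And>R. rad f R u v"
  shows "continuous_on S (fowler u)" "continuous_on S (fowler_velocity u v)"
proof -
  have c: "continuous_on {0..} u" "continuous_on {0..} v"
    using continuous_on_half_line radD(1,2)[OF assms] by blast+
  have cuv: "continuous_on S (\<lambda>t. u (exp t))" "continuous_on S (\<lambda>t. v (exp t))"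
    by (rule continuous_on_compose2[OF c(1)] continuous_on_compose2[OF c(2)]; auto intro!: continuous_intros)+
  show "continuous_on S (fowler u)" unfolding fowler_def[abs_def] by (intro continuous_intros cuv)
  show "continuous_on S (fowler_velocity u v)" unfolding fowler_velocity_def[abs_def]
      by (intro continuous_intros cuv)
qed

abbreviation xs where "xs d \<equiv> fowler (fst (sol d))"
abbreviation ys where "ys d \<equiv> fowler_velocity (fst (sol d)) (snd (sol d))"

lemma fowler_traj:
  assumes "good d"
  shows "ef.traj (xs d) (ys d)"
  unfolding ef.traj_def
proof (intro conjI allI impI)
  note s = sol(2)[OF assms]
  show "continuous_on {0..} (xs d)" "continuous_on {0..} (ys d)"
      using fowler_cont[of "fst (sol d)" "snd (sol d)"] s by auto
  fix t :: real assume t: "0 < t"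
  show "(xs d has_real_derivative ys d t) (at t)" by (rule fowler_deriv(1)[OF s[of "exp t + 1"]]) simp
  have "1 < exp t" using t by simp
  then have k: "k_coeff K1 K2 (exp t) = K2" "exp t \<noteq> 1" by (auto simp: k_coeff_def)
  show "(ys d has_real_derivative ef.restoring (xs d t) - ef.damping * ys d t) (at t)"
    using fowler_deriv(2)[OF s[of "exp t + 1"] _ k(2)] k(1) by simp
qed

lemma fowler_0: "fowler u 0 = u 1" "fowler_velocity u v 0 = alpha * u 1 + v 1"
  by (simp_all add: fowler_def fowler_velocity_def)

text \<open>
  By scaling, the initial point for \<open>d1\<close> lies on the curve that the solution for \<open>d2\<close> traces for \<open>r \<le> 1\<close>, at
  \<open>r = c\<close>. From there to \<open>r = 1\<close> this curve is an orbit of the \<open>K\<^sub>1\<close>-system.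
\<close>

lemma fowler_outside:
  assumes g: "good d2" and d: "0 < d1" "d1 < d2"
  shows "ef.outside (xs d1) (ys d1) (xs d2) (ys d2)"
proof -
  obtain c where c: "0 < c" "c < 1" "good d1"
    "\<And>r. 0 \<le> r \<Longrightarrow> r \<le> 1 \<Longrightarrow> fst (sol d1) r = c powr alpha * fst (sol d2) (c * r)"
    "\<And>r. 0 \<le> r \<Longrightarrow> r \<le> 1 \<Longrightarrow> snd (sol d1) r = c powr alpha * c * snd (sol d2) (c * r)"
    using sol_scale[OF g d] by metis
  have ec: "exp (ln c) = c" "exp (alpha * ln c) = c powr alpha" "ln c < 0" using c by (auto simp: powr_def)
  note s = sol(2)[OF g]
  have e1: "exp t \<le> 1" if "t \<le> 0" for t :: real using that by simp
  show ?thesis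
  proof (rule ef.outside_by_forcing[OF fowler_traj[OF c(3)] fowler_traj[OF g] ec(3),
      where X = "xs d2" and Y = "ys d2" and p = "\<lambda>t. (K2 - K1) * f (xs d2 t)"])
    show "continuous_on {ln c..0} (xs d2)" "continuous_on {ln c..0} (ys d2)"
      using fowler_cont[of "fst (sol d2)" "snd (sol d2)"] s by auto
    show "(xs d2 has_real_derivative ys d2 t) (at t)" for t by (rule fowler_deriv(1)[OF s[of "exp t + 1"]]) simp
    show "(ys d2 has_real_derivative ef.restoring (xs d2 t) - ef.damping * ys d2 t
        + (K2 - K1) * f (xs d2 t)) (at t)"
      if "t < 0" for t
    proof -
      have "exp t < 1" using that by simp
      then show ?thesis using fowler_deriv(2)[OF s[of "exp t + 1"], of t] by (simp add: k_coeff_def)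
    qed
    have xpos: "0 < xs d2 t" if "t \<le> 0" for t
      using sol_positive(4)[OF g, of "exp t"] e1[OF that] by (simp add: fowler_def)
    show "0 < (K2 - K1) * f (xs d2 t)" if "t < 0" for t
      using K1_neg K2_pos odd_power_pos[OF xpos, of t q] that by (intro mult_pos_pos) auto
    show "0 < ys d2 t" if "t \<le> 0" for t
    proof -
      have "0 < alpha * fst (sol d2) (exp t)" using sol_positive(4)[OF g, of "exp t"] e1[OF that] alpha_pos
          by simp
      moreover have "0 \<le> exp t * snd (sol d2) (exp t)" using sol_positive(1)[OF g, of "exp t"] e1[OF that]
          by simp
      ultimately show ?thesis by (simp add: fowler_velocity_def)
    qed
    show "xs d2 (ln c) = xs d1 0" "ys d2 (ln c) = ys d1 0"
      using c(4)[of 1] c(5)[of 1] ec c(1) by (simp_all add: fowler_def fowler_velocity_def algebra_simps)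
    show "0 \<le> xs d1 0" using sol_positive(4)[OF c(3), of 1] by (simp add: fowler_0)
  qed auto
qed

lemma fowler_energy_large: "\<exists>d. 0 < d \<and> d < dstar \<and> R \<le> ef.energy (xs d 0) (ys d 0)"
proof -
  obtain C where C: "\<And>x. x\<^sup>2 / 2 - C \<le> ef.potential x" using ef.potential_coercive by blast
  define m where "m = 1 + 2 * \<bar>R + C\<bar>"
  obtain d where d: "good d" "m < fst (sol d) 1" using large_data by blast
  have "m * 1 \<le> m * m" by (rule mult_left_mono) (auto simp: m_def)
  also have "m * m \<le> (xs d 0)\<^sup>2" unfolding power2_eq_square using d(2)
    sol_positive(4)[OF d(1), of 1] by (intro mult_mono) (auto simp: fowler_0 m_def)
  finally have "m \<le> (xs d 0)\<^sup>2" by simp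
  moreover have "2 * R + 2 * C \<le> m" using mult_left_mono[OF abs_ge_self[of "R + C"], of 2] by (simp add: m_def)
  ultimately have "2 * R + 2 * C \<le> (xs d 0)\<^sup>2" by linarith
  then have "R \<le> ef.potential (xs d 0)" using C[of "xs d 0"] by linarith
  then have "R \<le> ef.energy (xs d 0) (ys d 0)" unfolding ef.energy_def using zero_le_power2[of "ys d 0"]
      by linarith
  then show ?thesis using d(1) good_iff by blast
qed

text \<open>
  For small \<open>m = u(1,d)\<close> the slope at \<open>r = 1\<close> is \<open>O(m\<^bsup>q-1\<^esup>)\<close>, so \<open>(x, y)\<close> is close to \<open>(m, alpha m)\<close> and the energy to
  \<open>alpha(alpha - lam)m\<^sup>2/2 < 0\<close>. The function \<open>h\<close> of \<open>\<epsilon> = m\<^bsup>q-2\<^esup>\<close> keeps track of the corrections.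
\<close>

lemma fowler_energy_negative: "\<exists>d. 0 < d \<and> d < dstar \<and> ef.energy (xs d 0) (ys d 0) < 0"
proof -
  define h where "h = (\<lambda>\<epsilon>. (alpha - K1 * \<epsilon>)\<^sup>2 / 2 - alpha * lam / 2 + K2 * \<epsilon> / q)"
  have "isCont h 0" unfolding h_def by (intro continuous_intros) (use q_gt_2 in auto)
  moreover have "h 0 < 0"
  proof -
    have "alpha * alpha < alpha * lam" using alpha_pos alpha_less_lam by simp
    then show ?thesis by (simp add: h_def power2_eq_square)
  qed
  ultimately have "eventually (\<lambda>\<epsilon>. h \<epsilon> < 0) (at 0)"
    using order_tendstoD(2)[of h "h 0" "at 0" 0] by (simp add: isCont_def)
  then obtain \<epsilon>0 where e0: "\<epsilon>0 > 0" "\<And>\<epsilon>. \<epsilon> \<noteq> 0 \<Longrightarrow> \<bar>\<epsilon>\<bar> < \<epsilon>0 \<Longrightarrow> h \<epsilon> < 0"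
    by (auto simp: eventually_at dist_real_def)
  obtain d where d: "good d" "fst (sol d) 1 < \<epsilon>0 powr (1 / (q - 2))"
      using small_data[of "\<epsilon>0 powr (1 / (q - 2))"] e0(1) by auto
  define m where "m = fst (sol d) 1"
  define v where "v = snd (sol d) 1"
  define \<epsilon> where "\<epsilon> = m powr (q - 2)"
  have m: "0 < m" unfolding m_def using sol_positive(4)[OF d(1), of 1] by simp
  have v: "0 \<le> v" "v \<le> - K1 * f m" unfolding v_def m_def
      using sol_positive(1)[OF d(1), of 1] slope_le_at_1[OF d(1)] by auto
  have e: "0 < \<epsilon>" using m by (simp add: \<epsilon>_def)
  have "\<epsilon> < (\<epsilon>0 powr (1 / (q - 2))) powr (q - 2)"
    unfolding \<epsilon>_def using d(2) m q_gt_2 by (intro powr_less_mono2) (auto simp: m_def)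
  then have "\<epsilon> < \<epsilon>0" using e0(1) q_gt_2 by (simp add: powr_powr)
  then have h: "h \<epsilon> < 0" using e0(2)[of \<epsilon>] e by simp
  have "f m = m * \<epsilon>" using m by (simp add: odd_power_def \<epsilon>_def)
  then have y: "0 \<le> ys d 0" "ys d 0 \<le> m * (alpha - K1 * \<epsilon>)"
    using v m alpha_pos by (simp_all add: fowler_0 m_def[symmetric] v_def[symmetric] algebra_simps)
  have "(ys d 0)\<^sup>2 \<le> (m * (alpha - K1 * \<epsilon>))\<^sup>2" using y by (intro power_mono) auto
  then have y2: "(ys d 0)\<^sup>2 / 2 \<le> m\<^sup>2 * ((alpha - K1 * \<epsilon>)\<^sup>2 / 2)" by (simp add: power_mult_distrib)
  have "ef.potential (xs d 0) = m\<^sup>2 * (K2 * \<epsilon> / q - alpha * lam / 2)"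
    using ef.potential_eq[OF m] by (simp add: fowler_0 m_def[symmetric] \<epsilon>_def)
  then have "ef.energy (xs d 0) (ys d 0) \<le> m\<^sup>2 * ((alpha - K1 * \<epsilon>)\<^sup>2 / 2)
      + m\<^sup>2 * (K2 * \<epsilon> / q - alpha * lam / 2)"
    using y2 by (simp add: ef.energy_def)
  also have "\<dots> = m\<^sup>2 * h \<epsilon>" by (simp add: h_def algebra_simps)
  also have "\<dots> < 0" using m h by (simp add: mult_pos_neg)
  finally show ?thesis using d(1) good_iff by blast
qed

lemma shooting_structure:
  "\<exists>D. strict_mono D \<and> (\<forall>k::nat. 0 < D k \<and> D k < dstar \<and> ef.fast (xs (D k)) (ys (D k))
      \<and> card (ef.zeros (xs (D k))) = k) \<and>
     (\<forall>d. 0 < d \<and> d < D 0 \<longrightarrow> \<not> ef.fast (xs d) (ys d) \<and> card (ef.zeros (xs d)) = 0) \<and>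
     (\<forall>k d. D k < d \<and> d < D (Suc k) \<longrightarrow> \<not> ef.fast (xs d) (ys d) \<and> card (ef.zeros (xs d)) = Suc k)"
proof (rule ef.shooting[OF dstar_pos])
  fix d assume d: "0 < d" "d < dstar"
  then have g: "good d" using good_iff by simp
  show "ef.traj (xs d) (ys d)" by (rule fowler_traj[OF g])
  show "0 < xs d 0" using sol_positive(4)[OF g, of 1] by (simp add: fowler_0)
  show "isCont (\<lambda>d. xs d 0) d" "isCont (\<lambda>d. ys d 0) d"
    unfolding fowler_0 by (intro continuous_intros sol_continuous[OF d])+
next
  show "ef.outside (xs d) (ys d) (xs d') (ys d')" if "0 < d" "d < d'" "d' < dstar" for d d'
    using that good_iff by (intro fowler_outside) auto
qed (rule fowler_energy_large fowler_energy_negative)+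

section \<open>Transfer to the maximally continued regular solution\<close>

lemma rad_of_regular_solution:
  assumes reg: "regular_solution n q K1 K2 {0..<R} d u" and R': "R' < R"
  shows "\<exists>v. rad f R' u v"
proof -
  have du0: "(u has_real_derivative 0) (at 0 within {0..<R})" and "0 \<in> {0..<R}"
    using reg by (auto simp: regular_solution_def)
  then have R: "0 < R" by simp
  obtain v where v: "\<And>r. r \<in> {0..<R} \<Longrightarrow> (u has_real_derivative v r) (at r within {0..<R})"
    "continuous_on {0..<R} v"
    "\<And>r. r \<in> {0..<R} - {0, 1} \<Longrightarrow> \<exists>w. (v has_real_derivative w) (at r) \<and>
        w + (real n - 1) / r * v r + k_coeff K1 K2 r * (u r * \<bar>u r\<bar> powr (q - 2)) = 0"
    using reg unfolding regular_solution_def radial_solution_def by blast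
  have "v 0 = 0"
  proof -
    have "at (0::real) within {0..<R} = at 0 within {0..}"
      by (rule at_within_nhd[of _ "{..<R}"]) (use R in auto)
    also have "\<dots> = at_right 0" by (rule at_within_Ici_at_right)
    finally have nb: "at (0::real) within {0..<R} \<noteq> bot" by simp
    show ?thesis using tendsto_unique[OF nb] v(1)[of 0] du0 R unfolding has_field_derivative_iff by auto
  qed
  moreover have "(u has_real_derivative v r) (at r within {0..R'})" if "r \<in> {0..R'}" for r
    by (rule DERIV_subset[OF v(1)]) (use that R' in auto)
  moreover have "continuous_on {0..R'} v" by (rule continuous_on_subset[OF v(2)]) (use R' in auto)
  moreover have "(v has_real_derivative - ((real n - 1) / r) * v r - k_coeff K1 K2 r * f (u r)) (at r)"
    if r: "0 < r" "r < R'" "r \<noteq> 1" for r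
  proof -
    obtain w where w: "(v has_real_derivative w) (at r)"
      "w + (real n - 1) / r * v r + k_coeff K1 K2 r * (u r * \<bar>u r\<bar> powr (q - 2)) = 0"
      using v(3)[of r] r R' by auto
    have "w = - ((real n - 1) / r) * v r - k_coeff K1 K2 r * f (u r)"
      using w(2) by (simp add: odd_power_def)
    then show ?thesis using w(1) by simp
  qed
  ultimately show ?thesis unfolding rad_def by blast
qed

lemma regular_solution_of_rad:
  assumes s: "\<And>R. rad f R u v" and eq: "\<And>r. 0 \<le> r \<Longrightarrow> w r = u r"
    and I: "I \<subseteq> {0..}" "0 \<in> I"
  shows "regular_solution n q K1 K2 I (u 0) w"
proof -
  have du: "(w has_real_derivative v r) (at r within I)" if r: "r \<in> I" for r
  proof -
    have r0: "0 \<le> r" using r I by auto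
    have "(u has_real_derivative v r) (at r within {0..r + 1})" using s[of "r + 1"] r0 by (simp add: rad_def)
    moreover have "at r within {0..r + 1} = at r within {0..}"
      by (rule at_within_nhd[of _ "{..<r + 1}"]) auto
    ultimately have "(u has_real_derivative v r) (at r within {0..})" by simp
    then have "(u has_real_derivative v r) (at r within I)" by (rule DERIV_subset[OF _ I(1)])
    then show ?thesis
      by (rule has_field_derivative_transform_within[of _ _ _ _ 1]) (use r I eq in auto)
  qed
  have cv: "continuous_on I v"
    by (rule continuous_on_subset[OF continuous_on_half_line[OF radD(2)[OF s]] I(1)])
  have ode: "\<exists>w'. (v has_real_derivative w') (at r) \<and>
      w' + (real n - 1) / r * v r + k_coeff K1 K2 r * (w r * \<bar>w r\<bar> powr (q - 2)) = 0" if r: "r \<in> I - {0, 1}" for r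
  proof -
    have r0: "0 < r" "r \<noteq> 1" using r I by (auto simp: order.order_iff_strict)
    have "(v has_real_derivative - ((real n - 1) / r) * v r - k_coeff K1 K2 r * f (u r)) (at r)"
      by (rule radD(5)[OF s[of "r + 1"]]) (use r0 in auto)
    then show ?thesis using eq[of r] r0 by (intro exI conjI) (assumption, simp add: odd_power_def)
  qed
  have "radial_solution n q K1 K2 I w"
    unfolding radial_solution_def using I(1) du cv ode by (intro conjI exI[of _ v] ballI) blast+
  moreover have "v 0 = 0" using radD(3)[OF s] .
  ultimately show ?thesis unfolding regular_solution_def using I(2) eq[of 0] du[OF I(2)] by simp
qed

lemma reg_sol_eq:
  assumes g: "good d" and r: "0 \<le> r"
  shows "reg_sol n q K1 K2 d r = fst (sol d) r"
  unfolding reg_sol_def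
proof (rule the_equality)
  have "regular_solution n q K1 K2 {0..<r + 1} (fst (sol d) 0) (fst (sol d))"
    by (rule regular_solution_of_rad[OF sol(2)[OF g]]) (use r in auto)
  then show "\<exists>R u. r < R \<and> regular_solution n q K1 K2 {0..<R} d u \<and> u r = fst (sol d) r"
    using sol(1)[OF g] by (intro exI[of _ "r + 1"] exI[of _ "fst (sol d)"]) simp
  fix y assume "\<exists>R u. r < R \<and> regular_solution n q K1 K2 {0..<R} d u \<and> u r = y"
  then obtain R u where u: "r < R" "regular_solution n q K1 K2 {0..<R} d u" "u r = y" by blast
  obtain v where v: "rad f r u v" using rad_of_regular_solution[OF u(2,1)] by blast
  have "u 0 = d" using u(2) by (simp add: regular_solution_def)
  then have "u r = fst (sol d) r"
    using rad_unique(1)[OF v sol(2)[OF g] _ r order_refl] sol(1)[OF g] by simp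
  then show "y = fst (sol d) r" using u(3) by simp
qed

lemma reg_sol_regular:
  assumes g: "good d"
  shows "regular_solution n q K1 K2 {0..} d (reg_sol n q K1 K2 d)"
  using regular_solution_of_rad[OF sol(2)[OF g], of "reg_sol n q K1 K2 d"
      "{0..}"] reg_sol_eq[OF g] sol(1)[OF g] by auto

lemma reg_sol_radial:
  assumes g: "good d"
  shows "\<exists>R. radial_solution n q K1 K2 {R<..} (reg_sol n q K1 K2 d)"
proof -
  define u where "u = reg_sol n q K1 K2 d"
  obtain v where v: "\<And>r. r \<in> {0..} \<Longrightarrow> (u has_real_derivative v r) (at r within {0..})"
    "continuous_on {0..} v"
    "\<And>r. r \<in> {0..} - {0, 1} \<Longrightarrow> \<exists>w. (v has_real_derivative w) (at r) \<and>
        w + (real n - 1) / r * v r + k_coeff K1 K2 r * (u r * \<bar>u r\<bar> powr (q - 2)) = 0"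
    using reg_sol_regular[OF g] unfolding regular_solution_def radial_solution_def u_def by blast
  have "(u has_real_derivative v r) (at r within {0<..})" if "r \<in> {0<..}" for r
    by (rule DERIV_subset[OF v(1)]) (use that in auto)
  moreover have "continuous_on {0<..} v" by (rule continuous_on_subset[OF v(2)]) auto
  moreover have "\<exists>w. (v has_real_derivative w) (at r) \<and>
        w + (real n - 1) / r * v r + k_coeff K1 K2 r * (u r * \<bar>u r\<bar> powr (q - 2)) = 0" if "r \<in> {0<..} - {0, 1}" for r
    using that by (intro v(3)) auto
  ultimately have "radial_solution n q K1 K2 {0<..} u" unfolding radial_solution_def by auto
  then show ?thesis unfolding u_def by blast
qed

lemma reg_sol_fowler:
  assumes g: "good d" and r: "0 < r"
  shows "reg_sol n q K1 K2 d r = exp (- (alpha * ln r)) * xs d (ln r)"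
    "reg_sol n q K1 K2 d r * r ^ (n - 2) = exp (lam * ln r) * xs d (ln r)"
proof -
  have "exp (- (alpha * ln r)) * xs d (ln r) = (exp (- (alpha * ln r)) * exp (alpha * ln r)) * fst (sol d) r"
    using r by (simp add: fowler_def)
  also have "exp (- (alpha * ln r)) * exp (alpha * ln r) = 1" by (simp only: exp_add[symmetric]) simp
  finally show 1: "reg_sol n q K1 K2 d r = exp (- (alpha * ln r)) * xs d (ln r)"
    using reg_sol_eq[OF g] r by simp
  have "r ^ (n - 2) = r powr real (n - 2)" using r by (simp add: powr_realpow)
  also have "\<dots> = exp ((lam + alpha) * ln r)" using r n_ge_3 by (simp add: powr_def lam_def of_nat_diff)
  finally have "reg_sol n q K1 K2 d r * r ^ (n - 2)
      = (exp (- (alpha * ln r)) * exp ((lam + alpha) * ln r)) * xs d (ln r)"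
    unfolding 1 by simp
  also have "exp (- (alpha * ln r)) * exp ((lam + alpha) * ln r) = exp (lam * ln r)"
    by (simp only: exp_add[symmetric]) (simp add: algebra_simps)
  finally show "reg_sol n q K1 K2 d r * r ^ (n - 2) = exp (lam * ln r) * xs d (ln r)" .
qed

lemma fowler_initial:
  assumes "good d"
  shows "0 < xs d 0" "xs d 0 \<noteq> 0 \<or> ys d 0 \<noteq> 0"
  using sol_positive(4)[OF assms, of 1] by (auto simp: fowler_0)

text \<open>
  There are no zeroes for \<open>r \<le> 1\<close>, and those beyond correspond to the zeroes of the orbit. A degenerate one would make
  \<open>x\<close> and \<open>y\<close> vanish together.
\<close>

lemma reg_sol_zeros:
  assumes g: "good d"
  shows "exactly_nondegenerate_zeroes (card (ef.zeros (xs d))) (reg_sol n q K1 K2 d)"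
proof -
  define u where "u = reg_sol n q K1 K2 d"
  have ueq: "u r = exp (- (alpha * ln r)) * xs d (ln r)" if "0 < r" for r
    unfolding u_def by (rule reg_sol_fowler(1)[OF g that])
  have zero: "u r = 0 \<longleftrightarrow> xs d (ln r) = 0" if "0 < r" for r using ueq[OF that] by simp
  have late: "1 < r" if "0 < r" "u r = 0" for r
    using sol_positive(4)[OF g, of r] reg_sol_eq[OF g, of r] that by (cases "r \<le> 1") (auto simp: u_def)
  have set: "{r. r > 0 \<and> u r = 0} = exp ` ef.zeros (xs d)"
  proof (rule set_eqI)
    fix r
    show "r \<in> {r. r > 0 \<and> u r = 0} \<longleftrightarrow> r \<in> exp ` ef.zeros (xs d)"
    proof
      assume r: "r \<in> {r. r > 0 \<and> u r = 0}"
      then have "ln r \<in> ef.zeros (xs d)" using late[of r] zero[of r] by (simp add: ef.zeros_def)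
      then have "exp (ln r) \<in> exp ` ef.zeros (xs d)" by (rule imageI)
      then show "r \<in> exp ` ef.zeros (xs d)" using r by simp
    next
      assume "r \<in> exp ` ef.zeros (xs d)"
      then obtain t where "t \<in> ef.zeros (xs d)" "r = exp t" by blast
      then show "r \<in> {r. r > 0 \<and> u r = 0}" using zero[of r] by (simp add: ef.zeros_def)
    qed
  qed
  have fin: "finite (ef.zeros (xs d))" by (rule ef.finite_zeros[OF fowler_traj[OF g] fowler_initial(1)[OF g]])
  have "deriv u r \<noteq> 0" if r: "0 < r" "u r = 0" for r
  proof
    assume z: "deriv u r = 0"
    have "(fst (sol d) has_real_derivative snd (sol d) r) (at r)"
      using r by (intro radD(4)[OF sol(2)[OF g, of "r + 1"]]) auto
    then have "(u has_real_derivative snd (sol d) r) (at r)"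
      by (rule has_field_derivative_transform_within_open[of _ _ _ "{0<..}"])
         (use r reg_sol_eq[OF g] in \<open>auto simp: u_def\<close>)
    then have v: "snd (sol d) r = 0" using z DERIV_imp_deriv by fastforce
    have "fst (sol d) r = 0" using r reg_sol_eq[OF g, of r] by (simp add: u_def)
    then have "xs d (ln r) = 0" "ys d (ln r) = 0" using v r by (simp_all add: fowler_def fowler_velocity_def)
    then show False
      using ef.nontrivial[OF fowler_traj[OF g] fowler_initial(2)[OF g], of "ln r"] late[OF r] by simp
  qed
  then show ?thesis unfolding exactly_nondegenerate_zeroes_def u_def[symmetric] set
    using fin by (simp add: card_image inj_on_def)
qed

lemma reg_sol_fast:
  assumes g: "good d" and fast: "ef.fast (xs d) (ys d)"
  shows "fast_decay_solution n q K1 K2 (reg_sol n q K1 K2 d)"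
proof -
  obtain L where L: "((\<lambda>t. exp (lam * t) * xs d t) \<longlongrightarrow> L) at_top"
    using ef.fast_decay[OF fowler_traj[OF g] fowler_initial(2)[OF g] fast] by blast
  have "((\<lambda>r. exp (lam * ln r) * xs d (ln r)) \<longlongrightarrow> L) at_top"
    by (rule filterlim_compose[OF L ln_at_top])
  moreover have "eventually (\<lambda>r. exp (lam * ln r) * xs d (ln r) = reg_sol n q K1 K2 d r * r ^ (n - 2)) at_top"
    using eventually_gt_at_top[of "0::real"] by eventually_elim (rule reg_sol_fowler(2)[OF g, symmetric])
  ultimately have "((\<lambda>r. reg_sol n q K1 K2 d r * r ^ (n - 2)) \<longlongrightarrow> L) at_top"
    by (rule Lim_transform_eventually)
  then show ?thesis unfolding fast_decay_solution_def using reg_sol_radial[OF g] by blast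
qed

lemma reg_sol_slow:
  assumes g: "good d" and slow: "\<not> ef.fast (xs d) (ys d)"
  shows "slow_decay_solution n q K1 K2 (reg_sol n q K1 K2 d)"
proof -
  have tr: "filterlim (\<lambda>r. reg_sol n q K1 K2 d r * r ^ (n - 2)) F at_top"
    if "filterlim (\<lambda>t. exp (lam * t) * xs d t) F at_top" for F
  proof -
    have "filterlim (\<lambda>r. exp (lam * ln r) * xs d (ln r)) F at_top"
      by (rule filterlim_compose[OF that ln_at_top])
    moreover have ev: "eventually (\<lambda>r. reg_sol n q K1 K2 d r * r ^ (n - 2)
        = exp (lam * ln r) * xs d (ln r)) at_top"
      using eventually_gt_at_top[of "0::real"] by eventually_elim (rule reg_sol_fowler(2)[OF g])
    ultimately show ?thesis by (subst filterlim_cong[OF refl refl ev])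
  qed
  show ?thesis unfolding slow_decay_solution_def
    using reg_sol_radial[OF g] ef.slow_growth[OF fowler_traj[OF g] slow] tr by blast
qed

lemma reg_sol_ground_state:
  assumes g: "good d" and nz: "card (ef.zeros (xs d)) = 0"
  shows "ground_state n q K1 K2 (reg_sol n q K1 K2 d)"
proof -
  note z = fowler_traj[OF g]
  have "ef.zeros (xs d) = {}" using nz ef.finite_zeros[OF z fowler_initial(1)[OF g]] by simp
  then have "xs d t \<noteq> 0" if "0 \<le> t" for t
    using that fowler_initial(1)[OF g] by (cases "t = 0") (auto simp: ef.zeros_def)
  then have pos: "0 < xs d t" if "0 \<le> t" for t
    using no_zero_constant_sign[of 0 "xs d"] ef.trajD(1)[OF z] fowler_initial(1)[OF g] that by fastforce
  have "0 < reg_sol n q K1 K2 d r" if "0 < r" for r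
  proof (cases "r \<le> 1")
    case True
    then show ?thesis using sol_positive(4)[OF g, of r] reg_sol_eq[OF g, of r] that by simp
  next
    case False
    then show ?thesis using pos[of "ln r"] reg_sol_fowler(1)[OF g that] by simp
  qed
  moreover have "(reg_sol n q K1 K2 d \<longlongrightarrow> 0) at_top"
  proof -
    obtain M where M: "\<And>t. 0 \<le> t \<Longrightarrow> \<bar>xs d t\<bar> \<le> M" using ef.traj_bound[OF z] by metis
    have "filterlim (\<lambda>r. alpha * ln r) at_top at_top"
      using filterlim_tendsto_pos_mult_at_top[OF tendsto_const alpha_pos ln_at_top] .
    then have "filterlim (\<lambda>r. - (alpha * ln r)) at_bot at_top"
      by (simp add: filterlim_uminus_at_top)
    then have "((\<lambda>r. exp (- (alpha * ln r))) \<longlongrightarrow> 0) at_top" by (rule filterlim_compose[OF exp_at_bot])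
    then have lim: "((\<lambda>r. exp (- (alpha * ln r)) * M) \<longlongrightarrow> 0) at_top" by (rule tendsto_mult_left_zero)
    have "eventually (\<lambda>r. norm (reg_sol n q K1 K2 d r) \<le> exp (- (alpha * ln r)) * M) at_top"
      using eventually_ge_at_top[of 1]
    proof eventually_elim
      case (elim r)
      then have "0 < r" "0 \<le> ln r" by auto
      then show ?case using reg_sol_fowler(1)[OF g \<open>0 < r\<close>] M[of "ln r"]
        by (simp add: abs_mult mult_left_mono)
    qed
    then show ?thesis by (rule Lim_null_comparison[OF _ lim])
  qed
  ultimately show ?thesis unfolding ground_state_def using reg_sol_regular[OF g] by blast
qed

end

section \<open>Structure of the set of regular solutions\<close>

theorem corollary1p1:
  fixes n :: nat and q K1 K2 :: real
  assumes "n \<ge> 3"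
    and "q > 2 * real n / (real n - 2)"
    and "K1 < 0"
    and "K2 > 0"
  shows "\<exists>(D :: nat \<Rightarrow> real) D_inf :: real.
    strict_mono D \<and> (\<forall>k. D k > 0) \<and> D \<longlonglongrightarrow> D_inf \<and>
    (ground_state n q K1 K2 (reg_sol n q K1 K2 (D 0)) \<and>
     fast_decay_solution n q K1 K2 (reg_sol n q K1 K2 (D 0))) \<and>
    (\<forall>k. regular_solution n q K1 K2 {0..} (D k) (reg_sol n q K1 K2 (D k)) \<and>
         fast_decay_solution n q K1 K2 (reg_sol n q K1 K2 (D k)) \<and>
         exactly_nondegenerate_zeroes k (reg_sol n q K1 K2 (D k))) \<and>
    (\<forall>d. 0 < d \<and> d < D 0 \<longrightarrow>
         ground_state n q K1 K2 (reg_sol n q K1 K2 d) \<and>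
         slow_decay_solution n q K1 K2 (reg_sol n q K1 K2 d)) \<and>
    (\<forall>k\<ge>1. \<forall>d. D (k - 1) < d \<and> d < D k \<longrightarrow>
         regular_solution n q K1 K2 {0..} d (reg_sol n q K1 K2 d) \<and>
         slow_decay_solution n q K1 K2 (reg_sol n q K1 K2 d) \<and>
         exactly_nondegenerate_zeroes k (reg_sol n q K1 K2 d))"
proof -
  interpret radial n q K1 K2 by unfold_locales (use assms in auto)
  obtain D where D: "strict_mono D"
    "\<And>k::nat. 0 < D k \<and> D k < dstar \<and> ef.fast (xs (D k)) (ys (D k)) \<and> card (ef.zeros (xs (D k))) = k"
    "\<And>d. 0 < d \<Longrightarrow> d < D 0 \<Longrightarrow> \<not> ef.fast (xs d) (ys d) \<and> card (ef.zeros (xs d)) = 0"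
    "\<And>k d. D k < d \<Longrightarrow> d < D (Suc k) \<Longrightarrow> \<not> ef.fast (xs d) (ys d) \<and> card (ef.zeros (xs d)) = Suc k"
    using shooting_structure by blast
  have g: "good (D k)" for k using D(2) good_iff by blast
  have "incseq D" using D(1) by (rule strict_mono_mono)
  moreover have "\<And>k. D k \<le> dstar" using D(2) by (simp add: less_imp_le)
  ultimately obtain D_inf where lim: "D \<longlonglongrightarrow> D_inf" using incseq_convergent[of D dstar] by metis
  have at: "regular_solution n q K1 K2 {0..} (D k) (reg_sol n q K1 K2 (D k)) \<and>
      fast_decay_solution n q K1 K2 (reg_sol n q K1 K2 (D k)) \<and>
      exactly_nondegenerate_zeroes k (reg_sol n q K1 K2 (D k))" for k
    using reg_sol_regular[OF g] reg_sol_fast[OF g] reg_sol_zeros[OF g, of k] D(2)[of k] by simp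
  have first: "ground_state n q K1 K2 (reg_sol n q K1 K2 (D 0))"
    using reg_sol_ground_state[OF g] D(2)[of 0] by simp
  have below: "ground_state n q K1 K2 (reg_sol n q K1 K2 d)
      \<and> slow_decay_solution n q K1 K2 (reg_sol n q K1 K2 d)"
    if d: "0 < d" "d < D 0" for d
  proof -
    have gd: "good d" using d D(2)[of 0] good_iff by auto
    show ?thesis using reg_sol_ground_state[OF gd] reg_sol_slow[OF gd] D(3)[OF d] by simp
  qed
  have between: "regular_solution n q K1 K2 {0..} d (reg_sol n q K1 K2 d) \<and>
      slow_decay_solution n q K1 K2 (reg_sol n q K1 K2 d) \<and>
      exactly_nondegenerate_zeroes k (reg_sol n q K1 K2 d)" if k: "1 \<le> k" and d: "D (k - 1) < d" "d < D k" for k d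
  proof -
    have gd: "good d" using d D(2)[of k] D(2)[of "k - 1"] good_iff by auto
    have "Suc (k - 1) = k" using k by simp
    then have "\<not> ef.fast (xs d) (ys d)" "card (ef.zeros (xs d)) = k" using D(4)[of "k - 1" d] d by auto
    then show ?thesis using reg_sol_regular[OF gd] reg_sol_slow[OF gd] reg_sol_zeros[OF gd] by simp
  qed
  show ?thesis
  proof (intro exI[of _ D] exI[of _ D_inf] conjI)
    show "strict_mono D" "D \<longlonglongrightarrow> D_inf" by fact+
    show "\<forall>k. 0 < D k" using D(2) by simp
  qed (use at first below between in simp_all)
qed

end
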